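(* Let $J$ be the real-valued random variable such that $\mathbb{P}(J\ge x)=1/x$ for $x\ge1$. Let $L$ be a slowly varying function at $\infty$ and let $\mu$ be a probability measure on $\mathbb{Z}_{\ge 0}$ with mean $\sum_{i\ge 0} i\mu(i)=1$ and $\mu([n,\infty))\sim L(n)/n$ as $n\to\infty$. Let $\mathcal{T}_{\ge n}$ be a $\mathrm{BGW}_\mu$ tree conditioned on having at least $n$ vertices, and let $\mathsf{W}(\mathcal{T}_{\ge n})$ be its Łukasiewicz path. Then the convergence $$\left(\frac{\mathsf{W}_{\lfloor nt\rfloor}(\mathcal{T}_{\ge n})}{|b_n|}:t\ge-1\right)\ \longrightarrow\ \left((J-t)\mathbf{1}_{t\ge 0}:t\ge-1\right)$$ holds in distribution in $\mathbb{D}([-1,\infty),\mathbb{R})$ as $n\to\infty$. In addition, the convergence $$\frac{|\mathcal{T}_{\ge n}|}{n}\ \longrightarrow\ J$$ holds jointly in distribution.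
   Context: A plane tree $\tau$ is a rooted ordered tree; $k_v(\tau)$ denotes the number of children of the vertex $v$ and $|\tau|$ the number of vertices. A $\mathrm{BGW}_\mu$ (Bienaymé--Galton--Watson) tree is a random plane tree with law $\mathrm{BGW}_\mu(\tau)=\prod_{u\in\tau}\mu(k_u(\tau))$ for every finite plane tree $\tau$. Łukasiewicz path: if $u_0\prec u_1\prec\cdots\prec u_{|\tau|-1}$ are the vertices of $\tau$ in lexicographical (depth-first) order, then $\mathsf{W}_0(\tau)=0$ and $\mathsf{W}_{i+1}(\tau)=\mathsf{W}_i(\tau)+k_{u_i}(\tau)-1$ for $0\le i<|\tau|$; moreover, by convention, $\mathsf{W}_i(\tau)=0$ for $i>|\tau|$ or $i<0$. Scaling constants: let $X$ have law $\mathbb{P}(X=i)=\mu(i+1)$, $i\ge -1$. $(a_n)_{n\ge1}$ and $(b_n)_{n\ge1}$ are sequences such that $n\,\mathbb{P}(X\ge a_n)\to 1$ as $n\to\infty$ and $b_n=n\,\mathbb{E}[X\mathbf{1}_{|X|\le a_n}]$ (one has $b_n\to-\infty$). $\mathbb{D}([-1,\infty),\mathbb{R})$ is the space of real-valued càdlàg functions on $[-1,\infty)$ equipped with the Skorokhod $J_1$ topology.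
   Formalization: The limit path is taken as (J−t) for 0≤t≤J and 0 for t>J, not (J−t) for all t≥0: since W is set to 0 after time |τ| and is always at least −1, the displayed limit, which is negative for t>J, cannot be attained. *)

theory Defs
  imports
    "HOL-Probability.Probability"
    "HOL-Library.Landau_Symbols"
    "HOL-Library.List_Lexorder"
begin

subsection \<open>Plane trees and their Lukasiewicz paths\<close>

datatype plane_tree = Node (subtrees: "plane_tree list")

text \<open>
  Vertices are Ulam-Harris words: the empty word is the root, and \<open>i # u\<close> is the vertex \<open>u\<close> of the
  subtree hanging from the \<open>i\<close>-th child of the root (children are numbered from 0).
\<close>

primrec is_vertex :: "plane_tree \<Rightarrow> nat list \<Rightarrow> bool" where
  "is_vertex \<tau> [] \<longleftrightarrow> True"
| "is_vertex \<tau> (i # u) \<longleftrightarrow> i < length (subtrees \<tau>) \<and> is_vertex (subtrees \<tau> ! i) u"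

primrec subtree_at :: "plane_tree \<Rightarrow> nat list \<Rightarrow> plane_tree" where
  "subtree_at \<tau> [] = \<tau>"
| "subtree_at \<tau> (i # u) = subtree_at (subtrees \<tau> ! i) u"

definition vertices :: "plane_tree \<Rightarrow> nat list set" where
  "vertices \<tau> = {u. is_vertex \<tau> u}"

definition num_children :: "plane_tree \<Rightarrow> nat list \<Rightarrow> nat" where
  "num_children \<tau> u = length (subtrees (subtree_at \<tau> u))"

definition tree_size :: "plane_tree \<Rightarrow> nat" where
  "tree_size \<tau> = card (vertices \<tau>)"

lemma vertices_rec:
  "vertices \<tau> = insert [] (\<Union>i<length (subtrees \<tau>). (#) i ` vertices (subtrees \<tau> ! i))"
proof (rule set_eqI)
  fix u
  show "u \<in> vertices \<tau> \<longleftrightarrow>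
    u \<in> insert [] (\<Union>i<length (subtrees \<tau>). (#) i ` vertices (subtrees \<tau> ! i))"
    by (cases u) (auto simp: vertices_def)
qed

lemma finite_vertices [simp]: "finite (vertices \<tau>)"
proof (induction \<tau>)
  case (Node ts)
  then show ?case
    by (subst vertices_rec) auto
qed

lemma tree_size_pos: "tree_size \<tau> > 0"
  unfolding tree_size_def card_gt_0_iff by (subst vertices_rec) simp

text \<open>The order on words used by \<^const>\<open>sorted_list_of_set\<close> is the lexicographic order.\<close>

definition vertex_nth :: "plane_tree \<Rightarrow> nat \<Rightarrow> nat list" where
  "vertex_nth \<tau> i = sorted_list_of_set (vertices \<tau>) ! i"

definition lukasiewicz :: "plane_tree \<Rightarrow> int \<Rightarrow> int" where
  "lukasiewicz \<tau> i =
    (if 0 \<le> i \<and> i \<le> int (tree_size \<tau>)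
     then \<Sum>j<nat i. int (num_children \<tau> (vertex_nth \<tau> j)) - 1
     else 0)"

lemma lukasiewicz_0: "lukasiewicz \<tau> 0 = 0"
  by (simp add: lukasiewicz_def)

lemma lukasiewicz_Suc:
  assumes "i < tree_size \<tau>"
  shows "lukasiewicz \<tau> (int (Suc i)) =
    lukasiewicz \<tau> (int i) + int (num_children \<tau> (vertex_nth \<tau> i)) - 1"
proof -
  have "nat (int (Suc i)) = Suc i" "int (Suc i) \<le> int (tree_size \<tau>)"
    using assms by auto
  then show ?thesis
    unfolding lukasiewicz_def by simp
qed


subsection \<open>Bienayme--Galton--Watson trees\<close>

text \<open>
  The law is carried by the finite trees; for a critical offspring distribution other than the
  point mass at 1 this is the whole mass.
\<close>

definition BGW :: "nat pmf \<Rightarrow> plane_tree measure" where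
  "BGW \<mu> = density (count_space UNIV)
     (\<lambda>\<tau>. ennreal (\<Prod>u\<in>vertices \<tau>. pmf \<mu> (num_children \<tau> u)))"

definition BGW_ge :: "nat pmf \<Rightarrow> nat \<Rightarrow> plane_tree measure" where
  "BGW_ge \<mu> n = uniform_measure (BGW \<mu>) {\<tau>. tree_size \<tau> \<ge> n}"

lemma emeasure_BGW_singleton:
  "emeasure (BGW \<mu>) {\<tau>} = ennreal (\<Prod>u\<in>vertices \<tau>. pmf \<mu> (num_children \<tau> u))"
  by (simp add: BGW_def emeasure_density nn_integral_count_space_indicator[symmetric]
      nn_integral_count_space_finite)

text \<open>The law of \<open>X\<close>, with \<open>P(X = i) = \<mu>(i + 1)\<close> for \<open>i \<ge> -1\<close>.\<close>

definition step_pmf :: "nat pmf \<Rightarrow> int pmf" where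
  "step_pmf \<mu> = map_pmf (\<lambda>i. int i - 1) \<mu>"

lemma pmf_step_pmf: "pmf (step_pmf \<mu>) (int k - 1) = pmf \<mu> k"
proof -
  have "inj (\<lambda>i. int i - 1)"
    by (auto intro: injI)
  then show ?thesis
    unfolding step_pmf_def by (rule pmf_map_inj')
qed


subsection \<open>Slowly varying functions\<close>

definition slowly_varying :: "(real \<Rightarrow> real) \<Rightarrow> bool" where
  "slowly_varying L \<longleftrightarrow>
    (\<exists>A>0. L \<in> borel_measurable (restrict_space borel {A..}) \<and> (\<forall>x\<ge>A. L x > 0)) \<and>
    (\<forall>c>0. ((\<lambda>x. L (c * x) / L x) \<longlongrightarrow> 1) at_top)"


subsection \<open>The Skorokhod \<open>J\<^sub>1\<close> topology on \<open>D([a, \<infinity>), \<real>)\<close>\<close>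

text \<open>Functions on \<open>[a, \<infinity>)\<close> are functions on \<open>\<real>\<close> that are \<^const>\<open>undefined\<close> off \<open>[a, \<infinity>)\<close>.\<close>

definition cadlag_space :: "real \<Rightarrow> (real \<Rightarrow> real) set" where
  "cadlag_space a = {f \<in> extensional {a..}.
     (\<forall>t\<ge>a. (f \<longlongrightarrow> f t) (at_right t)) \<and> (\<forall>t>a. \<exists>l. (f \<longlongrightarrow> l) (at_left t))}"

text \<open>Increasing bijections of \<open>[a, \<infinity>)\<close> are automatically homeomorphisms and fix \<open>a\<close>.\<close>

definition time_changes :: "real \<Rightarrow> (real \<Rightarrow> real) set" where
  "time_changes a = {\<theta>. strict_mono_on {a..} \<theta> \<and> bij_betw \<theta> {a..} {a..}}"

definition J1_nbhd :: "real \<Rightarrow> (real \<Rightarrow> real) \<Rightarrow> real \<Rightarrow> real \<Rightarrow> (real \<Rightarrow> real) set" where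
  "J1_nbhd a f T e = {g \<in> cadlag_space a. \<exists>\<theta>\<in>time_changes a. \<exists>d<e.
     (\<forall>t\<ge>a. \<bar>\<theta> t - t\<bar> \<le> d) \<and> (\<forall>t\<in>{a..T}. \<bar>g (\<theta> t) - f t\<bar> \<le> d)}"

text \<open>
  The sets above form a neighbourhood base at \<open>f\<close>. By \<open>limitin_skorokhod_J1\<close> below, \<open>f\<^sub>n\<close> tends to \<open>f\<close>
  iff there are time changes \<open>\<theta>\<^sub>n\<close> with \<open>sup\<^sub>t \<bar>\<theta>\<^sub>n t - t\<bar>\<close> tending to 0 and
  \<open>\<bar>f\<^sub>n (\<theta>\<^sub>n t) - f t\<bar>\<close> tending to 0 uniformly on every \<open>[a, T]\<close>, which is the usual characterisation of the
  (metrizable) \<open>J\<^sub>1\<close> topology on a half-line (Jacod and Shiryaev, Theorem VI.1.14).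
\<close>

definition skorokhod_J1 :: "real \<Rightarrow> (real \<Rightarrow> real) topology" where
  "skorokhod_J1 a = topology (\<lambda>U. U \<subseteq> cadlag_space a \<and>
     (\<forall>f\<in>U. \<exists>T. \<exists>e>0. J1_nbhd a f T e \<subseteq> U))"

lemma J1_nbhd_mono: "T \<le> T' \<Longrightarrow> e' \<le> e \<Longrightarrow> J1_nbhd a f T' e' \<subseteq> J1_nbhd a f T e"
  unfolding J1_nbhd_def by (force intro: order_less_le_trans)

lemma openin_skorokhod_J1:
  "openin (skorokhod_J1 a) U \<longleftrightarrow>
     U \<subseteq> cadlag_space a \<and> (\<forall>f\<in>U. \<exists>T. \<exists>e>0. J1_nbhd a f T e \<subseteq> U)"
proof -
  have "istopology (\<lambda>U. U \<subseteq> cadlag_space a \<and> (\<forall>f\<in>U. \<exists>T. \<exists>e>0. J1_nbhd a f T e \<subseteq> U))"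
    unfolding istopology_def
  proof (intro conjI allI impI ballI)
    fix S S' f
    assume S: "S \<subseteq> cadlag_space a \<and> (\<forall>f\<in>S. \<exists>T. \<exists>e>0. J1_nbhd a f T e \<subseteq> S)"
      and S': "S' \<subseteq> cadlag_space a \<and> (\<forall>f\<in>S'. \<exists>T. \<exists>e>0. J1_nbhd a f T e \<subseteq> S')"
      and f: "f \<in> S \<inter> S'"
    obtain T e where 1: "e > 0" "J1_nbhd a f T e \<subseteq> S"
      using S f by blast
    obtain T' e' where 2: "e' > 0" "J1_nbhd a f T' e' \<subseteq> S'"
      using S' f by blast
    have "J1_nbhd a f (max T T') (min e e') \<subseteq> S \<inter> S'"
      using 1(2) 2(2) J1_nbhd_mono[of T "max T T'" "min e e'" e a f]
        J1_nbhd_mono[of T' "max T T'" "min e e'" e' a f] by auto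
    then show "\<exists>T. \<exists>e>0. J1_nbhd a f T e \<subseteq> S \<inter> S'"
      using 1(1) 2(1) by (intro exI[of _ "max T T'"] exI[of _ "min e e'"]) auto
  next
    fix K f
    assume K: "\<forall>S\<in>K. S \<subseteq> cadlag_space a \<and> (\<forall>f\<in>S. \<exists>T. \<exists>e>0. J1_nbhd a f T e \<subseteq> S)"
      and "f \<in> \<Union>K"
    then obtain S where "S \<in> K" "f \<in> S"
      by blast
    with K obtain T e where "e > 0" "J1_nbhd a f T e \<subseteq> S"
      by blast
    with \<open>S \<in> K\<close> show "\<exists>T. \<exists>e>0. J1_nbhd a f T e \<subseteq> \<Union>K"
      by blast
  qed blast+
  then show ?thesis
    unfolding skorokhod_J1_def by (simp add: topology_inverse')
qed

lemma topspace_skorokhod_J1 [simp]: "topspace (skorokhod_J1 a) = cadlag_space a"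
proof -
  have "openin (skorokhod_J1 a) (cadlag_space a)"
    unfolding openin_skorokhod_J1 J1_nbhd_def by (auto intro!: exI[of _ 1])
  then show ?thesis
    by (metis openin_skorokhod_J1 openin_subset openin_topspace subset_antisym)
qed

lemma time_changes_id: "(\<lambda>t. t) \<in> time_changes a"
  by (auto simp: time_changes_def strict_mono_on_def bij_betw_def)

lemma time_changes_comp:
  assumes "\<theta> \<in> time_changes a" "\<rho> \<in> time_changes a"
  shows "(\<lambda>t. \<rho> (\<theta> t)) \<in> time_changes a"
proof -
  have "bij_betw (\<rho> \<circ> \<theta>) {a..} {a..}"
    using assms by (auto simp: time_changes_def intro: bij_betw_trans)
  moreover have "strict_mono_on {a..} (\<lambda>t. \<rho> (\<theta> t))"
    using assms unfolding time_changes_def strict_mono_on_def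
    by (auto dest: bij_betwE)
  ultimately show ?thesis
    by (simp add: time_changes_def comp_def)
qed

lemma J1_nbhd_self:
  assumes "f \<in> cadlag_space a" "e > 0"
  shows "f \<in> J1_nbhd a f T e"
  unfolding J1_nbhd_def using assms time_changes_id
  by (auto intro!: bexI[of _ "\<lambda>t. t"] exI[of _ 0])

lemma openin_J1_nbhd: "openin (skorokhod_J1 a) (J1_nbhd a f T e)"
  unfolding openin_skorokhod_J1
proof (intro conjI ballI)
  show "J1_nbhd a f T e \<subseteq> cadlag_space a"
    by (auto simp: J1_nbhd_def)
next
  fix g assume "g \<in> J1_nbhd a f T e"
  then obtain \<theta> d where g: "\<theta> \<in> time_changes a" "d < e"
    "\<And>t. t \<ge> a \<Longrightarrow> \<bar>\<theta> t - t\<bar> \<le> d" "\<And>t. t \<in> {a..T} \<Longrightarrow> \<bar>g (\<theta> t) - f t\<bar> \<le> d"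
    by (auto simp: J1_nbhd_def)
  have ran: "\<theta> t \<ge> a" if "t \<ge> a" for t
    using g(1) that by (auto simp: time_changes_def dest: bij_betwE)
  have "J1_nbhd a g (T + d) (e - d) \<subseteq> J1_nbhd a f T e"
  proof
    fix h assume "h \<in> J1_nbhd a g (T + d) (e - d)"
    then obtain \<rho> d' where h: "h \<in> cadlag_space a" "\<rho> \<in> time_changes a" "d' < e - d"
      "\<And>t. t \<ge> a \<Longrightarrow> \<bar>\<rho> t - t\<bar> \<le> d'" "\<And>t. t \<in> {a..T + d} \<Longrightarrow> \<bar>h (\<rho> t) - g t\<bar> \<le> d'"
      by (auto simp: J1_nbhd_def)
    have "\<bar>\<rho> (\<theta> t) - t\<bar> \<le> d + d'" if "t \<ge> a" for t
      using g(3)[OF that] h(4)[OF ran[OF that]] by linarith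
    moreover have "\<bar>h (\<rho> (\<theta> t)) - f t\<bar> \<le> d + d'" if "t \<in> {a..T}" for t
    proof -
      have "\<theta> t \<in> {a..T + d}"
        using that ran[of t] g(3)[of t] by auto
      then show ?thesis
        using g(4)[OF that] h(5)[of "\<theta> t"] by linarith
    qed
    moreover have "d + d' < e"
      using h(3) by linarith
    ultimately show "h \<in> J1_nbhd a f T e"
      unfolding J1_nbhd_def using h(1) time_changes_comp[OF g(1) h(2)]
      by (auto intro!: bexI[of _ "\<lambda>t. \<rho> (\<theta> t)"] exI[of _ "d + d'"])
  qed
  then show "\<exists>T'. \<exists>e'>0. J1_nbhd a g T' e' \<subseteq> J1_nbhd a f T e"
    using g(2) by (intro exI[of _ "T + d"] exI[of _ "e - d"]) auto
qed

lemma limitin_skorokhod_J1_nbhd: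
  "limitin (skorokhod_J1 a) X f F \<longleftrightarrow>
     f \<in> cadlag_space a \<and> (\<forall>T. \<forall>e>0. \<forall>\<^sub>F n in F. X n \<in> J1_nbhd a f T e)"
proof
  assume "limitin (skorokhod_J1 a) X f F"
  then show "f \<in> cadlag_space a \<and> (\<forall>T. \<forall>e>0. \<forall>\<^sub>F n in F. X n \<in> J1_nbhd a f T e)"
    using openin_J1_nbhd J1_nbhd_self by (auto simp: limitin_def)
next
  assume *: "f \<in> cadlag_space a \<and> (\<forall>T. \<forall>e>0. \<forall>\<^sub>F n in F. X n \<in> J1_nbhd a f T e)"
  show "limitin (skorokhod_J1 a) X f F"
    unfolding limitin_def topspace_skorokhod_J1
  proof (intro conjI allI impI)
    fix U assume "openin (skorokhod_J1 a) U \<and> f \<in> U"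
    then obtain T e where U: "e > 0" "J1_nbhd a f T e \<subseteq> U"
      unfolding openin_skorokhod_J1 by blast
    have "\<forall>\<^sub>F n in F. X n \<in> J1_nbhd a f T e"
      using * U(1) by simp
    then show "\<forall>\<^sub>F n in F. X n \<in> U"
      by (rule eventually_mono) (use U(2) in blast)
  qed (use * in blast)
qed

lemma limitin_skorokhod_J1:
  assumes X: "\<And>n. X n \<in> cadlag_space a" and f: "f \<in> cadlag_space a"
  shows "limitin (skorokhod_J1 a) X f sequentially \<longleftrightarrow>
    (\<exists>\<theta>. (\<forall>n. \<theta> n \<in> time_changes a) \<and>
       uniform_limit {a..} \<theta> (\<lambda>t. t) sequentially \<and>
       (\<forall>T. uniform_limit {a..T} (\<lambda>n t. X n (\<theta> n t)) f sequentially))" (is "?L \<longleftrightarrow> ?R")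
proof
  assume ?R
  then obtain \<theta> where \<theta>: "\<And>n. \<theta> n \<in> time_changes a"
    and u: "uniform_limit {a..} \<theta> (\<lambda>t. t) sequentially"
    and v: "\<And>T. uniform_limit {a..T} (\<lambda>n t. X n (\<theta> n t)) f sequentially"
    by blast
  have "\<forall>\<^sub>F n in sequentially. X n \<in> J1_nbhd a f T e" if "e > 0" for T e
  proof -
    have "\<forall>\<^sub>F n in sequentially. \<forall>t\<in>{a..}. dist (\<theta> n t) t < e / 2"
      using u[unfolded uniform_limit_iff, rule_format, of "e / 2"] that by simp
    moreover have "\<forall>\<^sub>F n in sequentially. \<forall>t\<in>{a..T}. dist (X n (\<theta> n t)) (f t) < e / 2"
      using v[of T, unfolded uniform_limit_iff, rule_format, of "e / 2"] that by simp
    ultimately show ?thesis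
    proof eventually_elim
      case (elim n)
      have "\<forall>t\<ge>a. \<bar>\<theta> n t - t\<bar> \<le> e / 2"
        using elim(1) by (force simp: dist_real_def)
      moreover have "\<forall>t\<in>{a..T}. \<bar>X n (\<theta> n t) - f t\<bar> \<le> e / 2"
        using elim(2) by (force simp: dist_real_def)
      moreover have "e / 2 < e"
        using that by simp
      ultimately show ?case
        unfolding J1_nbhd_def using X \<theta> by blast
    qed
  qed
  then show ?L
    using f by (simp add: limitin_skorokhod_J1_nbhd)
next
  assume ?L
  then have ev: "\<forall>\<^sub>F n in sequentially. X n \<in> J1_nbhd a f T e" if "e > 0" for T e
    using that by (simp add: limitin_skorokhod_J1_nbhd)
  define P where "P n k \<longleftrightarrow> X n \<in> J1_nbhd a f (real k) (inverse (real (Suc k)))" for n k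
  have "\<exists>\<eta>. \<eta> \<in> time_changes a \<and> (\<forall>k. k \<le> n \<and> P n k \<longrightarrow>
      (\<forall>t\<ge>a. \<bar>\<eta> t - t\<bar> < inverse (real (Suc k))) \<and>
      (\<forall>t\<in>{a..real k}. \<bar>X n (\<eta> t) - f t\<bar> < inverse (real (Suc k))))" for n
  proof (cases "{k. k \<le> n \<and> P n k} = {}")
    case True
    then show ?thesis
      using time_changes_id by blast
  next
    case False
    define m where "m = Max {k. k \<le> n \<and> P n k}"
    have fin: "finite {k. k \<le> n \<and> P n k}"
      by simp
    have "P n m"
      using Max_in[OF fin False] by (simp add: m_def)
    then obtain \<eta> d where \<eta>: "\<eta> \<in> time_changes a" "d < inverse (real (Suc m))"
      "\<And>t. t \<ge> a \<Longrightarrow> \<bar>\<eta> t - t\<bar> \<le> d" "\<And>t. t \<in> {a..real m} \<Longrightarrow> \<bar>X n (\<eta> t) - f t\<bar> \<le> d"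
      by (auto simp: P_def J1_nbhd_def)
    have "(\<forall>t\<ge>a. \<bar>\<eta> t - t\<bar> < inverse (real (Suc k))) \<and>
      (\<forall>t\<in>{a..real k}. \<bar>X n (\<eta> t) - f t\<bar> < inverse (real (Suc k)))" if "k \<le> n \<and> P n k" for k
    proof -
      have km: "k \<le> m"
        unfolding m_def using fin that by (intro Max_ge) auto
      then have "inverse (real (Suc m)) \<le> inverse (real (Suc k))"
        by (intro le_imp_inverse_le) auto
      then have d: "d < inverse (real (Suc k))"
        using \<eta>(2) by linarith
      have "\<bar>\<eta> t - t\<bar> < inverse (real (Suc k))" if "t \<ge> a" for t
        using \<eta>(3)[OF that] d by linarith
      moreover have "\<bar>X n (\<eta> t) - f t\<bar> < inverse (real (Suc k))" if "t \<in> {a..real k}" for t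
        using \<eta>(4)[of t] that d km by fastforce
      ultimately show ?thesis
        by blast
    qed
    with \<eta>(1) show ?thesis
      by blast
  qed
  then obtain \<theta> where \<theta>: "\<And>n. \<theta> n \<in> time_changes a"
    and \<theta>': "\<And>n k. k \<le> n \<Longrightarrow> P n k \<Longrightarrow>
      (\<forall>t\<ge>a. \<bar>\<theta> n t - t\<bar> < inverse (real (Suc k))) \<and>
      (\<forall>t\<in>{a..real k}. \<bar>X n (\<theta> n t) - f t\<bar> < inverse (real (Suc k)))"
    by metis
  have evP: "\<forall>\<^sub>F n in sequentially. k \<le> n \<and> P n k" for k
    unfolding P_def by (intro eventually_conj eventually_ge_at_top ev) simp
  have "uniform_limit {a..} \<theta> (\<lambda>t. t) sequentially"
    unfolding uniform_limit_iff
  proof (intro allI impI)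
    fix e :: real assume "e > 0"
    then obtain k where k: "inverse (real (Suc k)) < e"
      using reals_Archimedean by blast
    show "\<forall>\<^sub>F n in sequentially. \<forall>t\<in>{a..}. dist (\<theta> n t) t < e"
      using evP[of k]
    proof eventually_elim
      case (elim n)
      then show ?case
        using \<theta>'[of k n] k by (auto simp: dist_real_def intro: order.strict_trans)
    qed
  qed
  moreover have "uniform_limit {a..T} (\<lambda>n t. X n (\<theta> n t)) f sequentially" for T
    unfolding uniform_limit_iff
  proof (intro allI impI)
    fix e :: real assume "e > 0"
    then obtain k where k: "inverse (real (Suc k)) < e"
      using reals_Archimedean by blast
    define j where "j = max k (nat \<lceil>T\<rceil>)"
    have "inverse (real (Suc j)) \<le> inverse (real (Suc k))"
      by (intro le_imp_inverse_le) (auto simp: j_def)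
    then have j: "inverse (real (Suc j)) < e"
      using k by linarith
    have jT: "T \<le> real j"
      using of_nat_mono[of "nat \<lceil>T\<rceil>" j, where 'a = real] real_nat_ceiling_ge[of T]
      by (simp add: j_def)
    show "\<forall>\<^sub>F n in sequentially. \<forall>t\<in>{a..T}. dist (X n (\<theta> n t)) (f t) < e"
      using evP[of j]
    proof eventually_elim
      case (elim n)
      then show ?case
        using \<theta>'[of j n] j jT by (auto simp: dist_real_def intro: order.strict_trans)
    qed
  qed
  ultimately show ?R
    using \<theta> by blast
qed


subsection \<open>Convergence in distribution\<close>

definition borel_of :: "'a topology \<Rightarrow> 'a measure" where
  "borel_of S = sigma (topspace S) {U. openin S U}"

definition random_element :: "'a topology \<Rightarrow> 'b measure \<Rightarrow> ('b \<Rightarrow> 'a) \<Rightarrow> bool" where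
  "random_element S M X \<longleftrightarrow> prob_space M \<and> X \<in> M \<rightarrow>\<^sub>M borel_of S"

text \<open>
  The random elements \<open>X n\<close> and the limit \<open>Y\<close> of the topological space \<open>S\<close> may live on different
  probability spaces \<open>M n\<close> and \<open>N\<close>.
\<close>

definition converges_in_distribution ::
  "'a topology \<Rightarrow> (nat \<Rightarrow> 'b measure) \<Rightarrow> (nat \<Rightarrow> 'b \<Rightarrow> 'a) \<Rightarrow> 'c measure \<Rightarrow> ('c \<Rightarrow> 'a) \<Rightarrow> bool" where
  "converges_in_distribution S M X N Y \<longleftrightarrow>
    (\<forall>n. random_element S (M n) (X n)) \<and> random_element S N Y \<and>
    (\<forall>F. continuous_map S euclideanreal F \<and> bounded (F ` topspace S) \<longrightarrow>
      (\<lambda>n. \<integral>\<omega>. F (X n \<omega>) \<partial>M n) \<longlonglongrightarrow> (\<integral>\<omega>. F (Y \<omega>) \<partial>N))"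


subsection \<open>The rescaled path and its limit\<close>

definition rescaled_path :: "nat \<Rightarrow> real \<Rightarrow> plane_tree \<Rightarrow> real \<Rightarrow> real" where
  "rescaled_path n c \<tau> = (\<lambda>t\<in>{-1..}. real_of_int (lukasiewicz \<tau> \<lfloor>real n * t\<rfloor>) / c)"

text \<open>
  The path \<open>(x - t) 1\<^bsub>t \<ge> 0\<^esub>\<close>, killed at its lifetime \<open>x\<close> exactly as \<^const>\<open>lukasiewicz\<close> is killed after
  \<^const>\<open>tree_size\<close>. Without the killing \<open>x - t\<close> would become negative for \<open>t > x\<close>, whereas
  \<^const>\<open>lukasiewicz\<close> is bounded below by \<open>-1\<close>.
\<close>

definition limit_path :: "real \<Rightarrow> real \<Rightarrow> real" where
  "limit_path x = (\<lambda>t\<in>{-1..}. if 0 \<le> t \<and> t \<le> x then x - t else 0)"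

end

theory Submission
  imports Defs "HOL-Real_Asymp.Real_Asymp"
begin

text \<open>
  The preorder list of child counts turns a tree into a first-passage word of the walk with steps
  \<open>k - 1\<close>, so \<open>|\<T>| \<ge> n\<close> means that the walk survives (stays nonnegative) for \<open>n - 1\<close> steps.
  Put \<open>B = |b\<^sub>n|\<close>. Kill the walk at its first jump above \<open>\<epsilon>B\<close>. The killed walk has drift about \<open>-B/n\<close>;
  stopping the martingale \<open>S + 1\<close> shows that its expected lifetime is asymptotic to \<open>n/B\<close>, and an exponential
  supermartingale vanishing at \<open>-1\<close> shows that it neither survives for \<open>\<eta>n\<close> steps nor reaches height
  \<open>eB\<close> before a big jump, up to probability \<open>o(n P(X \<ge> B)/B)\<close>. After the big jump the walk follows the
  line of slope \<open>-B/n\<close> by Kolmogorov's inequality. Hence \<open>P(|\<T>| \<ge> xn)\<close> is asymptotic to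
  \<open>(n/B) P(X \<ge> xB)\<close>, which gives the law of the size, and off a negligible event the path is \<open>J\<^sub>1\<close>-close to the
  limit path with lifetime \<open>|\<T>|/n\<close>; weak convergence of the size on the line then suffices.
\<close>

section \<open>Random walk words\<close>

text \<open>The conditioning event has probability of order \<open>f n\<close> = s / B with s = n
  \<open>tail p (B n)\<close>, which tends to 0; each error therefore has to be o(s / B). This order
  arises as the probability s / n of one jump of order B times the expected number n / B of times at
  which it can occur. For the errors, the factor 1 / B comes from the test function exp (l (x + 1))
  - 1, which is only of order l at the starting point, and the remaining gain from tuning l = R /
  (\<epsilon> B) with s = exp (-2 R): the quadratic term of the exponential moment is then o(B / n),
  while \<eta> n steps still gain a power of s. Tail index -1 is a boundary case: the truncated mean
  of X varies slowly and dominates x P(X \<ge> x). Since b_n is truncated at a_n but used at the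
  level \<epsilon> B, its stability between these levels has to be proved; a_n = o(B) and a
  square-root bound on the first moment in between give it. The limit path reaches 0 exactly when it
  is killed, so it depends on its lifetime continuously, even in the uniform norm.\<close>

definition steps :: "nat list \<Rightarrow> int" where
  "steps w = (\<Sum>k\<leftarrow>w. int k - 1)"

text \<open>Both the starting height and the final one are tested: a word of length n tests n + 1
  heights of the walk started at x.\<close>

fun surv :: "int \<Rightarrow> nat list \<Rightarrow> bool" where
  "surv x [] \<longleftrightarrow> 0 \<le> x"
| "surv x (k # w) \<longleftrightarrow> 0 \<le> x \<and> surv (x + int k - 1) w"

definition confined :: "nat \<Rightarrow> int \<Rightarrow> nat list \<Rightarrow> bool" where
  "confined D x w \<longleftrightarrow> surv x w \<and> (\<forall>k\<in>set w. k \<le> D)"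

lemma steps_simps [simp]:
  "steps [] = 0" "steps (k # w) = int k - 1 + steps w" "steps (u @ v) = steps u + steps v"
  by (simp_all add: steps_def)

lemma steps_ge: "steps w \<ge> - int (length w)"
  by (induction w) auto

lemma surv_append: "surv x (u @ v) \<longleftrightarrow> surv x u \<and> surv (x + steps u) v"
proof (induction u arbitrary: x)
  case Nil
  then show ?case by (cases v) auto
qed (auto simp: algebra_simps)

lemma surv_iff: "surv x w \<longleftrightarrow> (\<forall>i\<le>length w. 0 \<le> x + steps (take i w))"
proof (induction w arbitrary: x)
  case (Cons k w)
  have "(\<forall>i\<le>Suc n. P i) \<longleftrightarrow> P 0 \<and> (\<forall>i\<le>n. P (Suc i))" for n P
    by (metis Suc_le_mono le0 not0_implies_Suc)
  with Cons show ?case by (simp add: algebra_simps)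
qed simp

lemma surv_take: "surv x w \<Longrightarrow> surv x (take i w)"
  by (metis append_take_drop_id surv_append)

lemma confined_Nil [simp]: "confined D x [] \<longleftrightarrow> 0 \<le> x"
  by (simp add: confined_def)

lemma confined_Cons [simp]:
  "confined D x (k # w) \<longleftrightarrow> 0 \<le> x \<and> k \<le> D \<and> confined D (x + int k - 1) w"
  by (auto simp: confined_def)

lemma confined_imp_nonneg: "confined D x w \<Longrightarrow> 0 \<le> x"
  by (cases w) auto

section \<open>Laws of i.i.d. words and independence of their pieces\<close>

abbreviation word_prob :: "nat pmf \<Rightarrow> nat \<Rightarrow> nat list set \<Rightarrow> real" where
  "word_prob p n \<equiv> measure_pmf.prob (replicate_pmf n p)"

lemma prob_replicate_Suc:
  "word_prob p (Suc n) A =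
    (\<integral>k. word_prob p n {w. k # w \<in> A} \<partial>measure_pmf p)"
proof -
  have "replicate_pmf (Suc n) p = bind_pmf p (\<lambda>k. map_pmf ((#) k) (replicate_pmf n p))"
    by (simp add: map_pmf_def)
  then have "ennreal (word_prob p (Suc n) A) =
    (\<integral>\<^sup>+k. ennreal (word_prob p n {w. k # w \<in> A}) \<partial>measure_pmf p)"
    by (simp add: measure_pmf.emeasure_eq_measure[symmetric] vimage_def)
  also have "\<dots> = ennreal (\<integral>k. word_prob p n {w. k # w \<in> A} \<partial>measure_pmf p)"
    by (intro nn_integral_eq_integral measure_pmf.integrable_const_bound[where B = 1]) auto
  finally show ?thesis
    by (simp add: integral_nonneg_AE)
qed

lemma AE_replicate_length: "AE w in measure_pmf (replicate_pmf n p). length w = n"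
  by (auto simp: AE_measure_pmf_iff set_replicate_pmf)

lemma prob_replicate_append:
  fixes p :: "nat pmf"
  shows "word_prob p (m + n) {w. take m w \<in> A \<and> drop m w \<in> C} =
    word_prob p m A * word_prob p n C"
proof -
  have "replicate_pmf (m + n) p =
      map_pmf (\<lambda>(u, v). u @ v) (pair_pmf (replicate_pmf m p) (replicate_pmf n p))"
    unfolding replicate_pmf_distrib pair_pmf_def map_pmf_def
    by (simp add: bind_assoc_pmf bind_return_pmf)
  then have "word_prob p (m + n) {w. take m w \<in> A \<and> drop m w \<in> C} =
      measure_pmf.prob (pair_pmf (replicate_pmf m p) (replicate_pmf n p))
        {(u, v). take m (u @ v) \<in> A \<and> drop m (u @ v) \<in> C}"
    by (simp add: vimage_def case_prod_unfold)
  also have "\<dots> = measure_pmf.prob (pair_pmf (replicate_pmf m p) (replicate_pmf n p)) (A \<times> C)"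
  proof (rule measure_pmf.finite_measure_eq_AE)
    show "AE z in measure_pmf (pair_pmf (replicate_pmf m p) (replicate_pmf n p)).
        (z \<in> {(u, v). take m (u @ v) \<in> A \<and> drop m (u @ v) \<in> C}) = (z \<in> A \<times> C)"
      by (auto simp: AE_measure_pmf_iff set_replicate_pmf)
  qed auto
  also have "\<dots> = word_prob p m A * word_prob p n C"
    by (rule measure_pmf_prob_product) auto
  finally show ?thesis .
qed

lemma prob_replicate_take:
  fixes p :: "nat pmf"
  assumes "m \<le> n"
  shows "word_prob p n {w. take m w \<in> A} =
    word_prob p m A"
  using prob_replicate_append[of m "n - m" p A UNIV] assms by simp

lemma prob_replicate_1:
  "word_prob p 1 {w. w ! 0 \<in> C} = measure_pmf.prob p C"
  unfolding replicate_pmf_1 by (simp add: vimage_def)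

text \<open>Independence across position j, the place where the big jump will sit, with the past
  before it and the future after it.\<close>

lemma prob_replicate_split:
  fixes p :: "nat pmf"
  assumes "j < n"
  shows "word_prob p n {w. take j w \<in> A \<and> w ! j \<in> C \<and> drop (Suc j) w \<in> E} =
    word_prob p j A * measure_pmf.prob p C *
    word_prob p (n - Suc j) E"
proof -
  have "word_prob p n {w. take j w \<in> A \<and> w ! j \<in> C \<and> drop (Suc j) w \<in> E} =
    measure_pmf.prob (replicate_pmf (Suc j + (n - Suc j)) p)
      {w. take (Suc j) w \<in> {u. take j u \<in> A \<and> u ! j \<in> C} \<and> drop (Suc j) w \<in> E}"
    using assms by (intro arg_cong2[of _ _ _ _ "measure_pmf.prob"]) (auto simp: min_def)
  also have "\<dots> = word_prob p (j + 1) {u. take j u \<in> A \<and> u ! j \<in> C} *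
    word_prob p (n - Suc j) E"
    unfolding prob_replicate_append by simp
  also have "word_prob p (j + 1) {u. take j u \<in> A \<and> u ! j \<in> C} =
    word_prob p (j + 1) {u. take j u \<in> A \<and> drop j u \<in> {w. w ! 0 \<in> C}}"
  proof (rule measure_pmf.finite_measure_eq_AE)
    show "AE u in measure_pmf (replicate_pmf (j + 1) p). (u \<in> {u. take j u \<in> A \<and> u ! j \<in> C}) =
        (u \<in> {u. take j u \<in> A \<and> drop j u \<in> {w. w ! 0 \<in> C}})"
      using AE_replicate_length[of "j + 1" p] by eventually_elim auto
  qed auto
  also have "\<dots> = word_prob p j A * measure_pmf.prob p C"
    unfolding prob_replicate_append prob_replicate_1 ..
  finally show ?thesis .
qed

section \<open>Truncated expectations and the walk killed at big jumps\<close>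

lemma integrable_pmf_atMost:
  fixes f :: "nat \<Rightarrow> real"
  shows "integrable (measure_pmf p) (\<lambda>k. indicator {..D} k * f k)"
proof (rule measure_pmf.integrable_const_bound[where B = "\<Sum>k\<le>D. \<bar>f k\<bar>"])
  have "\<bar>f k\<bar> \<le> (\<Sum>k\<le>D. \<bar>f k\<bar>)" if "k \<le> D" for k
    using that by (intro member_le_sum) auto
  then show "AE k in measure_pmf p. norm (indicator {..D} k * f k) \<le> (\<Sum>k\<le>D. \<bar>f k\<bar>)"
    by (auto simp: indicator_def sum_nonneg)
qed auto

lemma integral_pmf_atMost:
  fixes f :: "nat \<Rightarrow> real"
  shows "(\<integral>k. indicator {..D} k * f k \<partial>measure_pmf p) = (\<Sum>k\<le>D. pmf p k * f k)"
proof -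
  have "(\<integral>k. indicator {..D} k * f k \<partial>measure_pmf p) =
      (\<Sum>k\<le>D. (indicator {..D} k * f k) * pmf p k)"
    by (rule integral_measure_pmf_real) (auto simp: indicator_def)
  then show ?thesis by (simp add: mult.commute)
qed

text \<open>\<open>confined_mean p D n \<phi> x\<close> is \<open>E\<^sub>x[\<phi>(S\<^sub>n); S\<^sub>0, \<dots>, S\<^sub>n \<ge> 0, no child count exceeds D]\<close>.\<close>

primrec confined_mean :: "nat pmf \<Rightarrow> nat \<Rightarrow> nat \<Rightarrow> (int \<Rightarrow> real) \<Rightarrow> int \<Rightarrow> real" where
  "confined_mean p D 0 \<phi> x = (if 0 \<le> x then \<phi> x else 0)"
| "confined_mean p D (Suc n) \<phi> x =
    (if 0 \<le> x then \<Sum>k\<le>D. pmf p k * confined_mean p D n \<phi> (x + int k - 1) else 0)"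

abbreviation confined_prob :: "nat pmf \<Rightarrow> nat \<Rightarrow> nat \<Rightarrow> int \<Rightarrow> real" where
  "confined_prob p D n \<equiv> confined_mean p D n (\<lambda>_. 1)"

lemma confined_mean_mono:
  assumes "\<And>y. 0 \<le> y \<Longrightarrow> \<phi> y \<le> \<psi> y"
  shows "confined_mean p D n \<phi> x \<le> confined_mean p D n \<psi> x"
proof (induction n arbitrary: x)
  case (Suc n)
  then show ?case by (auto intro!: sum_mono mult_left_mono)
qed (use assms in auto)

lemma confined_mean_nonneg:
  assumes "\<And>y. 0 \<le> y \<Longrightarrow> 0 \<le> \<phi> y"
  shows "0 \<le> confined_mean p D n \<phi> x"
  by (induction n arbitrary: x) (auto intro!: sum_nonneg mult_nonneg_nonneg assms)

lemma confined_mean_add: "confined_mean p D (m + n) \<phi> x = confined_mean p D m (confined_mean p D n \<phi>) x"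
proof (induction m arbitrary: x)
  case 0
  then show ?case by (cases n) auto
qed auto

lemma confined_mean_cong:
  assumes "\<And>y. 0 \<le> y \<Longrightarrow> \<phi> y = \<psi> y"
  shows "confined_mean p D n \<phi> x = confined_mean p D n \<psi> x"
  using confined_mean_mono[of \<phi> \<psi>] confined_mean_mono[of \<psi> \<phi>] assms by (intro antisym) auto

lemma confined_mean_linear:
  "confined_mean p D n (\<lambda>y. c * \<phi> y + d * \<psi> y) x = c * confined_mean p D n \<phi> x + d * confined_mean p D n \<psi> x"
  by (induction n arbitrary: x) (auto simp: sum_distrib_left sum.distrib algebra_simps)

lemma prob_confined:
  "word_prob p n {w. confined D x w} = confined_prob p D n x"
proof (induction n arbitrary: x)
  case (Suc n)
  have "word_prob p (Suc n) {w. confined D x w} =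
    (\<integral>k. indicator {..D} k * (if 0 \<le> x then confined_prob p D n (x + int k - 1) else 0) \<partial>measure_pmf p)"
    unfolding prob_replicate_Suc
    by (intro Bochner_Integration.integral_cong)
      (auto simp: Suc[symmetric] indicator_def)
  then show ?case
    unfolding integral_pmf_atMost by simp
qed (auto simp: indicator_def)

text \<open>Steps are at least -1, so the walk leaves the nonnegative half-line only at -1. There
  the killed mean is 0, and nonnegativity of V is all the induction asks for.\<close>

lemma confined_mean_supersolution:
  assumes "\<And>y. -1 \<le> y \<Longrightarrow> 0 \<le> V y"
    and "\<And>y. 0 \<le> y \<Longrightarrow> (\<Sum>k\<le>D. pmf p k * V (y + int k - 1)) \<le> \<rho> * V y"
    and "0 \<le> \<rho>" "-1 \<le> x"
  shows "confined_mean p D n V x \<le> \<rho> ^ n * V x"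
  using assms(4)
proof (induction n arbitrary: x)
  case (Suc n)
  show ?case
  proof (cases "0 \<le> x")
    case True
    have "confined_mean p D (Suc n) V x \<le> (\<Sum>k\<le>D. pmf p k * (\<rho> ^ n * V (x + int k - 1)))"
      using True by (auto intro!: sum_mono mult_left_mono Suc.IH)
    also have "\<dots> = \<rho> ^ n * (\<Sum>k\<le>D. pmf p k * V (x + int k - 1))"
      by (simp add: sum_distrib_left algebra_simps)
    also have "\<dots> \<le> \<rho> ^ n * (\<rho> * V x)"
      using assms(2)[OF True] assms(3) by (intro mult_left_mono) auto
    finally show ?thesis by (simp add: algebra_simps)
  qed (use assms(1)[of x] assms(3) Suc.prems in auto)
qed (use assms in auto)

text \<open>Maximal inequality for the nonnegative supermartingale V along the killed walk, by
  induction on the first step: a start at or above A makes the bound trivial, a start below 0 makes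
  the event empty.\<close>

lemma prob_confined_hits_le:
  assumes V: "\<And>y. -1 \<le> y \<Longrightarrow> 0 \<le> V y"
    and sup: "\<And>y. 0 \<le> y \<Longrightarrow> (\<Sum>k\<le>D. pmf p k * V (y + int k - 1)) \<le> V y"
    and c: "\<And>y. A \<le> y \<Longrightarrow> c \<le> V y" "0 < c" and x: "-1 \<le> x"
  shows "word_prob p n
    {w. confined D x w \<and> (\<exists>i\<le>n. A \<le> x + steps (take i w))} \<le> V x / c"
  using x
proof (induction n arbitrary: x)
  case (0 x)
  have "V x / c \<ge> 0" using V[OF 0] c by simp
  moreover have "V x / c \<ge> 1" if "A \<le> x" using c(1)[OF that] c(2) by simp
  ultimately show ?case by (auto simp: indicator_def)
next
  case (Suc n x)
  have nonneg: "V x / c \<ge> 0" using V[OF Suc.prems] c by simp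
  let ?E = "\<lambda>n x. {w. confined D x w \<and> (\<exists>i\<le>n. A \<le> x + steps (take i w))}"
  consider "x < 0" | "A \<le> x" | "0 \<le> x" "x < A" by linarith
  then show ?case
  proof cases
    case 1
    then have empty: "?E (Suc n) x = {}" by (auto dest: confined_imp_nonneg)
    show ?thesis unfolding empty using nonneg by (simp only: measure_empty)
  next
    case 2
    then have "1 \<le> V x / c" using c(1)[OF 2] c(2) by simp
    then show ?thesis by (meson measure_pmf.prob_le_1 order_trans)
  next
    case 3
    have E: "{w. k # w \<in> ?E (Suc n) x} \<subseteq> (if k \<le> D then ?E n (x + int k - 1) else {})" for k
    proof (rule subsetI)
      fix w assume w: "w \<in> {w. k # w \<in> ?E (Suc n) x}"
      then obtain i where i: "i \<le> Suc n" "A \<le> x + steps (take i (k # w))" by auto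
      with 3 have "i \<noteq> 0" by (intro notI) auto
      then obtain i' where "i = Suc i'" by (cases i) auto
      with i w show "w \<in> (if k \<le> D then ?E n (x + int k - 1) else {})"
        by (auto simp: algebra_simps)
    qed
    have "word_prob p (Suc n) (?E (Suc n) x) \<le>
      (\<integral>k. indicator {..D} k * (V (x + int k - 1) / c) \<partial>measure_pmf p)"
      unfolding prob_replicate_Suc
    proof (rule integral_mono)
      show "integrable (measure_pmf p) (\<lambda>k. indicator {..D} k * (V (x + int k - 1) / c))"
        by (rule integrable_pmf_atMost)
      show "integrable (measure_pmf p)
        (\<lambda>k. word_prob p n {w. k # w \<in> ?E (Suc n) x})"
        by (rule measure_pmf.integrable_const_bound[where B = 1]) auto
      show "word_prob p n {w. k # w \<in> ?E (Suc n) x} \<le>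
        indicator {..D} k * (V (x + int k - 1) / c)" for k
      proof -
        have "word_prob p n {w. k # w \<in> ?E (Suc n) x} \<le>
          word_prob p n (if k \<le> D then ?E n (x + int k - 1) else {})"
          using E by (intro measure_pmf.finite_measure_mono) auto
        also have "\<dots> \<le> indicator {..D} k * (V (x + int k - 1) / c)"
          using Suc.IH[of "x + int k - 1"] 3 by auto
        finally show ?thesis .
      qed
    qed
    also have "\<dots> = (\<Sum>k\<le>D. pmf p k * V (x + int k - 1)) / c"
      unfolding integral_pmf_atMost by (simp add: sum_divide_distrib)
    also have "\<dots> \<le> V x / c"
      using sup[OF 3(1)] c by (intro divide_right_mono) auto
    finally show ?thesis .
  qed
qed

section \<open>Drift, exponential and maximal inequalities\<close>

text \<open>For an offspring law of mean 1, \<open>drift p D\<close> is also \<open>E[X; X \<ge> D]\<close>.\<close>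

definition drift :: "nat pmf \<Rightarrow> nat \<Rightarrow> real" where
  "drift p D = (\<Sum>k\<le>D. (1 - real k) * pmf p k)"

definition sqmom :: "nat pmf \<Rightarrow> nat \<Rightarrow> real" where
  "sqmom p D = (\<Sum>k\<le>D. (real k - 1)\<^sup>2 * pmf p k)"

lemma sqmom_nonneg: "0 \<le> sqmom p D"
  by (auto simp: sqmom_def intro!: sum_nonneg)

lemma sum_pmf_atMost: "(\<Sum>k\<le>D. pmf p k) = measure_pmf.prob p {..D}" for p :: "nat pmf"
  by (simp add: measure_measure_pmf_finite)

section \<open>Expected lifetime of the killed walk\<close>

text \<open>The weight S + 1 vanishes at -1, so killing there costs nothing and the one-step balance
  is an exact identity. Mass is lost only to letters above D, through the factor
  \<open>measure_pmf.prob p {..D}\<close>.\<close>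

lemma confined_mean_drift:
  "confined_mean p D (Suc n) (\<lambda>y. real_of_int y + 1) x =
    measure_pmf.prob p {..D} * confined_mean p D n (\<lambda>y. real_of_int y + 1) x - drift p D * confined_prob p D n x"
proof -
  have "confined_mean p D (Suc n) (\<lambda>y. real_of_int y + 1) x =
      confined_mean p D n (confined_mean p D 1 (\<lambda>y. real_of_int y + 1)) x"
    using confined_mean_add[of p D n 1] by simp
  also have "\<dots> = confined_mean p D n (\<lambda>y. measure_pmf.prob p {..D} * (real_of_int y + 1) + (- drift p D) * 1) x"
  proof (rule confined_mean_cong)
    fix y :: int assume y: "0 \<le> y"
    have "confined_mean p D 1 (\<lambda>y. real_of_int y + 1) y = (\<Sum>k\<le>D. pmf p k * (real_of_int y + real k))"
    proof -
      \<comment> \<open>The killed transition is the one to -1, and its weight y + k is 0.\<close>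
      have "real_of_int y + real k = 0" if "\<not> 1 \<le> y + int k" for k
      proof -
        have "y + int k = 0" using that y by linarith
        then show ?thesis by (metis of_int_0 of_int_add of_int_of_nat_eq)
      qed
      then show ?thesis using y by (auto intro!: sum.cong)
    qed
    also have "\<dots> = measure_pmf.prob p {..D} * (real_of_int y + 1) + (- drift p D) * 1"
      unfolding sum_pmf_atMost[symmetric] drift_def
      by (simp add: sum_distrib_left sum_subtractf sum.distrib algebra_simps)
    finally show "confined_mean p D 1 (\<lambda>y. real_of_int y + 1) y =
      measure_pmf.prob p {..D} * (real_of_int y + 1) + (- drift p D) * 1" .
  qed
  finally show ?thesis unfolding confined_mean_linear by simp
qed

lemma confined_mean_height_le_1:
  assumes "0 \<le> drift p D"
  shows "confined_mean p D n (\<lambda>y. real_of_int y + 1) 0 \<le> 1"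
proof (induction n)
  case (Suc n)
  have 1: "0 \<le> confined_mean p D n (\<lambda>y. real_of_int y + 1) 0" "0 \<le> confined_prob p D n 0"
    by (auto intro: confined_mean_nonneg)
  have "measure_pmf.prob p {..D} * confined_mean p D n (\<lambda>y. real_of_int y + 1) 0 \<le>
      1 * confined_mean p D n (\<lambda>y. real_of_int y + 1) 0"
    using 1 by (intro mult_right_mono) auto
  then show ?case
    unfolding confined_mean_drift using Suc.IH mult_nonneg_nonneg[OF assms 1(2)] by linarith
qed simp

text \<open>Optional stopping of S + 1, as a telescoped one-step identity. The sum on the left is
  the expected lifetime of the killed walk, truncated at n; the last term is the weight lost at big
  jumps.\<close>

lemma drift_sum_conf:
  "drift p D * (\<Sum>k<n. confined_prob p D k 0) =
    1 - confined_mean p D n (\<lambda>y. real_of_int y + 1) 0 -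
    (1 - measure_pmf.prob p {..D}) * (\<Sum>k<n. confined_mean p D k (\<lambda>y. real_of_int y + 1) 0)"
proof (induction n)
  case (Suc n)
  have 1: "drift p D * (\<Sum>k<Suc n. confined_prob p D k 0) =
    drift p D * (\<Sum>k<n. confined_prob p D k 0) + drift p D * confined_prob p D n 0"
    by (simp add: algebra_simps)
  show ?case
    unfolding 1 Suc.IH confined_mean_drift by (simp add: algebra_simps)
qed simp

lemma drift_sum_conf_le:
  assumes "0 \<le> drift p D"
  shows "drift p D * (\<Sum>k<n. confined_prob p D k 0) \<le> 1"
proof -
  have "0 \<le> (1 - measure_pmf.prob p {..D}) * (\<Sum>k<n. confined_mean p D k (\<lambda>y. real_of_int y + 1) 0)"
    by (intro mult_nonneg_nonneg sum_nonneg confined_mean_nonneg) auto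
  moreover have "0 \<le> confined_mean p D n (\<lambda>y. real_of_int y + 1) 0"
    by (intro confined_mean_nonneg) auto
  ultimately show ?thesis unfolding drift_sum_conf by linarith
qed

lemma drift_sum_conf_ge:
  assumes "0 \<le> drift p D"
  shows "1 - confined_mean p D n (\<lambda>y. real_of_int y + 1) 0 - real n * (1 - measure_pmf.prob p {..D}) \<le>
    drift p D * (\<Sum>k<n. confined_prob p D k 0)"
proof -
  have "(\<Sum>k<n. confined_mean p D k (\<lambda>y. real_of_int y + 1) 0) \<le> real n * 1"
    using sum_bounded_above[of "{..<n}" "\<lambda>k. confined_mean p D k (\<lambda>y. real_of_int y + 1) 0" 1]
      confined_mean_height_le_1[OF assms] by auto
  then have "(1 - measure_pmf.prob p {..D}) * (\<Sum>k<n. confined_mean p D k (\<lambda>y. real_of_int y + 1) 0)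
      \<le> (1 - measure_pmf.prob p {..D}) * (real n * 1)"
    by (intro mult_left_mono) auto
  then show ?thesis unfolding drift_sum_conf by (simp add: mult.commute)
qed

lemma confined_mean_antimono: "m \<le> n \<Longrightarrow> confined_prob p D n x \<le> confined_prob p D m x"
proof -
  assume "m \<le> n"
  then have "confined_prob p D n x = confined_mean p D m (confined_prob p D (n - m)) x"
    using confined_mean_add[of p D m "n - m"] by simp
  also have "\<dots> \<le> confined_prob p D m x"
    by (intro confined_mean_mono) (simp add: prob_confined[symmetric])
  finally show ?thesis .
qed

text \<open>Survival probabilities decrease in time and sum to at most 1 / \<open>drift p D\<close>,
  so the m-th is at most the average of m of them.\<close>

lemma confined_mean_one_le:
  assumes "0 < drift p D" "0 < m"
  shows "confined_prob p D m 0 \<le> 1 / (drift p D * real m)"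
proof -
  have "real m * confined_prob p D m 0 = (\<Sum>k<m. confined_prob p D m 0)"
    by simp
  also have "\<dots> \<le> (\<Sum>k<m. confined_prob p D k 0)"
    by (intro sum_mono confined_mean_antimono) auto
  finally have "drift p D * (real m * confined_prob p D m 0) \<le> drift p D * (\<Sum>k<m. confined_prob p D k 0)"
    using assms by (intro mult_left_mono) auto
  also have "\<dots> \<le> 1" using assms by (intro drift_sum_conf_le) auto
  finally show ?thesis using assms by (simp add: field_simps)
qed

section \<open>Exponential supermartingale for the killed walk\<close>

text \<open>Both signs of y are reduced to (1 - y) exp y \<le> 1. It is applied to y = l (k - 1),
  which the truncation at D keeps below R.\<close>

lemma exp_le_quadratic:
  fixes y :: real
  assumes "y \<le> R" "0 \<le> R"
  shows "exp y \<le> 1 + y + y\<^sup>2 * exp R"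
proof -
  have "1 + (- y) \<le> exp (- y)" by (rule exp_ge_add_one_self)
  then have "exp y * (1 - y) \<le> exp y * exp (- y)" by (intro mult_left_mono) auto
  then have *: "exp y - 1 \<le> y * exp y" by (simp add: exp_minus algebra_simps)
  show ?thesis
  proof (cases "0 \<le> y")
    case True
    have "exp y - 1 - y \<le> y * (exp y - 1)" using * by (simp add: algebra_simps)
    also have "\<dots> \<le> y * (y * exp y)" using * True by (intro mult_left_mono)
    also have "\<dots> \<le> y * (y * exp R)" using assms True by (intro mult_left_mono) auto
    finally show ?thesis by (simp add: power2_eq_square algebra_simps)
  next
    case False
    have "exp y - 1 - y \<le> (- y) * (1 - exp y)" using * by (simp add: algebra_simps)
    also have "\<dots> \<le> (- y) * (- y)"
    proof (rule mult_left_mono)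
      show "1 - exp y \<le> - y" using exp_ge_add_one_self[of y] by linarith
    qed (use False in auto)
    also have "\<dots> \<le> y\<^sup>2 * exp R"
      using assms mult_left_mono[of 1 "exp R" "y\<^sup>2"] by (simp add: power2_eq_square)
    finally show ?thesis by simp
  qed
qed

locale exponential_bound =
  fixes p :: "nat pmf" and D :: nat and l R :: real
  assumes l: "0 < l" and lD: "l * real D \<le> R"
    and lR: "l * exp R * sqmom p D \<le> drift p D / 2" and drift_pos: "0 < drift p D"
begin

definition \<rho> :: real where "\<rho> = 1 - l * drift p D / 2"

text \<open>Because of the zero at -1, V 0 = exp l - 1 is of order l instead of 1. With l of order R
  / B this is the factor 1 / B needed against the rare event of survival.\<close>

definition V :: "int \<Rightarrow> real" where "V x = exp (l * (real_of_int x + 1)) - 1"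

lemma exp_moment:
  "(\<Sum>k\<le>D. pmf p k * exp (l * (real k - 1))) \<le> measure_pmf.prob p {..D} - l * drift p D / 2"
proof -
  have R: "0 \<le> R" using l lD by (meson mult_nonneg_nonneg of_nat_0_le_iff less_imp_le order_trans)
  have "(\<Sum>k\<le>D. pmf p k * exp (l * (real k - 1))) \<le>
    (\<Sum>k\<le>D. pmf p k * (1 + l * (real k - 1) + (l * (real k - 1))\<^sup>2 * exp R))"
  proof (intro sum_mono mult_left_mono exp_le_quadratic R)
    fix k assume "k \<in> {..D}"
    then have "l * (real k - 1) \<le> l * real D" using l by (intro mult_left_mono) auto
    then show "l * (real k - 1) \<le> R" using lD by linarith
  qed auto
  also have "\<dots> = measure_pmf.prob p {..D} - l * drift p D + l\<^sup>2 * exp R * sqmom p D"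
    unfolding sum_pmf_atMost[symmetric] drift_def sqmom_def
    by (simp add: sum_distrib_left sum.distrib[symmetric] sum_subtractf[symmetric] algebra_simps
        power2_eq_square)
  also have "l\<^sup>2 * exp R * sqmom p D = l * (l * exp R * sqmom p D)"
    by (simp add: power2_eq_square)
  also have "\<dots> \<le> l * (drift p D / 2)" using l lR by (intro mult_left_mono) auto
  finally show ?thesis by (simp add: field_simps)
qed

lemma rho: "0 \<le> \<rho>" "\<rho> \<le> exp (- (l * drift p D / 2))"
proof -
  have "0 \<le> (\<Sum>k\<le>D. pmf p k * exp (l * (real k - 1)))"
    by (intro sum_nonneg) auto
  also note exp_moment
  finally show "0 \<le> \<rho>" unfolding \<rho>_def using measure_pmf.prob_le_1[of p "{..D}"] by linarith
  show "\<rho> \<le> exp (- (l * drift p D / 2))"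
    unfolding \<rho>_def using exp_ge_add_one_self[of "- (l * drift p D / 2)"] by simp
qed

lemma exp_supersolution:
  "(\<Sum>k\<le>D. pmf p k * exp (l * (real_of_int (y + int k - 1) + 1))) \<le>
    (measure_pmf.prob p {..D} - l * drift p D / 2) * exp (l * (real_of_int y + 1))"
proof -
  have "(\<Sum>k\<le>D. pmf p k * exp (l * (real_of_int (y + int k - 1) + 1))) =
    (\<Sum>k\<le>D. pmf p k * exp (l * (real k - 1))) * exp (l * (real_of_int y + 1))"
    unfolding sum_distrib_right mult.assoc exp_add[symmetric] by (simp add: algebra_simps)
  also have "\<dots> \<le> (measure_pmf.prob p {..D} - l * drift p D / 2) * exp (l * (real_of_int y + 1))"
    by (intro mult_right_mono exp_moment) auto
  finally show ?thesis .
qed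

lemma exp_supersolution':
  "(\<Sum>k\<le>D. pmf p k * exp (l * (real_of_int (y + int k - 1) + 1))) \<le> \<rho> * exp (l * (real_of_int y + 1))"
proof -
  have "measure_pmf.prob p {..D} - l * drift p D / 2 \<le> \<rho>"
    unfolding \<rho>_def using measure_pmf.prob_le_1[of p "{..D}"] by linarith
  then show ?thesis
    using exp_supersolution[of y]
    by (meson exp_ge_zero mult_right_mono order_trans)
qed

text \<open>Subtracting 1 costs only the retained mass \<open>?P\<close>, so the gain l
  \<open>drift p D\<close> / 2 multiplies the full exponential, which exceeds V.\<close>

lemma V_supersolution:
  assumes "-1 \<le> y"
  shows "(\<Sum>k\<le>D. pmf p k * V (y + int k - 1)) \<le> \<rho> * V y"
proof -
  let ?P = "measure_pmf.prob p {..D}"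
  have "(\<Sum>k\<le>D. pmf p k * V (y + int k - 1)) =
    (\<Sum>k\<le>D. pmf p k * exp (l * (real_of_int (y + int k - 1) + 1))) - ?P"
    unfolding V_def sum_pmf_atMost[symmetric] by (simp add: sum_subtractf algebra_simps)
  also have "\<dots> \<le> (?P - l * drift p D / 2) * exp (l * (real_of_int y + 1)) - ?P"
    using exp_supersolution[of y] by linarith
  also have "\<dots> = ?P * V y - l * drift p D / 2 * exp (l * (real_of_int y + 1))"
    unfolding V_def by (simp add: algebra_simps)
  also have "\<dots> \<le> 1 * V y - l * drift p D / 2 * V y"
  proof (intro diff_mono mult_right_mono mult_left_mono)
    show "0 \<le> V y" unfolding V_def using l assms by simp
    show "0 \<le> l * drift p D / 2" using l drift_pos by simp
  qed (auto simp: V_def)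
  finally show ?thesis by (simp add: \<rho>_def algebra_simps)
qed

lemma V_nonneg: "-1 \<le> y \<Longrightarrow> 0 \<le> V y"
  unfolding V_def using l by simp

lemma rho_le_1: "\<rho> \<le> 1"
  using l drift_pos by (simp add: \<rho>_def)

lemma confined_mean_V_le: "confined_mean p D n V 0 \<le> \<rho> ^ n * V 0"
  by (rule confined_mean_supersolution) (auto simp: V_nonneg V_supersolution rho)

text \<open>The plain exponential started at 0 would give \<rho> ^ n exp l, with no small factor.
  Splitting at time m, its expectation at that time is the one of V plus the probability of being
  alive, and both of these are small.\<close>

lemma confined_mean_one_exp_le: "confined_prob p D (m + n) 0 \<le> \<rho> ^ n * (V 0 + confined_prob p D m 0)"
proof -
  have "confined_prob p D (m + n) 0 = confined_mean p D m (confined_prob p D n) 0"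
    by (rule confined_mean_add)
  also have "\<dots> \<le> confined_mean p D m (\<lambda>y. \<rho> ^ n * V y + \<rho> ^ n * 1) 0"
  proof (rule confined_mean_mono)
    fix y :: int assume y: "0 \<le> y"
    have "confined_prob p D n y \<le> confined_mean p D n (\<lambda>y. exp (l * (real_of_int y + 1))) y"
      using l by (intro confined_mean_mono) auto
    also have "\<dots> \<le> \<rho> ^ n * exp (l * (real_of_int y + 1))"
      by (rule confined_mean_supersolution) (use y rho exp_supersolution' in auto)
    finally show "confined_prob p D n y \<le> \<rho> ^ n * V y + \<rho> ^ n * 1"
      by (simp add: V_def algebra_simps)
  qed
  also have "\<dots> = \<rho> ^ n * confined_mean p D m V 0 + \<rho> ^ n * confined_prob p D m 0"
    by (rule confined_mean_linear)
  also have "\<dots> \<le> \<rho> ^ n * V 0 + \<rho> ^ n * confined_prob p D m 0"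
  proof -
    have "confined_mean p D m V 0 \<le> \<rho> ^ m * V 0" by (rule confined_mean_V_le)
    also have "\<dots> \<le> 1 * V 0"
      using rho rho_le_1 V_nonneg[of 0] by (intro mult_right_mono power_le_one) auto
    finally show ?thesis using rho by (intro add_right_mono mult_left_mono) auto
  qed
  finally show ?thesis by (simp add: algebra_simps)
qed

lemma confined_mean_height_le: "confined_mean p D n (\<lambda>y. real_of_int y + 1) 0 \<le> \<rho> ^ n * (V 0 / l)"
proof -
  have "confined_mean p D n (\<lambda>y. real_of_int y + 1) 0 \<le> confined_mean p D n (\<lambda>y. (1 / l) * V y + 0 * V y) 0"
  proof (rule confined_mean_mono)
    fix y :: int
    have "l * (real_of_int y + 1) \<le> V y"
      unfolding V_def using exp_ge_add_one_self[of "l * (real_of_int y + 1)"] by linarith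
    then show "real_of_int y + 1 \<le> (1 / l) * V y + 0 * V y"
      using l by (simp add: field_simps)
  qed
  also have "\<dots> = confined_mean p D n V 0 / l"
    unfolding confined_mean_linear by simp
  also have "\<dots> \<le> \<rho> ^ n * V 0 / l"
    using l confined_mean_V_le by (intro divide_right_mono) auto
  finally show ?thesis by simp
qed

text \<open>The maximal inequality for V, with exp (l A) - 1 as a lower bound for V at heights of at
  least A.\<close>

lemma prob_confined_high_le:
  fixes A :: real
  assumes "0 < A"
  shows "word_prob p n
    {w. confined D 0 w \<and> (\<exists>i\<le>n. A \<le> real_of_int (steps (take i w)))} \<le> V 0 / (exp (l * A) - 1)"
proof -
  have eq: "A \<le> real_of_int z \<longleftrightarrow> \<lceil>A\<rceil> \<le> 0 + z" for z by linarith
  show ?thesis unfolding eq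
  proof (rule prob_confined_hits_le)
    show "(\<Sum>k\<le>D. pmf p k * V (y + int k - 1)) \<le> V y" if "0 \<le> y" for y
    proof -
      have "\<rho> * V y \<le> 1 * V y" using that rho_le_1 V_nonneg by (intro mult_right_mono) auto
      then show ?thesis using V_supersolution[of y] that by simp
    qed
    show "exp (l * A) - 1 \<le> V y" if "\<lceil>A\<rceil> \<le> y" for y
      unfolding V_def using l that by (simp) linarith
  qed (use V_nonneg l assms in auto)
qed

end

section \<open>Maximal inequality and deviation from a line\<close>

text \<open>Induction on the first step: the free starting point x makes the hypothesis applicable
  after it, and E (x + Z)^2 \<le> x^2 + v closes the recursion.\<close>

lemma kolmogorov_maximal:
  fixes Z :: "nat \<Rightarrow> real"
  assumes bnd: "\<And>k. \<bar>Z k\<bar> \<le> C" and mean: "measure_pmf.expectation p Z = 0"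
    and var: "measure_pmf.expectation p (\<lambda>k. (Z k)\<^sup>2) \<le> v" and a: "0 < a"
  shows "word_prob p n {w. \<exists>i\<le>n. a \<le> \<bar>x + (\<Sum>k\<leftarrow>take i w. Z k)\<bar>}
    \<le> (x\<^sup>2 + real n * v) / a\<^sup>2"
proof -
  have big: "1 \<le> x\<^sup>2 / a\<^sup>2" if "a \<le> \<bar>x\<bar>" for x
  proof -
    have "a\<^sup>2 \<le> \<bar>x\<bar>\<^sup>2" using that a by (intro power_mono) auto
    then show ?thesis using a by simp
  qed
  have v: "0 \<le> v"
  proof -
    have "0 \<le> measure_pmf.expectation p (\<lambda>k. (Z k)\<^sup>2)" by (intro integral_nonneg_AE) auto
    then show ?thesis using var by linarith
  qed
  show ?thesis
  proof (induction n arbitrary: x)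
    case (0 x)
    then show ?case using big[of x] by (auto simp: indicator_def)
  next
    case (Suc n x)
    let ?E = "\<lambda>n x. {w. \<exists>i\<le>n. a \<le> \<bar>x + (\<Sum>k\<leftarrow>take i w. Z k)\<bar>}"
    show ?case
    proof (cases "a \<le> \<bar>x\<bar>")
      case True
      have "1 \<le> x\<^sup>2 / a\<^sup>2" by (rule big[OF True])
      also have "\<dots> \<le> (x\<^sup>2 + real (Suc n) * v) / a\<^sup>2"
        using v by (intro divide_right_mono) auto
      finally show ?thesis by (meson measure_pmf.prob_le_1 order_trans)
    next
      case False
      have int: "integrable (measure_pmf p) Z" "integrable (measure_pmf p) (\<lambda>k. (Z k)\<^sup>2)"
      proof -
        show "integrable (measure_pmf p) Z"
          using bnd by (intro measure_pmf.integrable_const_bound[where B = C]) auto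
        have "\<bar>Z k\<bar>\<^sup>2 \<le> C\<^sup>2" for k using bnd[of k] by (intro power_mono) auto
        then show "integrable (measure_pmf p) (\<lambda>k. (Z k)\<^sup>2)"
          by (intro measure_pmf.integrable_const_bound[where B = "C\<^sup>2"]) auto
      qed
      have E: "{w. k # w \<in> ?E (Suc n) x} \<subseteq> ?E n (x + Z k)" for k
      proof (rule subsetI)
        fix w assume "w \<in> {w. k # w \<in> ?E (Suc n) x}"
        then obtain i where i: "i \<le> Suc n" "a \<le> \<bar>x + (\<Sum>k\<leftarrow>take i (k # w). Z k)\<bar>" by auto
        with False have "i \<noteq> 0" by (intro notI) auto
        then obtain i' where "i = Suc i'" by (cases i) auto
        with i show "w \<in> ?E n (x + Z k)"
          by (auto simp: algebra_simps)
      qed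
      have eq: "((x + Z k)\<^sup>2 + real n * v) / a\<^sup>2 =
          (x\<^sup>2 + real n * v) / a\<^sup>2 + (2 * x / a\<^sup>2) * Z k + (1 / a\<^sup>2) * (Z k)\<^sup>2" for k
        by (simp add: power2_sum add_divide_distrib algebra_simps)
      have "word_prob p (Suc n) (?E (Suc n) x) \<le>
        (\<integral>k. ((x + Z k)\<^sup>2 + real n * v) / a\<^sup>2 \<partial>measure_pmf p)"
        unfolding prob_replicate_Suc
      proof (rule integral_mono)
        show "integrable (measure_pmf p) (\<lambda>k. ((x + Z k)\<^sup>2 + real n * v) / a\<^sup>2)"
          unfolding eq using int by auto
        show "integrable (measure_pmf p)
          (\<lambda>k. word_prob p n {w. k # w \<in> ?E (Suc n) x})"
          by (rule measure_pmf.integrable_const_bound[where B = 1]) auto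
        show "word_prob p n {w. k # w \<in> ?E (Suc n) x} \<le>
            ((x + Z k)\<^sup>2 + real n * v) / a\<^sup>2" for k
          by (rule order_trans[OF measure_pmf.finite_measure_mono[OF E] Suc.IH]) simp
      qed
      also have "\<dots> = (x\<^sup>2 + real n * v) / a\<^sup>2 + (1 / a\<^sup>2) * measure_pmf.expectation p (\<lambda>k. (Z k)\<^sup>2)"
        unfolding eq using int mean by simp
      also have "\<dots> \<le> (x\<^sup>2 + real n * v) / a\<^sup>2 + (1 / a\<^sup>2) * v"
        using var by (intro add_left_mono mult_left_mono) auto
      also have "\<dots> = (x\<^sup>2 + real (Suc n) * v) / a\<^sup>2"
        by (simp add: add_divide_distrib algebra_simps)
      finally show ?thesis .
    qed
  qed
qed

lemma prob_exceeds_le: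
  "word_prob p n {w. \<exists>j<n. D < w ! j} \<le>
    real n * (1 - measure_pmf.prob p {..D})" for p :: "nat pmf"
proof -
  have "{w. \<exists>j<n. D < w ! j} = (\<Union>j<n. {w. w ! j \<in> {D<..}})" by auto
  then have "word_prob p n {w. \<exists>j<n. D < w ! j} \<le>
    (\<Sum>j<n. word_prob p n {w. w ! j \<in> {D<..}})"
    using measure_pmf.finite_measure_subadditive_finite[of "{..<n}" "\<lambda>j. {w. w ! j \<in> {D<..}}"
      "replicate_pmf n p"] by auto
  also have "\<dots> = (\<Sum>j<n. measure_pmf.prob p {D<..})"
  proof (rule sum.cong)
    fix j assume "j \<in> {..<n}"
    then show "word_prob p n {w. w ! j \<in> {D<..}} = measure_pmf.prob p {D<..}"
      using prob_replicate_split[of j n p UNIV "{D<..}" UNIV] by simp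
  qed simp
  also have "\<dots> = real n * (1 - measure_pmf.prob p {..D})"
  proof -
    have "{D<..} = UNIV - {..D}" by auto
    then show ?thesis using measure_pmf.prob_compl[of "{..D}" p] by simp
  qed
  finally show ?thesis .
qed

text \<open>Unless some letter exceeds D, the steps agree with their truncations. Half of the
  tolerance a pays for replacing the slope \<open>drift p D\<close> by c, the other half goes to
  Kolmogorov's inequality, whence the factor 4.\<close>

lemma prob_deviation_le:
  assumes a: "0 < a" and c: "real n * \<bar>c - drift p D\<bar> \<le> a / 2"
  shows "word_prob p n
      {w. \<exists>i\<le>n. a < \<bar>real_of_int (steps (take i w)) + real i * c\<bar>} \<le>
    real n * (1 - measure_pmf.prob p {..D}) + 4 * real n * sqmom p D / a\<^sup>2"
proof -
  \<comment> \<open>Letters above D contribute 0, so the mean is exactly -\<open>drift p D\<close>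
    and adding \<open>drift p D\<close> centres Z.\<close>
  define Y :: "nat \<Rightarrow> real" where "Y k = indicator {..D} k * (real k - 1)" for k
  define Z where "Z k = Y k + drift p D" for k
  have Yb: "\<bar>Y k\<bar> \<le> real D + 1" for k
    by (auto simp: Y_def indicator_def)
  have Y2: "(Y k)\<^sup>2 = indicator {..D} k * (real k - 1)\<^sup>2" for k
    by (auto simp: Y_def indicator_def)
  have int: "integrable (measure_pmf p) Y" "integrable (measure_pmf p) (\<lambda>k. (Y k)\<^sup>2)"
  proof -
    show "integrable (measure_pmf p) Y"
      using Yb by (intro measure_pmf.integrable_const_bound[where B = "real D + 1"]) auto
    have "\<bar>Y k\<bar>\<^sup>2 \<le> (real D + 1)\<^sup>2" for k using Yb[of k] by (intro power_mono) auto
    then show "integrable (measure_pmf p) (\<lambda>k. (Y k)\<^sup>2)"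
      by (intro measure_pmf.integrable_const_bound[where B = "(real D + 1)\<^sup>2"]) auto
  qed
  have EY: "measure_pmf.expectation p Y = - drift p D"
    unfolding Y_def integral_pmf_atMost drift_def by (simp add: sum_negf[symmetric] algebra_simps)
  have EY2: "measure_pmf.expectation p (\<lambda>k. (Y k)\<^sup>2) = sqmom p D"
    unfolding Y2 integral_pmf_atMost sqmom_def by (simp add: mult.commute)
  have "measure_pmf.expectation p (\<lambda>k. (Z k)\<^sup>2) =
      measure_pmf.expectation p (\<lambda>k. (Y k)\<^sup>2 + 2 * drift p D * Y k + (drift p D)\<^sup>2)"
    by (simp add: Z_def power2_sum algebra_simps)
  also have "\<dots> = sqmom p D - (drift p D)\<^sup>2"
    using int EY EY2 by (simp add: power2_eq_square)
  finally have var: "measure_pmf.expectation p (\<lambda>k. (Z k)\<^sup>2) \<le> sqmom p D" by simp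
  have mean: "measure_pmf.expectation p Z = 0"
    unfolding Z_def using int EY by simp
  have K: "word_prob p n {w. \<exists>i\<le>n. a / 2 \<le> \<bar>0 + (\<Sum>k\<leftarrow>take i w. Z k)\<bar>}
    \<le> (0\<^sup>2 + real n * sqmom p D) / (a / 2)\<^sup>2"
  proof (rule kolmogorov_maximal[OF _ mean var])
    show "\<bar>Z k\<bar> \<le> real D + 1 + \<bar>drift p D\<bar>" for k
      unfolding Z_def using Yb[of k] by linarith
  qed (use a in auto)
  have sumZ: "(\<Sum>k\<leftarrow>u. Z k) = real_of_int (steps u) + real (length u) * drift p D"
    if "\<forall>k\<in>set u. k \<le> D" for u
    using that by (induction u) (auto simp: Z_def Y_def algebra_simps)
  have "word_prob p n
      {w. \<exists>i\<le>n. a < \<bar>real_of_int (steps (take i w)) + real i * c\<bar>} \<le>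
    word_prob p n ({w. \<exists>j<n. D < w ! j} \<union>
      {w. \<exists>i\<le>n. a / 2 \<le> \<bar>0 + (\<Sum>k\<leftarrow>take i w. Z k)\<bar>})"
  proof (rule measure_pmf.finite_measure_mono_AE)
    show "AE w in measure_pmf (replicate_pmf n p).
      w \<in> {w. \<exists>i\<le>n. a < \<bar>real_of_int (steps (take i w)) + real i * c\<bar>} \<longrightarrow>
      w \<in> {w. \<exists>j<n. D < w ! j} \<union> {w. \<exists>i\<le>n. a / 2 \<le> \<bar>0 + (\<Sum>k\<leftarrow>take i w. Z k)\<bar>}"
    proof (rule eventually_mono[OF AE_replicate_length[of n p]], rule impI)
      fix w :: "nat list"
      assume len: "length w = n"
      assume "w \<in> {w. \<exists>i\<le>n. a < \<bar>real_of_int (steps (take i w)) + real i * c\<bar>}"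
      then obtain i where i: "i \<le> n" "a < \<bar>real_of_int (steps (take i w)) + real i * c\<bar>" by auto
      show "w \<in> {w. \<exists>j<n. D < w ! j} \<union> {w. \<exists>i\<le>n. a / 2 \<le> \<bar>0 + (\<Sum>k\<leftarrow>take i w. Z k)\<bar>}"
      proof (cases "\<exists>j<n. D < w ! j")
        case False
        then have "\<forall>k\<in>set (take i w). k \<le> D"
          using len by (auto simp: in_set_conv_nth not_less) (metis not_less)
        from sumZ[OF this] i len have s: "(\<Sum>k\<leftarrow>take i w. Z k) =
            real_of_int (steps (take i w)) + real i * drift p D" by (simp add: min_def)
        have "real i * \<bar>c - drift p D\<bar> \<le> real n * \<bar>c - drift p D\<bar>"
          using i by (intro mult_right_mono) auto
        then have "\<bar>real i * c - real i * drift p D\<bar> \<le> a / 2"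
          using c by (simp add: abs_mult right_diff_distrib[symmetric])
        then have "a / 2 \<le> \<bar>0 + (\<Sum>k\<leftarrow>take i w. Z k)\<bar>"
          unfolding s using i(2) by linarith
        then show ?thesis using i(1) by auto
      qed auto
    qed
  qed auto
  also have "\<dots> \<le> word_prob p n {w. \<exists>j<n. D < w ! j} +
      word_prob p n {w. \<exists>i\<le>n. a / 2 \<le> \<bar>0 + (\<Sum>k\<leftarrow>take i w. Z k)\<bar>}"
    by (intro measure_Un_le) auto
  also have "\<dots> \<le> real n * (1 - measure_pmf.prob p {..D}) +
      (0\<^sup>2 + real n * sqmom p D) / (a / 2)\<^sup>2"
    by (intro add_mono prob_exceeds_le K)
  finally show ?thesis by (simp add: power_divide mult_ac)
qed

section \<open>One big jump\<close>

text \<open>Tail of the child count, not of X: P(X \<ge> y) is \<open>tail p (y + 1)\<close>, hence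
  the shift by 1 where a_n enters.\<close>

definition tail :: "nat pmf \<Rightarrow> real \<Rightarrow> real" where
  "tail p y = measure_pmf.prob p {k. y \<le> real k}"

definition deviates :: "real \<Rightarrow> real \<Rightarrow> nat list \<Rightarrow> bool" where
  "deviates A c v \<longleftrightarrow> (\<exists>i\<le>length v. A < \<bar>real_of_int (steps (take i v)) + real i * c\<bar>)"

text \<open>The walk is alive at times 0 to j; the jump is the letter of index j and is complete at
  time j + 1.\<close>

definition first_jump :: "nat \<Rightarrow> nat \<Rightarrow> nat list \<Rightarrow> bool" where
  "first_jump D j w \<longleftrightarrow> confined D 0 (take j w) \<and> D < w ! j"

text \<open>A word that dies before any big jump is not bad; the notion is used only for words that
  survive the window of length J. Such a word is bad if the window brings no jump, or the walk is
  high before the jump, or it leaves the line of slope -c after it.\<close>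

definition bad_word :: "nat \<Rightarrow> nat \<Rightarrow> real \<Rightarrow> real \<Rightarrow> nat list \<Rightarrow> bool" where
  "bad_word D J A c w \<longleftrightarrow> confined D 0 (take J w) \<or>
    (\<exists>j<J. first_jump D j w \<and>
      ((\<exists>i\<le>j. A \<le> real_of_int (steps (take i w))) \<or> deviates A c (drop (Suc j) w)))"

lemma prob_deviates_le:
  assumes "0 < a" and "real n * \<bar>c - drift p D\<bar> \<le> a / 2"
  shows "word_prob p n {v. deviates a c v} \<le>
    real n * (1 - measure_pmf.prob p {..D}) + 4 * real n * sqmom p D / a\<^sup>2"
proof -
  have "word_prob p n {v. deviates a c v} \<le>
    word_prob p n
      {w. \<exists>i\<le>n. a < \<bar>real_of_int (steps (take i w)) + real i * c\<bar>}"
    by (rule measure_pmf.finite_measure_mono_AE)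
      (auto simp: deviates_def AE_measure_pmf_iff set_replicate_pmf)
  then show ?thesis using prob_deviation_le[OF assms] by linarith
qed

lemma ex_first_jump:
  assumes "surv 0 (take J w)" "\<not> confined D 0 (take J w)" "J \<le> length w"
  shows "\<exists>j<J. first_jump D j w"
proof -
  have ex: "\<exists>j. j < J \<and> D < w ! j"
    using assms by (auto simp: confined_def in_set_conv_nth not_le) blast
  define j where "j = (LEAST j. j < J \<and> D < w ! j)"
  have j: "j < J" "D < w ! j" using LeastI_ex[OF ex] by (auto simp: j_def)
  have "w ! i \<le> D" if "i < j" for i
    using not_less_Least[of i "\<lambda>j. j < J \<and> D < w ! j"] that j(1) by (auto simp: j_def)
  then have "\<forall>k\<in>set (take j w). k \<le> D"
    by (auto simp: in_set_conv_nth)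
  moreover have "surv 0 (take j w)"
    using surv_take[OF assms(1), of j] j(1) by (simp add: min_def)
  ultimately show ?thesis using j by (auto simp: first_jump_def confined_def)
qed

text \<open>Makes the events indexed by the jump time disjoint, which turns the sum over jump times
  into a lower bound.\<close>

lemma first_jump_unique:
  assumes "first_jump D i w" "first_jump D j w" "j < length w" "i < length w"
  shows "i = j"
proof -
  have "\<not> i < j" if "first_jump D i w" "first_jump D j w" "i < length w" for i j
  proof
    assume "i < j"
    then have "w ! i \<in> set (take j w)" using that(3) by (auto simp: in_set_conv_nth intro!: exI[of _ i])
    then show False using that by (auto simp: first_jump_def confined_def)
  qed
  from this[of i j] this[of j i] assms show ?thesis by (simp add: linorder_neq_iff)
qed

lemma good_wordE:
  assumes "surv 0 (take J w)" "J \<le> length w" "\<not> bad_word D J A c w"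
  obtains j where "j < J" "first_jump D j w" "\<And>i. i \<le> j \<Longrightarrow> real_of_int (steps (take i w)) < A"
    "\<And>i. j < i \<Longrightarrow> i \<le> length w \<Longrightarrow>
      \<bar>real_of_int (steps (take i w)) - real_of_int (steps (take (Suc j) w)) + real (i - Suc j) * c\<bar> \<le> A"
proof -
  have "\<not> confined D 0 (take J w)" using assms(3) by (simp add: bad_word_def)
  from ex_first_jump[OF assms(1) this assms(2)] obtain j where j: "j < J" "first_jump D j w" by blast
  have 1: "real_of_int (steps (take i w)) < A" if "i \<le> j" for i
    using assms(3) j that unfolding bad_word_def by (meson not_less)
  have dev: "\<not> deviates A c (drop (Suc j) w)"
    using assms(3) j unfolding bad_word_def by blast
  have "\<bar>real_of_int (steps (take i w)) - real_of_int (steps (take (Suc j) w)) + real (i - Suc j) * c\<bar> \<le> A"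
    if "j < i" "i \<le> length w" for i
  proof -
    have "take i w = take (Suc j) w @ take (i - Suc j) (drop (Suc j) w)"
      using that by (metis Suc_leI le_add_diff_inverse take_add)
    then have "real_of_int (steps (take i w)) =
        real_of_int (steps (take (Suc j) w)) + real_of_int (steps (take (i - Suc j) (drop (Suc j) w)))"
      by simp
    moreover have "i - Suc j \<le> length (drop (Suc j) w)" using that by simp
    then have "\<bar>real_of_int (steps (take (i - Suc j) (drop (Suc j) w))) + real (i - Suc j) * c\<bar> \<le> A"
      using dev unfolding deviates_def by (meson not_less)
    ultimately show ?thesis by simp
  qed
  with 1 j that show thesis by blast
qed

lemma steps_take_Suc: "j < length w \<Longrightarrow> steps (take (Suc j) w) = steps (take j w) + int (w ! j) - 1"
  by (simp add: take_Suc_conv_app_nth)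

section \<open>Decomposition over the time of the first big jump\<close>

lemma prob_first_jump:
  assumes "j < n"
  shows "word_prob p n {w. take j w \<in> A \<and> first_jump D j w \<and> w ! j \<in> C \<and> drop (Suc j) w \<in> E} =
    word_prob p j {u. u \<in> A \<and> confined D 0 u} *
    measure_pmf.prob p (C \<inter> {D<..}) * word_prob p (n - Suc j) E"
  using prob_replicate_split[OF assms, of p "{u. u \<in> A \<and> confined D 0 u}" "C \<inter> {D<..}" E]
  by (simp add: first_jump_def conj_ac)

lemma prob_Ex_lessThan_le:
  fixes n :: nat
  shows
  "measure_pmf.prob p {w. \<exists>j<n. P j w} \<le> (\<Sum>j<n. measure_pmf.prob p {w. P j w})"
proof -
  have eq: "{w. \<exists>j<n. P j w} = (\<Union>j<n. {w. P j w})" by auto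
  show ?thesis unfolding eq
    by (rule measure_pmf.finite_measure_subadditive_finite) auto
qed

lemma sum_conf_le:
  assumes "0 < drift p D"
  shows "(\<Sum>j<J. confined_prob p D j 0) \<le> 1 / drift p D"
  using drift_sum_conf_le[of p D J] assms by (simp add: field_simps)

text \<open>Deviation after the jump is weighted by the probability of being alive at the jump time,
  and these sum to at most 1 / \<open>drift p D\<close>. For the height before the jump the crude
  count J suffices, since \<kappa> will itself be of order l.\<close>

lemma prob_bad_word_le:
  assumes "J \<le> H" and d: "0 < drift p D"
    and \<kappa>: "\<And>n. n < J \<Longrightarrow> word_prob p n
      {w. confined D 0 w \<and> (\<exists>i\<le>n. A \<le> real_of_int (steps (take i w)))} \<le> \<kappa>"
    and \<delta>: "\<And>n. n \<le> H \<Longrightarrow> word_prob p n {v. deviates A c v} \<le> \<delta>"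
  shows "word_prob p H {w. bad_word D J A c w} \<le>
    confined_prob p D J 0 + real J * \<kappa> * measure_pmf.prob p {D<..} +
    measure_pmf.prob p {D<..} * \<delta> / drift p D"
proof -
  let ?P = "word_prob p H" and ?g = "measure_pmf.prob p {D<..}"
  have "{w. bad_word D J A c w} = {w. confined D 0 (take J w)} \<union>
    ({w. \<exists>j<J. first_jump D j w \<and> (\<exists>i\<le>j. A \<le> real_of_int (steps (take i w)))} \<union>
     {w. \<exists>j<J. first_jump D j w \<and> deviates A c (drop (Suc j) w)})"
    unfolding bad_word_def by blast
  then have "?P {w. bad_word D J A c w} \<le> ?P {w. confined D 0 (take J w)} +
    ?P ({w. \<exists>j<J. first_jump D j w \<and> (\<exists>i\<le>j. A \<le> real_of_int (steps (take i w)))} \<union>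
     {w. \<exists>j<J. first_jump D j w \<and> deviates A c (drop (Suc j) w)})"
    using measure_Un_le[of "{w. confined D 0 (take J w)}" "replicate_pmf H p"] by simp
  also have "\<dots> \<le> ?P {w. confined D 0 (take J w)} +
    (?P {w. \<exists>j<J. first_jump D j w \<and> (\<exists>i\<le>j. A \<le> real_of_int (steps (take i w)))} +
     ?P {w. \<exists>j<J. first_jump D j w \<and> deviates A c (drop (Suc j) w)})"
    by (intro add_left_mono measure_Un_le) auto
  also have "?P {w. confined D 0 (take J w)} = confined_prob p D J 0"
    using prob_replicate_take[OF assms(1), of p "{w. confined D 0 w}"] by (simp add: prob_confined)
  also have "?P {w. \<exists>j<J. first_jump D j w \<and> (\<exists>i\<le>j. A \<le> real_of_int (steps (take i w)))} \<le>
    (\<Sum>j<J. ?P {w. first_jump D j w \<and> (\<exists>i\<le>j. A \<le> real_of_int (steps (take i w)))})"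
    by (rule prob_Ex_lessThan_le)
  also have "\<dots> \<le> (\<Sum>j<J. \<kappa> * ?g)"
  proof (rule sum_mono)
    fix j assume j: "j \<in> {..<J}"
    have "?P {w. first_jump D j w \<and> (\<exists>i\<le>j. A \<le> real_of_int (steps (take i w)))} =
      ?P {w. take j w \<in> {u. \<exists>i\<le>j. A \<le> real_of_int (steps (take i u))} \<and>
        first_jump D j w \<and> w ! j \<in> UNIV \<and> drop (Suc j) w \<in> UNIV}"
      by (intro arg_cong[of _ _ ?P]) (auto simp: min_def)
    also have "\<dots> = word_prob p j
        {w. (\<exists>i\<le>j. A \<le> real_of_int (steps (take i w))) \<and> confined D 0 w} * ?g"
      using j assms(1) by (subst prob_first_jump) auto
    also have "\<dots> \<le> \<kappa> * ?g"
      using \<kappa>[of j] j by (intro mult_right_mono) (auto simp: conj_commute)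
    finally show "?P {w. first_jump D j w \<and> (\<exists>i\<le>j. A \<le> real_of_int (steps (take i w)))} \<le> \<kappa> * ?g" .
  qed
  also have "(\<Sum>j<J. \<kappa> * ?g) = real J * \<kappa> * ?g" by simp
  also have "?P {w. \<exists>j<J. first_jump D j w \<and> deviates A c (drop (Suc j) w)} \<le>
      (\<Sum>j<J. ?P {w. first_jump D j w \<and> deviates A c (drop (Suc j) w)})"
    by (rule prob_Ex_lessThan_le)
  also have "\<dots> \<le> (\<Sum>j<J. confined_prob p D j 0 * (?g * \<delta>))"
  proof (rule sum_mono)
    fix j assume j: "j \<in> {..<J}"
    have "?P {w. first_jump D j w \<and> deviates A c (drop (Suc j) w)} =
      ?P {w. take j w \<in> UNIV \<and> first_jump D j w \<and> w ! j \<in> UNIV \<and> drop (Suc j) w \<in> {v. deviates A c v}}"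
      by simp
    also have "\<dots> = confined_prob p D j 0 * (?g * word_prob p (H - Suc j) {v. deviates A c v})"
      using j assms(1) by (subst prob_first_jump) (auto simp: prob_confined)
    also have "\<dots> \<le> confined_prob p D j 0 * (?g * \<delta>)"
      by (intro mult_left_mono \<delta> confined_mean_nonneg) auto
    finally show "?P {w. first_jump D j w \<and> deviates A c (drop (Suc j) w)} \<le> \<dots>" .
  qed
  also have "(\<Sum>j<J. confined_prob p D j 0 * (?g * \<delta>)) = (\<Sum>j<J. confined_prob p D j 0) * (?g * \<delta>)"
    by (simp add: sum_distrib_right)
  also have "\<dots> \<le> (1 / drift p D) * (?g * \<delta>)"
    using order_trans[OF measure_nonneg \<delta>[of 0]] d
    by (intro mult_right_mono sum_conf_le mult_nonneg_nonneg) auto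
  finally show ?thesis by (simp add: algebra_simps)
qed

text \<open>A good word that is alive at time N has paid for the descent of the line by one jump: at
  least (N - J) c, less A for the height before the jump and A for the deviation after it.\<close>

lemma prob_surv_le:
  assumes "0 < J" "J \<le> N" "N \<le> H" and d: "0 < drift p D" and c: "0 \<le> c"
  shows "word_prob p N {w. surv 0 w} \<le>
    word_prob p H {w. bad_word D J A c w} +
    tail p (real (N - J) * c - 2 * A) / drift p D"
proof -
  let ?P = "word_prob p H" and ?y = "real (N - J) * c - 2 * A"
  have "word_prob p N {w. surv 0 w} = ?P {w. surv 0 (take N w)}"
    using prob_replicate_take[OF assms(3), of p "{w. surv 0 w}"] by simp
  also have "\<dots> \<le> ?P ({w. bad_word D J A c w} \<union> {w. \<exists>j<J. first_jump D j w \<and> ?y \<le> real (w ! j)})"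
  proof (rule measure_pmf.finite_measure_mono_AE)
    show "AE w in measure_pmf (replicate_pmf H p). w \<in> {w. surv 0 (take N w)} \<longrightarrow>
      w \<in> {w. bad_word D J A c w} \<union> {w. \<exists>j<J. first_jump D j w \<and> ?y \<le> real (w ! j)}"
    proof (rule eventually_mono[OF AE_replicate_length[of H p]], rule impI)
      fix w :: "nat list"
      assume len: "length w = H" and "w \<in> {w. surv 0 (take N w)}"
      then have s: "surv 0 (take N w)" by simp
      show "w \<in> {w. bad_word D J A c w} \<union> {w. \<exists>j<J. first_jump D j w \<and> ?y \<le> real (w ! j)}"
      proof (cases "bad_word D J A c w")
        case False
        have "surv 0 (take J w)" using surv_take[OF s, of J] assms(2) by (simp add: min_def)
        then obtain j where j: "j < J" "first_jump D j w"
            "\<And>i. i \<le> j \<Longrightarrow> real_of_int (steps (take i w)) < A"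
          and dev: "\<And>i. j < i \<Longrightarrow> i \<le> length w \<Longrightarrow>
          \<bar>real_of_int (steps (take i w)) - real_of_int (steps (take (Suc j) w)) + real (i - Suc j) * c\<bar> \<le> A"
          using good_wordE[of J w D A c] False len assms by auto
        have "0 \<le> steps (take N w)"
          using s len assms(3) by (auto simp: surv_iff dest!: spec[of _ N])
        moreover have "\<bar>real_of_int (steps (take N w)) - real_of_int (steps (take (Suc j) w)) + real (N - Suc j) * c\<bar> \<le> A"
          using dev[of N] j(1) assms len by auto
        moreover have "real_of_int (steps (take (Suc j) w)) = real_of_int (steps (take j w)) + real (w ! j) - 1"
          using steps_take_Suc[of j w] j(1) assms len by simp
        moreover have "real_of_int (steps (take j w)) < A" by (rule j(3)) simp
        moreover have "real (N - J) * c \<le> real (N - Suc j) * c"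
          using j(1) c by (intro mult_right_mono) auto
        ultimately have "?y \<le> real (w ! j)" by linarith
        with j show ?thesis by auto
      qed auto
    qed
  qed auto
  also have "\<dots> \<le> ?P {w. bad_word D J A c w} + ?P {w. \<exists>j<J. first_jump D j w \<and> ?y \<le> real (w ! j)}"
    by (intro measure_Un_le) auto
  also have "?P {w. \<exists>j<J. first_jump D j w \<and> ?y \<le> real (w ! j)} \<le>
      (\<Sum>j<J. ?P {w. first_jump D j w \<and> ?y \<le> real (w ! j)})"
    by (rule prob_Ex_lessThan_le)
  also have "\<dots> \<le> (\<Sum>j<J. confined_prob p D j 0 * tail p ?y)"
  proof (rule sum_mono)
    fix j assume j: "j \<in> {..<J}"
    have "?P {w. first_jump D j w \<and> ?y \<le> real (w ! j)} =
      ?P {w. take j w \<in> UNIV \<and> first_jump D j w \<and> w ! j \<in> {k. ?y \<le> real k} \<and> drop (Suc j) w \<in> UNIV}"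
      by simp
    also have "\<dots> = confined_prob p D j 0 * measure_pmf.prob p ({k. ?y \<le> real k} \<inter> {D<..})"
      using j assms by (subst prob_first_jump) (auto simp: prob_confined)
    also have "\<dots> \<le> confined_prob p D j 0 * tail p ?y"
      unfolding tail_def by (intro mult_left_mono measure_pmf.finite_measure_mono confined_mean_nonneg) auto
    finally show "?P {w. first_jump D j w \<and> ?y \<le> real (w ! j)} \<le> confined_prob p D j 0 * tail p ?y" .
  qed
  also have "\<dots> = (\<Sum>j<J. confined_prob p D j 0) * tail p ?y"
    by (simp add: sum_distrib_right)
  also have "\<dots> \<le> (1 / drift p D) * tail p ?y"
    using d by (intro mult_right_mono sum_conf_le) (auto simp: tail_def)
  finally show ?thesis by simp
qed

text \<open>A letter of at least y outlasts the descent N c, the deviation A and the unit lost in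
  each step k - 1, so the walk survives all N steps. As D < y, such a letter is automatically a big
  jump.\<close>

lemma prob_surv_ge:
  assumes "J \<le> N" and c: "0 \<le> c" and y: "real N * c + A + 1 \<le> y" "real D < y"
    and \<delta>: "\<And>n. n \<le> N \<Longrightarrow> word_prob p n {v. deviates A c v} \<le> \<delta>"
  shows "(\<Sum>j<J. confined_prob p D j 0) * (tail p y * (1 - \<delta>)) \<le>
    word_prob p N {w. surv 0 w}"
proof -
  let ?P = "word_prob p N"
  \<comment> \<open>The length is part of \<open>F\<close> because uniqueness of the first jump
    holds for indices inside the word.\<close>
  define F where "F j = {w. length w = N \<and> first_jump D j w \<and> y \<le> real (w ! j) \<and> \<not> deviates A c (drop (Suc j) w)}" for j
  have "(\<Sum>j<J. confined_prob p D j 0) * (tail p y * (1 - \<delta>)) =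
      (\<Sum>j<J. confined_prob p D j 0 * (tail p y * (1 - \<delta>)))"
    by (simp add: sum_distrib_right)
  also have "\<dots> \<le> (\<Sum>j<J. ?P (F j))"
  proof (rule sum_mono)
    fix j assume j: "j \<in> {..<J}"
    have "1 - \<delta> \<le> word_prob p (N - Suc j) {v. \<not> deviates A c v}"
    proof -
      have "{v. \<not> deviates A c v} = UNIV - {v. deviates A c v}" by auto
      then have "word_prob p (N - Suc j) {v. \<not> deviates A c v} =
          1 - word_prob p (N - Suc j) {v. deviates A c v}"
        using measure_pmf.prob_compl[of "{v. deviates A c v}" "replicate_pmf (N - Suc j) p"] by simp
      then show ?thesis using \<delta>[of "N - Suc j"] by simp
    qed
    then have "confined_prob p D j 0 * (tail p y * (1 - \<delta>)) \<le>
      confined_prob p D j 0 * (tail p y * word_prob p (N - Suc j) {v. \<not> deviates A c v})"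
      by (intro mult_left_mono confined_mean_nonneg) (auto simp: tail_def)
    also have tl: "tail p y = measure_pmf.prob p ({k. y \<le> real k} \<inter> {D<..})"
      unfolding tail_def using y by (intro arg_cong[of _ _ "measure_pmf.prob p"]) auto
    also have "confined_prob p D j 0 * (measure_pmf.prob p ({k. y \<le> real k} \<inter> {D<..}) *
        word_prob p (N - Suc j) {v. \<not> deviates A c v}) =
      ?P {w. take j w \<in> UNIV \<and> first_jump D j w \<and> w ! j \<in> {k. y \<le> real k} \<and>
        drop (Suc j) w \<in> {v. \<not> deviates A c v}}"
      using j assms by (subst prob_first_jump) (auto simp: prob_confined)
    also have "\<dots> = ?P (F j)"
    proof (rule measure_pmf.finite_measure_eq_AE)
      show "AE w in measure_pmf (replicate_pmf N p). (w \<in> {w. take j w \<in> UNIV \<and> first_jump D j w \<and>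
          w ! j \<in> {k. y \<le> real k} \<and> drop (Suc j) w \<in> {v. \<not> deviates A c v}}) = (w \<in> F j)"
        using AE_replicate_length[of N p] by eventually_elim (auto simp: F_def)
    qed auto
    finally show "confined_prob p D j 0 * (tail p y * (1 - \<delta>)) \<le> ?P (F j)" unfolding tl .
  qed
  also have "\<dots> = ?P (\<Union>j<J. F j)"
  proof (rule measure_pmf.finite_measure_finite_Union[symmetric])
    show "disjoint_family_on F {..<J}"
      unfolding disjoint_family_on_def F_def using assms(1)
      by (auto intro: first_jump_unique)
  qed auto
  also have "\<dots> \<le> ?P {w. surv 0 w}"
  proof (rule measure_pmf.finite_measure_mono)
    show "(\<Union>j<J. F j) \<subseteq> {w. surv 0 w}"
    proof
      fix w assume "w \<in> (\<Union>j<J. F j)"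
      then obtain j where j: "j < J" and len: "length w = N" and f: "first_jump D j w"
        and k: "y \<le> real (w ! j)" and dev: "\<not> deviates A c (drop (Suc j) w)"
        by (auto simp: F_def)
      have jN: "j < length w" using j len assms(1) by simp
      have s: "surv 0 (take j w)" using f by (simp add: first_jump_def confined_def)
      then have sj: "0 \<le> steps (take j w)"
        using jN by (auto simp: surv_iff dest!: spec[of _ j])
      have w: "w = take j w @ w ! j # drop (Suc j) w" using jN by (simp add: id_take_nth_drop)
      have "surv (steps (take j w) + int (w ! j) - 1) (drop (Suc j) w)"
        unfolding surv_iff
      proof (intro allI impI)
        fix i assume i: "i \<le> length (drop (Suc j) w)"
        then have "\<bar>real_of_int (steps (take i (drop (Suc j) w))) + real i * c\<bar> \<le> A"
          using dev by (auto simp: deviates_def not_less)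
        moreover have "real i * c \<le> real N * c"
          using i len c by (intro mult_right_mono) auto
        ultimately have "0 \<le> real_of_int (steps (take j w)) + real (w ! j) - 1 +
            real_of_int (steps (take i (drop (Suc j) w)))"
          using k y(1) sj by linarith
        then show "0 \<le> steps (take j w) + int (w ! j) - 1 + steps (take i (drop (Suc j) w))"
          by linarith
      qed
      then have "surv 0 (take j w @ w ! j # drop (Suc j) w)"
        unfolding surv_append using s sj by simp
      then show "w \<in> {w. surv 0 w}" using w by simp
    qed
  qed auto
  finally show ?thesis .
qed

section \<open>Trees and excursions\<close>

lemma tree_size_neq_0 [simp]: "tree_size \<tau> \<noteq> 0"
  using tree_size_pos[of \<tau>] by linarith

definition degs :: "plane_tree \<Rightarrow> nat list" where
  "degs \<tau> = map (num_children \<tau>) (sorted_list_of_set (vertices \<tau>))"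

text \<open>First passage to -1 exactly at the end of the word.\<close>

definition excursion :: "nat list \<Rightarrow> bool" where
  "excursion w \<longleftrightarrow> steps w = -1 \<and> (\<forall>i<length w. 0 \<le> steps (take i w))"

lemma sorted_concat_Cons:
  fixes f :: "nat \<Rightarrow> nat list list"
  assumes "sorted_wrt (<) is" "\<And>i. i \<in> set is \<Longrightarrow> sorted_wrt (<) (f i)"
  shows "sorted_wrt (<) (concat (map (\<lambda>i. map ((#) i) (f i)) is))"
  using assms by (induction "is") (auto simp: sorted_wrt_append sorted_wrt_map)

text \<open>Lexicographic order compares the child index first, so the root comes first and the
  subtrees follow as consecutive blocks: it is the depth-first order.\<close>

lemma sorted_vertices_Node:
  "sorted_list_of_set (vertices (Node ts)) =
    [] # concat (map (\<lambda>i. map ((#) i) (sorted_list_of_set (vertices (ts ! i)))) [0..<length ts])"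
    (is "?l = ?r")
proof (rule strict_sorted_equal)
  show "sorted_wrt (<) ?l" by (rule strict_sorted_list_of_set)
  show "sorted_wrt (<) ?r"
    using sorted_concat_Cons[of "[0..<length ts]" "\<lambda>i. sorted_list_of_set (vertices (ts ! i))"]
    by (auto simp: sorted_wrt_upt)
  show "set ?l = set ?r"
  proof -
    have l: "set ?l = vertices (Node ts)" by (rule set_sorted_list_of_set) simp
    show ?thesis unfolding l by (subst vertices_rec[of "Node ts"]) (simp add: atLeast0LessThan)
  qed
qed

lemma num_children_Cons: "num_children (Node ts) (i # u) = num_children (ts ! i) u"
  by (simp add: num_children_def)

lemma degs_Node: "degs (Node ts) = length ts # concat (map degs ts)"
proof -
  have "map degs ts = map (\<lambda>i. degs (ts ! i)) [0..<length ts]"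
    by (rule nth_equalityI) auto
  then show ?thesis
    unfolding degs_def sorted_vertices_Node
    by (simp add: map_concat comp_def num_children_Cons) (simp add: num_children_def)
qed

lemma length_degs: "length (degs \<tau>) = tree_size \<tau>"
  by (simp add: degs_def tree_size_def)

lemma prod_vertices: "(\<Prod>u\<in>vertices \<tau>. f (num_children \<tau> u)) = prod_list (map f (degs \<tau>))"
proof -
  have "(\<Prod>u\<in>vertices \<tau>. f (num_children \<tau> u)) =
      prod_list (map (\<lambda>u. f (num_children \<tau> u)) (sorted_list_of_set (vertices \<tau>)))"
    by (subst prod.distinct_set_conv_list[symmetric]) auto
  then show ?thesis by (simp add: degs_def comp_def)
qed

lemma steps_take_sum: "m \<le> length w \<Longrightarrow> steps (take m w) = (\<Sum>j<m. int (w ! j) - 1)"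
  by (induction m) (auto simp: steps_take_Suc)

lemma lukasiewicz_eq_steps:
  "lukasiewicz \<tau> i = (if 0 \<le> i \<and> i \<le> int (tree_size \<tau>) then steps (take (nat i) (degs \<tau>)) else 0)"
proof (cases "0 \<le> i \<and> i \<le> int (tree_size \<tau>)")
  case True
  then have le: "nat i \<le> length (degs \<tau>)" by (auto simp: length_degs)
  have "(\<Sum>j<nat i. int (num_children \<tau> (vertex_nth \<tau> j)) - 1) = (\<Sum>j<nat i. int (degs \<tau> ! j) - 1)"
    using le by (intro sum.cong) (auto simp: degs_def vertex_nth_def)
  then show ?thesis using True steps_take_sum[OF le] by (simp add: lukasiewicz_def)
qed (auto simp: lukasiewicz_def)

section \<open>Coding of forests by first-passage words\<close>

text \<open>Forests make the inductions work: deleting the first root leaves its children followed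
  by the other trees, and deletes exactly the first letter of the word.\<close>

definition forest_degs :: "plane_tree list \<Rightarrow> nat list" where
  "forest_degs ts = concat (map degs ts)"

lemma forest_degs_simps [simp]:
  "forest_degs [] = []"
  "forest_degs (Node us # ts) = length us # forest_degs (us @ ts)"
  by (simp_all add: forest_degs_def degs_Node)

lemma forest_nonempty_cases: "ts \<noteq> [] \<Longrightarrow> \<exists>us ts'. ts = Node us # ts'"
  by (metis list.exhaust plane_tree.exhaust)

lemma forest_degs_first_passage:
  "steps (forest_degs ts) = - int (length ts) \<and>
    (\<forall>i<length (forest_degs ts). - int (length ts) < steps (take i (forest_degs ts)))"
proof (induction "length (forest_degs ts)" arbitrary: ts rule: less_induct)
  case less
  show ?case
  proof (cases "ts = []")
    case False
    then obtain us ts' where ts: "ts = Node us # ts'" using forest_nonempty_cases by blast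
    note IH = less[of "us @ ts'"]
    show ?thesis
    proof (intro conjI allI impI)
      show "steps (forest_degs ts) = - int (length ts)" using IH ts by simp
      fix i assume "i < length (forest_degs ts)"
      with IH ts show "- int (length ts) < steps (take i (forest_degs ts))"
        by (cases i) fastforce+
    qed
  qed simp
qed

text \<open>The first letter tells how many trees of the remaining forest were children of the
  deleted root, so the split of the list is recovered.\<close>

lemma forest_degs_inj:
  "length ts = length ts' \<Longrightarrow> forest_degs ts = forest_degs ts' \<Longrightarrow> ts = ts'"
proof (induction "length (forest_degs ts)" arbitrary: ts ts' rule: less_induct)
  case less
  show ?case
  proof (cases "ts = []")
    case False
    then obtain us vs where ts: "ts = Node us # vs" using forest_nonempty_cases by blast
    have "ts' \<noteq> []" using False less.prems(1) by auto
    then obtain us' vs' where ts': "ts' = Node us' # vs'" using forest_nonempty_cases by blast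
    have "us @ vs = us' @ vs'"
      by (rule less.hyps) (use less.prems ts ts' in auto)
    then show ?thesis using less.prems ts ts' by auto
  qed (use less.prems in auto)
qed

text \<open>Decoding letter by letter: after the letter k the rest codes r - 1 + k trees, the first
  k of which become the children of a new root.\<close>

lemma forest_degs_surj:
  assumes "steps w = - int r" "\<forall>i<length w. - int r < steps (take i w)"
  shows "\<exists>ts. length ts = r \<and> forest_degs ts = w"
  using assms
proof (induction w arbitrary: r)
  case Nil
  then show ?case by auto
next
  case (Cons k w)
  have r: "0 < r" using Cons.prems(2)[rule_format, of 0] by simp
  have "\<exists>ts. length ts = r - 1 + k \<and> forest_degs ts = w"
  proof (rule Cons.IH)
    show "steps w = - int (r - 1 + k)" using Cons.prems(1) r by simp
    show "\<forall>i<length w. - int (r - 1 + k) < steps (take i w)"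
    proof (intro allI impI)
      fix i assume "i < length w"
      then show "- int (r - 1 + k) < steps (take i w)"
        using Cons.prems(2)[rule_format, of "Suc i"] r by simp
    qed
  qed
  then obtain ts where ts: "length ts = r - 1 + k" "forest_degs ts = w" by blast
  then show ?case
    using r by (intro exI[of _ "Node (take k ts) # drop k ts"]) simp
qed

lemma bij_betw_degs: "bij_betw degs UNIV {w. excursion w}"
proof (rule bij_betwI')
  have single: "forest_degs [\<tau>] = degs \<tau>" for \<tau> by (simp add: forest_degs_def)
  show "degs x = degs y \<longleftrightarrow> x = y" for x y
    using forest_degs_inj[of "[x]" "[y]"] by (auto simp: single)
  show "degs x \<in> {w. excursion w}" for x
    using forest_degs_first_passage[of "[x]"] by (fastforce simp: single excursion_def)
  fix w assume "w \<in> {w. excursion w}"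
  then have "steps w = - int 1" "\<forall>i<length w. - int 1 < steps (take i w)"
    by (fastforce simp: excursion_def)+
  from forest_degs_surj[OF this] obtain ts where ts: "length ts = 1" "forest_degs ts = w" by blast
  then obtain \<tau> where "ts = [\<tau>]" by (auto simp: length_Suc_conv)
  with ts show "\<exists>\<tau>\<in>UNIV. w = degs \<tau>" by (auto simp: single)
qed

lemma pmf_replicate: "length w = n \<Longrightarrow> pmf (replicate_pmf n p) w = prod_list (map (pmf p) w)" for p :: "nat pmf"
proof (induction w arbitrary: n)
  case (Cons k w)
  then obtain m where n: "n = Suc m" "length w = m" by auto
  have "pmf (replicate_pmf (Suc m) p) (k # w) =
      (\<integral>j. indicator {k} j * pmf (replicate_pmf m p) w \<partial>measure_pmf p)"
    unfolding pmf.rep_eq prob_replicate_Suc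
    by (intro Bochner_Integration.integral_cong) (auto simp: indicator_def)
  also have "\<dots> = pmf p k * pmf (replicate_pmf m p) w"
    by (simp add: pmf.rep_eq)
  finally show ?case using Cons.IH n by simp
qed simp

lemma emeasure_BGW: "emeasure (BGW \<mu>) A = (\<integral>\<^sup>+\<tau>. ennreal (prod_list (map (pmf \<mu>) (degs \<tau>))) \<partial>count_space A)"
  unfolding BGW_def prod_vertices
  by (subst emeasure_density) (auto simp: nn_integral_count_space_indicator)

lemma sets_BGW [simp]: "sets (BGW \<mu>) = UNIV" "space (BGW \<mu>) = UNIV"
  by (simp_all add: BGW_def)

lemma emeasure_BGW_size:
  "emeasure (BGW \<mu>) {\<tau>. tree_size \<tau> = k \<and> Q (degs \<tau>)} =
    emeasure (measure_pmf (replicate_pmf k \<mu>)) {w. excursion w \<and> Q w}"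
proof -
  let ?A = "{\<tau>. tree_size \<tau> = k \<and> Q (degs \<tau>)}" and ?B = "{w. excursion w \<and> Q w \<and> length w = k}"
  have bij: "bij_betw degs ?A ?B"
    unfolding bij_betw_def
  proof
    show "inj_on degs ?A"
      using bij_betw_degs by (auto simp: bij_betw_def intro: inj_on_subset)
    show "degs ` ?A = ?B"
    proof (intro equalityI subsetI)
      fix w assume "w \<in> ?B"
      moreover from this obtain \<tau> where "w = degs \<tau>" using bij_betw_degs by (auto simp: bij_betw_def)
      ultimately show "w \<in> degs ` ?A" by (auto simp: length_degs)
    qed (use bij_betw_degs in \<open>auto simp: bij_betw_def length_degs\<close>)
  qed
  have "emeasure (BGW \<mu>) ?A = (\<integral>\<^sup>+\<tau>. ennreal (prod_list (map (pmf \<mu>) (degs \<tau>))) \<partial>count_space ?A)"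
    by (rule emeasure_BGW)
  also have "\<dots> = (\<integral>\<^sup>+w. ennreal (prod_list (map (pmf \<mu>) w)) \<partial>count_space ?B)"
    by (rule nn_integral_bij_count_space[OF bij])
  also have "\<dots> = (\<integral>\<^sup>+w. ennreal (pmf (replicate_pmf k \<mu>) w) \<partial>count_space ?B)"
    by (intro nn_integral_cong) (auto simp: pmf_replicate)
  also have "\<dots> = emeasure (measure_pmf (replicate_pmf k \<mu>)) ?B"
    by (rule nn_integral_pmf)
  also have "\<dots> = emeasure (measure_pmf (replicate_pmf k \<mu>)) {w. excursion w \<and> Q w}"
    by (rule emeasure_eq_AE) (auto simp: AE_measure_pmf_iff set_replicate_pmf)
  finally show ?thesis .
qed

section \<open>Tree size and survival of the walk\<close>

definition surv_prob :: "nat pmf \<Rightarrow> nat \<Rightarrow> real" where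
  "surv_prob p n = word_prob p n {w. surv 0 w}"

lemma surv_prob_0 [simp]: "surv_prob p 0 = 1"
  by (simp add: surv_prob_def)

text \<open>The walk descends by at most 1, so one that survives k steps but not k + 1 sits at -1 at
  time k + 1.\<close>

lemma prob_excursion: "word_prob p (Suc k) {w. excursion w} =
  surv_prob p k - surv_prob p (Suc k)"
proof -
  let ?P = "word_prob p (Suc k)"
  have "surv_prob p k = ?P {w. surv 0 (take k w)}"
    using prob_replicate_take[of k "Suc k" p "{w. surv 0 w}"] by (simp add: surv_prob_def)
  also have "\<dots> = ?P ({w. surv 0 w} \<union> {w. excursion w \<and> \<not> surv 0 w})"
  proof (rule measure_pmf.finite_measure_eq_AE)
    show "AE w in measure_pmf (replicate_pmf (Suc k) p).
        (w \<in> {w. surv 0 (take k w)}) = (w \<in> {w. surv 0 w} \<union> {w. excursion w \<and> \<not> surv 0 w})"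
      using AE_replicate_length[of "Suc k" p]
    proof eventually_elim
      case (elim w)
      have "excursion w" if s: "surv 0 (take k w)" and ns: "\<not> surv 0 w"
      proof -
        have nn: "0 \<le> steps (take i w)" if "i \<le> k" for i
          using s that elim by (auto simp: surv_iff min_def dest!: spec[of _ i])
        have "steps w < 0"
        proof (rule ccontr)
          assume "\<not> steps w < 0"
          then have "0 \<le> 0 + steps (take i w)" if "i \<le> length w" for i
            using nn[of i] that elim by (cases "i \<le> k") (auto simp: not_le le_Suc_eq)
          then show False using ns by (auto simp: surv_iff)
        qed
        moreover have "steps w = steps (take k w) + int (w ! k) - 1"
          using steps_take_Suc[of k w] elim by simp
        moreover have "0 \<le> steps (take k w)" by (rule nn) simp
        ultimately have "steps w = -1" by linarith
        then show ?thesis using nn elim by (auto simp: excursion_def)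
      qed
      moreover have "surv 0 (take k w)" if "excursion w"
        using that elim by (auto simp: excursion_def surv_iff)
      ultimately show ?case using surv_take by auto
    qed
  qed auto
  also have "\<dots> = surv_prob p (Suc k) + ?P {w. excursion w \<and> \<not> surv 0 w}"
    unfolding surv_prob_def by (rule measure_pmf.finite_measure_Union) auto
  also have "{w. excursion w \<and> \<not> surv 0 w} = {w. excursion w}"
    by (auto simp: excursion_def surv_iff)
  finally show ?thesis by simp
qed

lemma surv_prob_le_1: "surv_prob p k \<le> 1"
  by (simp add: surv_prob_def)

lemma surv_prob_nonneg: "0 \<le> surv_prob p k"
  by (simp add: surv_prob_def)

lemma emeasure_BGW_size_le: "emeasure (BGW \<mu>) {\<tau>. tree_size \<tau> \<le> k} = ennreal (1 - surv_prob \<mu> k)"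
proof (induction k)
  case 0
  have "{\<tau>. tree_size \<tau> \<le> 0} = {}" by auto
  then show ?case by simp
next
  case (Suc k)
  have "{\<tau>. tree_size \<tau> \<le> Suc k} = {\<tau>. tree_size \<tau> \<le> k} \<union> {\<tau>. tree_size \<tau> = Suc k \<and> True}" by auto
  then have "emeasure (BGW \<mu>) {\<tau>. tree_size \<tau> \<le> Suc k} =
      emeasure (BGW \<mu>) {\<tau>. tree_size \<tau> \<le> k} + emeasure (BGW \<mu>) {\<tau>. tree_size \<tau> = Suc k \<and> True}"
    by (simp only:) (intro plus_emeasure[symmetric], auto)
  also have "\<dots> = ennreal (1 - surv_prob \<mu> k) + ennreal (surv_prob \<mu> k - surv_prob \<mu> (Suc k))"
    using emeasure_BGW_size[of \<mu> "Suc k" "\<lambda>_. True"] Suc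
    by (simp add: measure_pmf.emeasure_eq_measure prob_excursion del: replicate_pmf.simps)
  also have "\<dots> = ennreal (1 - surv_prob \<mu> (Suc k))"
    using surv_prob_le_1[of \<mu> k] prob_excursion[of k \<mu>]
      measure_nonneg[of "measure_pmf (replicate_pmf (Suc k) \<mu>)" "{w. excursion w}"]
    by (subst ennreal_plus[symmetric]) (auto simp del: replicate_pmf.simps)
  finally show ?case .
qed

text \<open>The measure charges only finite trees, so total mass 1 has to be derived from the fact
  that the walk eventually dies.\<close>

lemma emeasure_BGW_UNIV:
  assumes "(\<lambda>k. surv_prob \<mu> k) \<longlonglongrightarrow> 0"
  shows "emeasure (BGW \<mu>) UNIV = 1"
proof -
  have "(\<lambda>k. emeasure (BGW \<mu>) {\<tau>. tree_size \<tau> \<le> k}) \<longlonglongrightarrow> emeasure (BGW \<mu>) (\<Union>k. {\<tau>. tree_size \<tau> \<le> k})"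
    by (rule Lim_emeasure_incseq) (auto simp: incseq_def)
  moreover have "(\<Union>k. {\<tau>. tree_size \<tau> \<le> k}) = UNIV" by auto
  moreover have "(\<lambda>k. ennreal (1 - surv_prob \<mu> k)) \<longlonglongrightarrow> ennreal (1 - 0)"
    by (intro tendsto_ennrealI tendsto_intros assms)
  ultimately show ?thesis
    unfolding emeasure_BGW_size_le by (auto dest: LIMSEQ_unique)
qed

lemma prob_space_BGW:
  assumes "(\<lambda>k. surv_prob \<mu> k) \<longlonglongrightarrow> 0"
  shows "prob_space (BGW \<mu>)"
  using emeasure_BGW_UNIV[OF assms] by (intro prob_spaceI) simp

text \<open>The shift by 1: the first passage to -1 comes no earlier than time n iff the walk
  survives n - 1 steps.\<close>

lemma measure_BGW_size_ge:
  assumes "(\<lambda>k. surv_prob \<mu> k) \<longlonglongrightarrow> 0"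
  shows "measure (BGW \<mu>) {\<tau>. n \<le> tree_size \<tau>} = surv_prob \<mu> (n - 1)"
proof -
  interpret prob_space "BGW \<mu>" by (rule prob_space_BGW[OF assms])
  have "{\<tau>. n \<le> tree_size \<tau>} = space (BGW \<mu>) - {\<tau>. tree_size \<tau> \<le> n - 1}"
    by (cases n) (auto simp: not_le)
  then have "measure (BGW \<mu>) {\<tau>. n \<le> tree_size \<tau>} = 1 - measure (BGW \<mu>) {\<tau>. tree_size \<tau> \<le> n - 1}"
    by (simp only:) (rule prob_compl, simp)
  also have "measure (BGW \<mu>) {\<tau>. tree_size \<tau> \<le> n - 1} = 1 - surv_prob \<mu> (n - 1)"
    using emeasure_BGW_size_le[of \<mu> "n - 1"] surv_prob_le_1[of \<mu> "n - 1"]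
    by (simp add: emeasure_eq_measure)
  finally show ?thesis by simp
qed

lemma excursion_take_unique:
  assumes "excursion (take i w)" "excursion (take j w)" "i \<le> length w" "j \<le> length w"
  shows "i = j"
proof -
  have "\<not> i < j" if "excursion (take i w)" "excursion (take j w)" "i \<le> length w" "j \<le> length w" for i j
    using that by (auto simp: excursion_def dest!: spec[of _ i])
  from this[of i j] this[of j i] assms show ?thesis by (simp add: linorder_neq_iff)
qed

text \<open>Trees of different sizes become prefixes of words of one common length n. A word has at
  most one excursion prefix, so the events for the different sizes are disjoint and their sum is a
  single word probability.\<close>

lemma measure_BGW_size_between_le:
  assumes "(\<lambda>k. surv_prob \<mu> k) \<longlonglongrightarrow> 0"
  shows "measure (BGW \<mu>) {\<tau>. m \<le> tree_size \<tau> \<and> tree_size \<tau> \<le> n \<and> Q (degs \<tau>)} \<le>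
    word_prob \<mu> n {w. \<exists>k\<in>{m..n}. excursion (take k w) \<and> Q (take k w)}"
proof -
  interpret prob_space "BGW \<mu>" by (rule prob_space_BGW[OF assms])
  let ?P = "word_prob \<mu> n"
  define F where "F k = {w. length w = n \<and> excursion (take k w) \<and> Q (take k w)}" for k
  have "{\<tau>. m \<le> tree_size \<tau> \<and> tree_size \<tau> \<le> n \<and> Q (degs \<tau>)} =
      (\<Union>k\<in>{m..n}. {\<tau>. tree_size \<tau> = k \<and> Q (degs \<tau>)})" by auto
  then have "measure (BGW \<mu>) {\<tau>. m \<le> tree_size \<tau> \<and> tree_size \<tau> \<le> n \<and> Q (degs \<tau>)} \<le>
      (\<Sum>k\<in>{m..n}. measure (BGW \<mu>) {\<tau>. tree_size \<tau> = k \<and> Q (degs \<tau>)})"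
    by (simp only:) (intro finite_measure_subadditive_finite, auto)
  also have "\<dots> = (\<Sum>k\<in>{m..n}. ?P (F k))"
  proof (rule sum.cong)
    fix k assume k: "k \<in> {m..n}"
    have "measure (BGW \<mu>) {\<tau>. tree_size \<tau> = k \<and> Q (degs \<tau>)} =
        word_prob \<mu> k {w. excursion w \<and> Q w}"
      unfolding measure_def emeasure_BGW_size ..
    also have "\<dots> = ?P {w. take k w \<in> {w. excursion w \<and> Q w}}"
      using k by (intro prob_replicate_take[symmetric]) auto
    also have "\<dots> = ?P (F k)"
      by (rule measure_pmf.finite_measure_eq_AE)
        (auto simp: F_def AE_measure_pmf_iff set_replicate_pmf)
    finally show "measure (BGW \<mu>) {\<tau>. tree_size \<tau> = k \<and> Q (degs \<tau>)} = ?P (F k)" .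
  qed simp
  also have "\<dots> = ?P (\<Union>k\<in>{m..n}. F k)"
  proof (rule measure_pmf.finite_measure_finite_Union[symmetric])
    show "disjoint_family_on F {m..n}"
      unfolding disjoint_family_on_def F_def by (auto intro: excursion_take_unique)
  qed auto
  also have "\<dots> \<le> ?P {w. \<exists>k\<in>{m..n}. excursion (take k w) \<and> Q (take k w)}"
    by (intro measure_pmf.finite_measure_mono) (auto simp: F_def)
  finally show ?thesis .
qed

section \<open>Regular variation\<close>

text \<open>The quotient is controlled only at integer scales and integer points; monotonicity
  bridges the gaps.\<close>

lemma regular_variation_from_integers:
  fixes f :: "real \<Rightarrow> real"
  assumes anti: "\<And>x y. x \<le> y \<Longrightarrow> f y \<le> f x" and pos: "\<And>x. 0 < f x"
    and int: "\<And>m::nat. 0 < m \<Longrightarrow> (\<lambda>n. f (real m * real n) / f (real n)) \<longlonglongrightarrow> 1 / real m"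
    and c: "0 < c"
  shows "((\<lambda>x. f (c * x) / f x) \<longlongrightarrow> 1 / c) at_top"
proof -
  have upper: "\<forall>\<^sub>F x in at_top. f (c * x) / f x < u" if c: "0 < c" and u: "1 / c < u" for c u
  proof -
    \<comment> \<open>Let m = floor (c q). For x between q i and q (i + 1) with i \<ge> q one has m
      i \<le> c x and x \<le> (q + 1) i, so the quotient at x is bounded by one between integer
      multiples of i, whose limit (q + 1) / m is below u for suitable q.\<close>
    have "((\<lambda>q. (q + 1) / (c * q - 1)) \<longlongrightarrow> inverse c) at_top"
      using c by real_asymp
    then have "((\<lambda>q. (q + 1) / (c * q - 1)) \<longlongrightarrow> 1 / c) at_top"
      by (simp add: inverse_eq_divide)
    then have "\<forall>\<^sub>F q in at_top. (q + 1) / (c * q - 1) < u"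
      using u by (rule order_tendstoD)
    then have "\<forall>\<^sub>F q in sequentially. (real q + 1) / (c * real q - 1) < u"
      using filterlim_real_sequentially by (rule eventually_compose_filterlim)
    moreover have "\<forall>\<^sub>F q in sequentially. 1 < c * real q"
      using c by real_asymp
    ultimately have "\<forall>\<^sub>F q in sequentially. 0 < q \<and> 1 < c * real q \<and> (real q + 1) / (c * real q - 1) < u"
      using eventually_gt_at_top[of "0::nat"] by eventually_elim auto
    then obtain q :: nat where q: "0 < q" "1 < c * real q" "(real q + 1) / (c * real q - 1) < u"
      by (metis (mono_tags, lifting) eventually_sequentially order_refl)
    define m where "m = nat \<lfloor>c * real q\<rfloor>"
    have m: "0 < m" "real m \<le> c * real q" "c * real q - 1 < real m"
      using q by (auto simp: m_def)
    have "(\<lambda>i. (f (real m * real i) / f (real i)) / (f (real (q + 1) * real i) / f (real i)))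
        \<longlonglongrightarrow> (1 / real m) / (1 / real (q + 1))"
      using m by (intro tendsto_divide int) auto
    moreover have "(1 / real m) / (1 / real (q + 1)) < u"
    proof -
      have "(1 / real m) / (1 / real (q + 1)) = (real q + 1) / real m" by simp
      also have "\<dots> \<le> (real q + 1) / (c * real q - 1)"
        using m q by (intro divide_left_mono) auto
      also have "\<dots> < u" by (rule q)
      finally show ?thesis .
    qed
    ultimately have "\<forall>\<^sub>F i in sequentially. (f (real m * real i) / f (real i)) / (f (real (q + 1) * real i) / f (real i)) < u"
      by (rule order_tendstoD)
    then have ev: "\<forall>\<^sub>F i in sequentially. f (real m * real i) / f (real (q + 1) * real i) < u"
      by eventually_elim (use pos in \<open>simp add: less_imp_neq[symmetric] order_less_imp_not_eq2\<close>)
    have lim: "filterlim (\<lambda>x. nat \<lfloor>x / real q\<rfloor>) sequentially at_top"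
      using q by real_asymp
    have "\<forall>\<^sub>F i in sequentially. q \<le> i \<and> f (real m * real i) / f (real (q + 1) * real i) < u"
      using ev eventually_ge_at_top[of q] by eventually_elim auto
    from eventually_compose_filterlim[OF this lim] eventually_ge_at_top[of "0::real"]
    show ?thesis
    proof eventually_elim
      case (elim x)
      define i where "i = nat \<lfloor>x / real q\<rfloor>"
      have i: "real i \<le> x / real q" "x / real q < real i + 1"
        using elim q by (auto simp: i_def)
      have iq: "q \<le> i" and lt: "f (real m * real i) / f (real (q + 1) * real i) < u"
        using elim by (auto simp: i_def)
      have 1: "real q * real i \<le> x" "x \<le> real q * (real i + 1)"
        using i q by (auto simp: field_simps)
      have "real m * real i \<le> (c * real q) * real i"
        using m by (intro mult_right_mono) auto
      also have "\<dots> = c * (real q * real i)" by simp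
      also have "\<dots> \<le> c * x" using 1 c by (intro mult_left_mono) auto
      finally have "f (c * x) \<le> f (real m * real i)" by (rule anti)
      moreover have "f (real (q + 1) * real i) \<le> f x"
        using 1 iq by (intro anti) (auto simp: algebra_simps)
      ultimately have "f (c * x) / f x \<le> f (real m * real i) / f (real (q + 1) * real i)"
        using pos by (intro frac_le) (auto intro: less_imp_le)
      then show ?case using lt by linarith
    qed
  qed
  show ?thesis
  proof (rule order_tendstoI)
    fix u assume "1 / c < u"
    then show "\<forall>\<^sub>F x in at_top. f (c * x) / f x < u" using upper c by blast
  next
    fix l assume l: "l < 1 / c"
    show "\<forall>\<^sub>F x in at_top. l < f (c * x) / f x"
    proof (cases "0 < l")
      case True
      \<comment> \<open>The upper bound for the scale 1 / c, taken at the point c x, inverts to the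
        lower bound.\<close>
      have "1 / (1 / c) < 1 / l" using l True c by (simp add: field_simps)
      then have ev: "\<forall>\<^sub>F x in at_top. f ((1 / c) * x) / f x < 1 / l"
        using c by (intro upper) auto
      have "filterlim (\<lambda>x. c * x) at_top at_top"
        using c by (intro filterlim_tendsto_pos_mult_at_top[OF tendsto_const _ filterlim_ident])
      from eventually_compose_filterlim[OF ev this] show ?thesis
      proof eventually_elim
        case (elim x)
        then have "f x / f (c * x) < 1 / l" using c by simp
        then show ?case using True pos[of x] pos[of "c * x"] by (simp add: field_simps)
      qed
    next
      case False
      have "l < f (c * x) / f x" for x
        using False divide_pos_pos[OF pos[of "c * x"] pos[of x]] by linarith
      then show ?thesis by simp
    qed
  qed
qed

lemma tail_antimono: "x \<le> y \<Longrightarrow> tail p y \<le> tail p x"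
  unfolding tail_def by (intro measure_pmf.finite_measure_mono) auto

lemma tail_nonneg: "0 \<le> tail p x"
  by (simp add: tail_def)

lemma tail_of_nat: "tail p (real n) = measure_pmf.prob p {n..}"
  by (simp add: tail_def atLeast_def)

lemma slowly_varyingD:
  assumes "slowly_varying L"
  shows "\<forall>\<^sub>F x in at_top. 0 < L x" "0 < c \<Longrightarrow> ((\<lambda>x. L (c * x) / L x) \<longlongrightarrow> 1) at_top"
  using assms unfolding slowly_varying_def eventually_at_top_linorder by blast+

text \<open>Slow variation cancels L in the quotient and leaves 1 / m. Positivity at large integers
  spreads to every x because the tail decreases.\<close>

lemma tail_regular_variation:
  assumes L: "slowly_varying L"
    and asym: "(\<lambda>n. measure_pmf.prob p {n..}) \<sim>[sequentially] (\<lambda>n. L (real n) / real n)"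
  shows "0 < tail p x" and "0 < c \<Longrightarrow> ((\<lambda>x. tail p (c * x) / tail p x) \<longlongrightarrow> 1 / c) at_top"
proof -
  have Lpos: "\<forall>\<^sub>F n in sequentially. 0 < L (real n) / real n"
    using eventually_compose_filterlim[OF slowly_varyingD(1)[OF L] filterlim_real_sequentially]
      eventually_gt_at_top[of 0] by eventually_elim auto
  have ratio: "(\<lambda>n. tail p (real n) / (L (real n) / real n)) \<longlonglongrightarrow> 1"
    unfolding tail_of_nat
    by (rule asymp_equivD_strong[OF asym], rule eventually_mono[OF Lpos]) (metis less_irrefl)
  have pos: "0 < tail p x" for x
  proof -
    have "\<forall>\<^sub>F n in sequentially. 1 / 2 < tail p (real n) / (L (real n) / real n)"
      using ratio by (rule order_tendstoD) simp
    then have "\<forall>\<^sub>F n in sequentially. 0 < tail p (real n)"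
      using Lpos
    proof eventually_elim
      case (elim n)
      then have "0 < tail p (real n) / (L (real n) / real n)" by linarith
      then show ?case using elim(2) zero_less_divide_iff by (metis order_less_asym)
    qed
    moreover have "\<forall>\<^sub>F n in sequentially. x \<le> real n"
      using filterlim_real_sequentially by (simp add: filterlim_at_top)
    ultimately have "\<forall>\<^sub>F n in sequentially. 0 < tail p x"
      by eventually_elim (meson tail_antimono less_le_trans)
    then show ?thesis by simp
  qed
  then show "0 < tail p x" .
  show "((\<lambda>x. tail p (c * x) / tail p x) \<longlongrightarrow> 1 / c) at_top" if "0 < c"
  proof (rule regular_variation_from_integers[OF tail_antimono pos _ that])
    fix m :: nat assume m: "0 < m"
    let ?r = "\<lambda>n. tail p (real n) / (L (real n) / real n)"
    have lim: "filterlim (\<lambda>n. m * n) sequentially sequentially"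
      using m by (simp add: mult_nat_left_at_top)
    have "(\<lambda>n. (?r (m * n) / ?r n) * (L (real m * real n) / L (real n)) * (1 / real m)) \<longlonglongrightarrow> (1 / 1) * 1 * (1 / real m)"
    proof (intro tendsto_mult tendsto_divide tendsto_const)
      show "(\<lambda>n. ?r (m * n)) \<longlonglongrightarrow> 1" by (rule filterlim_compose[OF ratio lim])
      show "(\<lambda>n. L (real m * real n) / L (real n)) \<longlonglongrightarrow> 1"
        using m by (intro filterlim_compose[OF slowly_varyingD(2)[OF L] filterlim_real_sequentially]) auto
    qed (use ratio m in auto)
    moreover have "\<forall>\<^sub>F n in sequentially. (?r (m * n) / ?r n) * (L (real m * real n) / L (real n)) * (1 / real m) =
        tail p (real m * real n) / tail p (real n)"
      using eventually_gt_at_top[of 0] Lpos eventually_compose_filterlim[OF Lpos lim]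
    proof eventually_elim
      case (elim n)
      have "L (real n) \<noteq> 0" "L (real m * real n) \<noteq> 0" "real n \<noteq> 0" "real m \<noteq> 0" "tail p (real n) \<noteq> 0"
        using elim m pos[of "real n"] by auto
      then show ?case by (simp add: field_simps)
    qed
    ultimately show "(\<lambda>n. tail p (real m * real n) / tail p (real n)) \<longlonglongrightarrow> 1 / real m"
      by (simp add: tendsto_cong)
  qed
qed

section \<open>Truncated moments under regular variation\<close>

lemma prob_greaterThan_tail: "measure_pmf.prob p {n<..} = tail p (real n + 1)"
  unfolding tail_def by (intro arg_cong[of _ _ "measure_pmf.prob p"]) auto

lemma drift_diff:
  assumes "D \<le> E"
  shows "drift p D - drift p E = (\<Sum>k\<in>{D<..E}. (real k - 1) * pmf p k)"
proof -
  have "{..E} = {..D} \<union> {D<..E}" using assms by auto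
  then have "drift p E = drift p D + (\<Sum>k\<in>{D<..E}. (1 - real k) * pmf p k)"
    unfolding drift_def by (simp only:) (rule sum.union_disjoint, auto)
  then show ?thesis by (simp add: sum_negf[symmetric] algebra_simps)
qed

lemma drift_antimono: "D \<le> E \<Longrightarrow> drift p E \<le> drift p D"
proof -
  assume "D \<le> E"
  moreover have "0 \<le> (\<Sum>k\<in>{D<..E}. (real k - 1) * pmf p k)"
    by (intro sum_nonneg mult_nonneg_nonneg) auto
  ultimately show ?thesis using drift_diff[of D E p] by linarith
qed

text \<open>As D grows, \<open>drift p D\<close> decreases to total mass minus mean, that is to
  0.\<close>

lemma drift_nonneg:
  assumes "(\<lambda>i. real i * pmf p i) sums 1"
  shows "0 \<le> drift p D"
proof -
  have "(\<lambda>E. \<Sum>k\<le>E. real k * pmf p k) \<longlonglongrightarrow> 1"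
    using assms unfolding sums_def_le .
  moreover have "(\<lambda>E. \<Sum>k\<le>E. pmf p k) \<longlonglongrightarrow> 1"
  proof -
    have "(\<lambda>E. measure_pmf.prob p {..E}) \<longlonglongrightarrow> measure_pmf.prob p (\<Union>E. {..E})"
      by (rule measure_pmf.finite_Lim_measure_incseq) (auto simp: incseq_def)
    moreover have "(\<Union>E. {..E}) = (UNIV :: nat set)" by auto
    ultimately show ?thesis by (simp add: sum_pmf_atMost)
  qed
  ultimately have "(\<lambda>E. (\<Sum>k\<le>E. pmf p k) - (\<Sum>k\<le>E. real k * pmf p k)) \<longlonglongrightarrow> 1 - 1"
    by (intro tendsto_diff)
  moreover have "(\<Sum>k\<le>E. pmf p k) - (\<Sum>k\<le>E. real k * pmf p k) = drift p E" for E
    unfolding drift_def by (simp add: sum_subtractf[symmetric] algebra_simps)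
  ultimately have "(\<lambda>E. drift p E) \<longlonglongrightarrow> 0" by simp
  then show ?thesis
    using drift_antimono[of D] by (intro tendsto_upperbound[of "\<lambda>E. drift p E" 0 sequentially])
      (auto intro: eventually_sequentiallyI[of D])
qed

context
  fixes p :: "nat pmf"
  assumes tail_pos: "\<And>x. 0 < tail p x"
    and rv: "\<And>c. 0 < c \<Longrightarrow> ((\<lambda>x. tail p (c * x) / tail p x) \<longlongrightarrow> 1 / c) at_top"
begin

lemma rv_seq:
  assumes "filterlim X at_top F" "0 < c"
  shows "((\<lambda>n. tail p (c * X n) / tail p (X n)) \<longlongrightarrow> 1 / c) F"
  by (rule filterlim_compose[OF rv[OF assms(2)] assms(1)])

lemma rv_le:
  assumes "0 < c" "1 / c < u"
  shows "\<forall>\<^sub>F x in at_top. tail p (c * x) \<le> u * tail p x"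
  using order_tendstoD(2)[OF rv[OF assms(1)] assms(2)]
  by eventually_elim (use tail_pos in \<open>simp add: field_simps\<close>)

lemma rv_ge:
  assumes "0 < c" "u < 1 / c"
  shows "\<forall>\<^sub>F x in at_top. u * tail p x \<le> tail p (c * x)"
  using order_tendstoD(1)[OF rv[OF assms(1)] assms(2)]
  by eventually_elim (use tail_pos in \<open>simp add: field_simps\<close>)

lemma sqmom_mono_diff:
  assumes "D \<le> E" "0 < D"
  shows "sqmom p E \<le> sqmom p D + (real E)\<^sup>2 * tail p (real D)"
proof -
  have "{..E} = {..D} \<union> {D<..E}" using assms by auto
  then have "sqmom p E = sqmom p D + (\<Sum>k\<in>{D<..E}. (real k - 1)\<^sup>2 * pmf p k)"
    unfolding sqmom_def by (simp only:) (rule sum.union_disjoint, auto)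
  also have "(\<Sum>k\<in>{D<..E}. (real k - 1)\<^sup>2 * pmf p k) \<le> (\<Sum>k\<in>{D<..E}. (real E)\<^sup>2 * pmf p k)"
    by (intro sum_mono mult_right_mono power_mono) auto
  also have "\<dots> = (real E)\<^sup>2 * measure_pmf.prob p {D<..E}"
    by (simp add: sum_distrib_left measure_measure_pmf_finite)
  also have "\<dots> \<le> (real E)\<^sup>2 * tail p (real D)"
    unfolding tail_def by (intro mult_left_mono measure_pmf.finite_measure_mono) auto
  finally show ?thesis by simp
qed

text \<open>Karamata-type bound by halving E. Passing to E / 2 divides the square by 4 and
  multiplies the tail by at most 5/2, so a bound of the form C E^2 \<open>tail p E\<close>
  reproduces itself.\<close>

lemma sqmom_bound: "\<exists>C. \<forall>\<^sub>F x in at_top. sqmom p (nat \<lfloor>x\<rfloor>) \<le> C * x\<^sup>2 * tail p x"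
proof -
  have "\<forall>\<^sub>F x in at_top. (2/5) * tail p x \<le> tail p ((9/4) * x)"
    by (rule rv_ge) auto
  from eventually_compose_filterlim[OF this filterlim_real_sequentially]
  obtain D1 where D1: "\<And>D. D1 \<le> D \<Longrightarrow> (2/5) * tail p (real D) \<le> tail p ((9/4) * real D)"
    unfolding eventually_sequentially by blast
  \<comment> \<open>From 4 on the rounding E \<le> 2 D + 1 is absorbed by E \<le> (9/4) D, and 2/5
    is below the limiting tail ratio 4/9.\<close>
  define D0 where "D0 = max 4 D1"
  \<comment> \<open>20/3 is the solution of C = (C/4 + 1) (5/2); the second entry starts the
    induction on the range from D0 to 2 D0 + 1.\<close>
  define C where "C = max (20/3) (sqmom p (2 * D0 + 1) / ((real D0)\<^sup>2 * tail p (real (2 * D0 + 1))))"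
  have D0: "4 \<le> D0" "D1 \<le> D0" by (auto simp: D0_def)
  have C: "20/3 \<le> C" by (simp add: C_def)
  have main: "sqmom p E \<le> C * (real E)\<^sup>2 * tail p (real E)" if "D0 \<le> E" for E
    using that
  proof (induction E rule: less_induct)
    case (less E)
    show ?case
    proof (cases "E \<le> 2 * D0 + 1")
      case True
      have mono: "sqmom p E \<le> sqmom p (2 * D0 + 1)"
        unfolding sqmom_def using True by (intro sum_mono2) auto
      have pos: "0 < (real D0)\<^sup>2 * tail p (real (2 * D0 + 1))" using D0 tail_pos by simp
      have "sqmom p (2 * D0 + 1) \<le> C * ((real D0)\<^sup>2 * tail p (real (2 * D0 + 1)))"
        unfolding pos_divide_le_eq[OF pos, symmetric] by (simp add: C_def)
      also have "\<dots> \<le> C * ((real E)\<^sup>2 * tail p (real E))"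
        using C True less.prems tail_pos
        by (intro mult_left_mono mult_mono power_mono tail_antimono) (auto intro: less_imp_le)
      finally show ?thesis using mono by (simp add: mult.assoc)
    next
      case False
      define D where "D = E div 2"
      have D: "D0 \<le> D" "D < E" "2 * D \<le> E" "E \<le> 2 * D + 1" using False D0 by (auto simp: D_def)
      have IH: "sqmom p D \<le> C * (real D)\<^sup>2 * tail p (real D)" using less.IH D by blast
      have "(2/5) * tail p (real D) \<le> tail p ((9/4) * real D)" using D1 D D0 by auto
      also have "\<dots> \<le> tail p (real E)" using D D0 by (intro tail_antimono) auto
      finally have t: "tail p (real D) \<le> (5/2) * tail p (real E)" by simp
      have "(2 * real D)\<^sup>2 \<le> (real E)\<^sup>2" using D by (intro power_mono) auto
      then have sq: "(real D)\<^sup>2 \<le> (real E)\<^sup>2 / 4" by (simp add: power_mult_distrib)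
      have "sqmom p E \<le> sqmom p D + (real E)\<^sup>2 * tail p (real D)"
        using D D0 by (intro sqmom_mono_diff) auto
      also have "\<dots> \<le> C * ((real E)\<^sup>2 / 4) * tail p (real D) + (real E)\<^sup>2 * tail p (real D)"
        using IH sq C tail_pos[of "real D"]
          mult_right_mono[OF mult_left_mono[OF sq, of C], of "tail p (real D)"] by linarith
      also have "\<dots> = (C / 4 + 1) * (real E)\<^sup>2 * tail p (real D)" by (simp add: algebra_simps)
      also have "\<dots> \<le> (C / 4 + 1) * (real E)\<^sup>2 * ((5/2) * tail p (real E))"
        using C t by (intro mult_left_mono) auto
      also have "\<dots> = ((C / 4 + 1) * (5/2)) * ((real E)\<^sup>2 * tail p (real E))" by simp
      also have "\<dots> \<le> C * ((real E)\<^sup>2 * tail p (real E))"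
        using C tail_pos[of "real E"] by (intro mult_right_mono) auto
      finally show ?thesis by (simp add: mult.assoc)
    qed
  qed
  have "\<forall>\<^sub>F x in at_top. sqmom p (nat \<lfloor>x\<rfloor>) \<le> (3 * C) * x\<^sup>2 * tail p x"
    using rv_le[of "1/2" 3, simplified] eventually_ge_at_top[of "real D0 + 2"]
  proof eventually_elim
    case (elim x)
    define E where "E = nat \<lfloor>x\<rfloor>"
    have E: "real E \<le> x" "x / 2 \<le> real E" "D0 \<le> E"
      using elim(2) by (auto simp: E_def) linarith+
    have "sqmom p E \<le> C * (real E)\<^sup>2 * tail p (real E)" by (rule main[OF E(3)])
    also have "\<dots> \<le> C * x\<^sup>2 * (3 * tail p x)"
    proof (intro mult_mono power_mono)
      have "tail p (real E) \<le> tail p (x / 2)" using E by (intro tail_antimono)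
      then show "tail p (real E) \<le> 3 * tail p x" using elim(1) by simp
    qed (use C E tail_nonneg in auto)
    finally show ?case by (simp add: E_def mult_ac)
  qed
  then show ?thesis by blast
qed

text \<open>Bounds how much the truncated mean changes between the levels A and N. With the weight
  sqrt k, dyadic blocks decay geometrically under a tail of index -1, so the lower end A dominates;
  then k \<le> sqrt N sqrt k.\<close>

lemma first_moment_bound:
  "\<exists>A0. \<forall>A\<ge>A0. \<forall>N. (\<Sum>k\<in>{A<..N}. real k * pmf p k) \<le> 10 * sqrt (real N * real A) * tail p (real A)"
proof -
  have "\<forall>\<^sub>F x in at_top. tail p (2 * x) \<le> (3/5) * tail p x"
    by (rule rv_le) auto
  from eventually_compose_filterlim[OF this filterlim_real_sequentially]
  obtain A1 where A1: "\<And>A. A1 \<le> A \<Longrightarrow> tail p (2 * real A) \<le> (3/5) * tail p (real A)"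
    unfolding eventually_sequentially by blast
  define A0 where "A0 = max 1 A1"
  \<comment> \<open>On doubling A, the block up to 2 A costs 71/50 \<ge> sqrt 2 and the rest 10
    (71/50) (3/5) = 8.52, in total 9.94 \<le> 10.\<close>
  have *: "(\<Sum>k\<in>{A<..N}. sqrt (real k) * pmf p k) \<le> 10 * sqrt (real A) * tail p (real A)"
    if "A0 \<le> A" for A N
    using that
  proof (induction "N - A" arbitrary: A rule: less_induct)
    case less
    have A: "0 < A" "A1 \<le> A" using less.prems by (auto simp: A0_def)
    have sqrt2: "sqrt 2 \<le> 71/50" by (rule real_le_lsqrt) (auto simp: power2_eq_square)
    have first: "(\<Sum>k\<in>{A<..M}. sqrt (real k) * pmf p k) \<le> (71/50) * sqrt (real A) * tail p (real A)"
      if "M \<le> 2 * A" for M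
    proof -
      have "(\<Sum>k\<in>{A<..M}. sqrt (real k) * pmf p k) \<le> (\<Sum>k\<in>{A<..M}. sqrt (2 * real A) * pmf p k)"
        using that by (intro sum_mono mult_right_mono) auto
      also have "\<dots> = sqrt (2 * real A) * measure_pmf.prob p {A<..M}"
        by (simp add: sum_distrib_left measure_measure_pmf_finite)
      also have "\<dots> \<le> ((71/50) * sqrt (real A)) * tail p (real A)"
        unfolding tail_def real_sqrt_mult using sqrt2
        by (intro mult_mono mult_right_mono measure_pmf.finite_measure_mono) auto
      finally show ?thesis .
    qed
    show ?case
    proof (cases "N \<le> 2 * A")
      case True
      have "0 \<le> sqrt (real A) * tail p (real A)" using tail_nonneg by simp
      then show ?thesis using first[OF True] by linarith
    next
      case False
      have "{A<..N} = {A<..2 * A} \<union> {2 * A<..N}" using False by auto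
      then have "(\<Sum>k\<in>{A<..N}. sqrt (real k) * pmf p k) =
          (\<Sum>k\<in>{A<..2 * A}. sqrt (real k) * pmf p k) + (\<Sum>k\<in>{2 * A<..N}. sqrt (real k) * pmf p k)"
        by (simp only:) (rule sum.union_disjoint, auto)
      also have "\<dots> \<le> (71/50) * sqrt (real A) * tail p (real A) + 10 * sqrt (real (2 * A)) * tail p (real (2 * A))"
        using False A less.prems by (intro add_mono first less.hyps) auto
      also have "10 * sqrt (real (2 * A)) * tail p (real (2 * A)) \<le>
          10 * ((7/5 + 1/50) * sqrt (real A)) * ((3/5) * tail p (real A))"
      proof (intro mult_mono)
        have "sqrt 2 \<le> 7/5 + 1/50" by (rule real_le_lsqrt) (auto simp: power2_eq_square)
        then show "sqrt (real (2 * A)) \<le> (7/5 + 1/50) * sqrt (real A)"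
          unfolding of_nat_mult real_sqrt_mult by (intro mult_right_mono) auto
        show "tail p (real (2 * A)) \<le> (3/5) * tail p (real A)" using A1[OF A(2)] by simp
      qed (auto simp: tail_nonneg)
      finally have "(\<Sum>k\<in>{A<..N}. sqrt (real k) * pmf p k) \<le>
          (71/50 + 10 * (7/5 + 1/50) * (3/5)) * (sqrt (real A) * tail p (real A))"
        by (simp add: algebra_simps)
      also have "\<dots> \<le> 10 * (sqrt (real A) * tail p (real A))"
        using tail_nonneg[of p "real A"] by (intro mult_right_mono) auto
      finally show ?thesis by (simp add: mult.assoc)
    qed
  qed
  have "(\<Sum>k\<in>{A<..N}. real k * pmf p k) \<le> 10 * sqrt (real N * real A) * tail p (real A)"
    if "A0 \<le> A" for A N
  proof -
    have "(\<Sum>k\<in>{A<..N}. real k * pmf p k) \<le> (\<Sum>k\<in>{A<..N}. sqrt (real N) * (sqrt (real k) * pmf p k))"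
    proof (rule sum_mono)
      fix k assume "k \<in> {A<..N}"
      then have "sqrt (real k) * sqrt (real k) \<le> sqrt (real N) * sqrt (real k)"
        by (intro mult_right_mono) auto
      then have "real k \<le> sqrt (real N) * sqrt (real k)" by simp
      from mult_right_mono[OF this pmf_nonneg[of p k]]
      show "real k * pmf p k \<le> sqrt (real N) * (sqrt (real k) * pmf p k)" by (simp add: mult.assoc)
    qed
    also have "\<dots> = sqrt (real N) * (\<Sum>k\<in>{A<..N}. sqrt (real k) * pmf p k)"
      by (simp add: sum_distrib_left)
    also have "\<dots> \<le> sqrt (real N) * (10 * sqrt (real A) * tail p (real A))"
      by (intro mult_left_mono * that) auto
    finally show ?thesis by (simp add: real_sqrt_mult mult_ac)
  qed
  then show ?thesis by blast
qed

text \<open>Each dyadic block from 2^i D to 2^(i+1) D contributes, in the limit, at least a sixth of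
  D \<open>tail p D\<close>, and the number r of blocks is at choice.\<close>

lemma drift_over_tail:
  assumes mean: "(\<lambda>i. real i * pmf p i) sums 1"
  shows "filterlim (\<lambda>D. drift p D / (real D * tail p (real D))) at_top sequentially"
  unfolding filterlim_at_top
proof
  fix Z :: real
  obtain r :: nat where r: "6 * Z < real r" using reals_Archimedean2 by blast
  \<comment> \<open>A child count above a is at least a + 1, and a + 1 \<le> (3/2) a for a \<ge> 2;
    each block then retains 2/3 - 1/2 = 1/6.\<close>
  let ?X = "\<lambda>i D. 2 ^ i * (tail p ((3/2 * 2 ^ i) * real D) / tail p (real D) - tail p (2 ^ Suc i * real D) / tail p (real D))"
  have "(\<lambda>D. \<Sum>i<r. ?X i D) \<longlonglongrightarrow> (\<Sum>i<r. 2 ^ i * (1 / (3/2 * 2 ^ i) - 1 / 2 ^ Suc i))"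
    by (intro tendsto_intros rv_seq filterlim_real_sequentially) auto
  moreover have "(\<Sum>i<r. 2 ^ i * (1 / (3/2 * 2 ^ i) - 1 / 2 ^ Suc i)) = (\<Sum>i<r. 1 / (6::real))"
    by (intro sum.cong) (auto simp: field_simps)
  ultimately have "(\<lambda>D. \<Sum>i<r. ?X i D) \<longlonglongrightarrow> real r / 6" by simp
  then have "\<forall>\<^sub>F D in sequentially. Z < (\<Sum>i<r. ?X i D)"
    using r by (intro order_tendstoD) auto
  then show "\<forall>\<^sub>F D in sequentially. Z \<le> drift p D / (real D * tail p (real D))"
    using eventually_ge_at_top[of 2]
  proof eventually_elim
    case (elim D)
    have "(\<Sum>i<r. ?X i D) * (real D * tail p (real D)) =
        (\<Sum>i<r. 2 ^ i * real D * (tail p ((3/2 * 2 ^ i) * real D) - tail p (2 ^ Suc i * real D)))"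
      unfolding sum_distrib_right using tail_pos[of "real D"] elim
      by (intro sum.cong) (auto simp: field_simps)
    also have "\<dots> \<le> (\<Sum>i<r. drift p (2 ^ i * D) - drift p (2 ^ Suc i * D))"
    proof (rule sum_mono)
      fix i
      let ?a = "2 ^ i * D" and ?b = "2 ^ Suc i * D"
      have a: "2 \<le> ?a" using elim by (metis mult_le_mono one_le_numeral one_le_power mult_1)
      have "tail p ((3/2 * 2 ^ i) * real D) - tail p (2 ^ Suc i * real D) \<le>
          measure_pmf.prob p {?a<..} - measure_pmf.prob p {?b<..}"
      proof (rule diff_mono)
        have "real 2 \<le> real ?a" using a by (rule of_nat_mono)
        then show "tail p ((3/2 * 2 ^ i) * real D) \<le> measure_pmf.prob p {?a<..}"
          unfolding prob_greaterThan_tail by (intro tail_antimono) (simp add: mult.commute)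
        show "measure_pmf.prob p {?b<..} \<le> tail p (2 ^ Suc i * real D)"
          unfolding prob_greaterThan_tail by (intro tail_antimono) simp
      qed
      also have "\<dots> = measure_pmf.prob p ({?a<..} - {?b<..})"
        by (rule measure_pmf.finite_measure_Diff[symmetric]) auto
      also have "{?a<..} - {?b<..} = {?a<..?b}" by auto
      finally have "2 ^ i * real D * (tail p ((3/2 * 2 ^ i) * real D) - tail p (2 ^ Suc i * real D)) \<le>
          real ?a * measure_pmf.prob p {?a<..?b}"
        by (simp add: mult_left_mono)
      also have "\<dots> = (\<Sum>k\<in>{?a<..?b}. real ?a * pmf p k)"
        by (simp add: measure_measure_pmf_finite sum_distrib_left)
      also have "\<dots> \<le> (\<Sum>k\<in>{?a<..?b}. (real k - 1) * pmf p k)"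
      proof (intro sum_mono mult_right_mono)
        fix k assume "k \<in> {?a<..?b}"
        then have "?a + 1 \<le> k" by auto
        then have "real (?a + 1) \<le> real k" by (rule of_nat_mono)
        then show "real ?a \<le> real k - 1" by simp
      qed auto
      also have "\<dots> = drift p ?a - drift p ?b"
        by (rule drift_diff[symmetric]) simp
      finally show "2 ^ i * real D * (tail p ((3/2 * 2 ^ i) * real D) - tail p (2 ^ Suc i * real D)) \<le>
          drift p ?a - drift p ?b" .
    qed
    also have "\<dots> = drift p (2 ^ 0 * D) - drift p (2 ^ r * D)"
      by (rule sum_lessThan_telescope')
    also have "\<dots> \<le> drift p D" using drift_nonneg[OF mean] by simp
    finally have "(\<Sum>i<r. ?X i D) * (real D * tail p (real D)) \<le> drift p D" .
    then have "(\<Sum>i<r. ?X i D) \<le> drift p D / (real D * tail p (real D))"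
      using elim tail_pos[of "real D"] by (simp add: pos_le_divide_eq)
    then show ?case using elim by linarith
  qed
qed

end

section \<open>The scaling constants\<close>

text \<open>Everything later on the offspring law and the scale is drawn from these properties. That
  \<open>drift_B\<close> holds for every \<epsilon> says that the truncated mean is insensitive to
  the level at the scale B.\<close>

locale cauchy_scaling =
  fixes p :: "nat pmf" and B :: "nat \<Rightarrow> real"
  assumes tail_pos: "\<And>x. 0 < tail p x"
    and tail_rv: "\<And>c. 0 < c \<Longrightarrow> (\<lambda>n. tail p (c * B n) / tail p (B n)) \<longlonglongrightarrow> 1 / c"
    and B_top: "filterlim B at_top sequentially"
    and drift_B: "\<And>\<epsilon>. 0 < \<epsilon> \<Longrightarrow> (\<lambda>n. real n * drift p (nat \<lfloor>\<epsilon> * B n\<rfloor>) / B n) \<longlonglongrightarrow> 1"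
    and tail_B: "(\<lambda>n. real n * tail p (B n)) \<longlonglongrightarrow> 0"
    and sqmom_B: "\<exists>C>0. \<forall>\<^sub>F n in sequentially. sqmom p (nat \<lfloor>B n\<rfloor>) \<le> C * (B n)\<^sup>2 * tail p (B n)"

text \<open>b_n truncates at the level A, where the tail is of order 1 / n. Divergence of drift over
  D \<open>tail p D\<close> gives A = o(B), hence n \<open>tail p (B n)\<close> tends to 0, and the
  first moment bound carries the drift from A to \<epsilon> B.\<close>

lemma cauchy_scalingI:
  fixes p :: "nat pmf" and L :: "real \<Rightarrow> real" and a b :: "nat \<Rightarrow> real"
  assumes L: "slowly_varying L"
    and mean: "(\<lambda>i. real i * pmf p i) sums 1"
    and asym: "(\<lambda>n. measure_pmf.prob p {n..}) \<sim>[sequentially] (\<lambda>n. L (real n) / real n)"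
    and a: "(\<lambda>n. real n * measure_pmf.prob (step_pmf p) {x. real_of_int x \<ge> a n}) \<longlonglongrightarrow> 1"
    and b: "\<And>n. n \<ge> 1 \<Longrightarrow> b n = real n *
      measure_pmf.expectation (step_pmf p)
        (\<lambda>x. real_of_int x * indicator {x. \<bar>real_of_int x\<bar> \<le> a n} x)"
  shows "cauchy_scaling p (\<lambda>n. \<bar>b n\<bar>)"
proof -
  note tail_pos = tail_regular_variation(1)[OF L asym]
  note rv = tail_regular_variation(2)[OF L asym]
  \<comment> \<open>X is the child count minus 1, so X \<ge> a n means a child count of at least a n
    + 1.\<close>
  define \<alpha> where "\<alpha> n = a n + 1" for n
  define A where "A n = nat \<lfloor>\<alpha> n\<rfloor>" for n
  define B where "B n = \<bar>b n\<bar>" for n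
  have "measure_pmf.prob (step_pmf p) {x. real_of_int x \<ge> a n} = tail p (\<alpha> n)" for n
    unfolding step_pmf_def tail_def measure_map_pmf \<alpha>_def
    by (intro arg_cong[of _ _ "measure_pmf.prob p"]) auto
  then have n\<alpha>: "(\<lambda>n. real n * tail p (\<alpha> n)) \<longlonglongrightarrow> 1" using a by simp
  have \<alpha>_top: "filterlim \<alpha> at_top sequentially"
    unfolding filterlim_at_top
  proof
    fix Z :: real
    have "\<forall>\<^sub>F n in sequentially. real n * tail p (\<alpha> n) < 2"
      using n\<alpha> by (rule order_tendstoD) simp
    moreover have "\<forall>\<^sub>F n in sequentially. 2 < real n * tail p Z"
      using tail_pos[of Z] by real_asymp
    ultimately show "\<forall>\<^sub>F n in sequentially. Z \<le> \<alpha> n"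
    proof eventually_elim
      case (elim n)
      show ?case
      proof (rule ccontr)
        assume "\<not> Z \<le> \<alpha> n"
        then have "real n * tail p Z \<le> real n * tail p (\<alpha> n)"
          by (intro mult_left_mono tail_antimono) auto
        then show False using elim by linarith
      qed
    qed
  qed
  have A_top: "filterlim A at_top sequentially"
    unfolding A_def using \<alpha>_top
    by (intro filterlim_compose[OF _ \<alpha>_top] filterlim_compose[OF filterlim_nat_sequentially filterlim_floor_sequentially])
  have A_real: "filterlim (\<lambda>n. real (A n)) at_top sequentially"
    by (rule filterlim_compose[OF filterlim_real_sequentially A_top])
  have A_pos: "\<forall>\<^sub>F n in sequentially. 1 \<le> A n"
    using A_top by (simp add: filterlim_at_top)
  \<comment> \<open>Only the order of magnitude matters: 6 is 2 times the factor 3 lost when A \<ge>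
    \<alpha> / 2 replaces \<alpha>.\<close>
  have nA: "\<forall>\<^sub>F n in sequentially. 1 / 2 \<le> real n * tail p (real (A n)) \<and> real n * tail p (real (A n)) \<le> 6"
  proof -
    have 1: "\<forall>\<^sub>F n in sequentially. 1 / 2 < real n * tail p (\<alpha> n)"
      using n\<alpha> by (rule order_tendstoD) simp
    have 2: "\<forall>\<^sub>F n in sequentially. real n * tail p (\<alpha> n) < 2"
      using n\<alpha> by (rule order_tendstoD) simp
    have "\<forall>\<^sub>F x in at_top. tail p ((1/2) * x) \<le> 3 * tail p x"
      by (rule rv_le[OF tail_pos rv]) auto
    note 3 = eventually_compose_filterlim[OF this \<alpha>_top]
    from 1 2 3 filterlim_at_top[THEN iffD1, OF \<alpha>_top, rule_format, of 2] show ?thesis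
    proof eventually_elim
      case (elim n)
      have A: "real (A n) \<le> \<alpha> n" "\<alpha> n / 2 \<le> real (A n)"
        using elim by (auto simp: A_def) linarith+
      have "real n * tail p (\<alpha> n) \<le> real n * tail p (real (A n))"
        using A by (intro mult_left_mono tail_antimono) auto
      moreover have "real n * tail p (real (A n)) \<le> real n * (3 * tail p (\<alpha> n))"
        using A elim tail_antimono[OF A(2), of p] by (intro mult_left_mono) auto
      ultimately show ?case using elim by auto
    qed
  qed
  have B: "\<forall>\<^sub>F n in sequentially. B n = real n * drift p (A n)"
    using filterlim_at_top[THEN iffD1, OF \<alpha>_top, rule_format, of 2] eventually_ge_at_top[of 1]
  proof eventually_elim
    case (elim n)
    \<comment> \<open>A child count of 0, that is X = -1, also passes the truncation, since a n
      \<ge> 1 here.\<close>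
    have ind: "indicator {x. \<bar>real_of_int x\<bar> \<le> a n} (int k - 1) = indicat_real {..A n} k" for k
    proof -
      have "\<bar>real_of_int (int k - 1)\<bar> \<le> a n \<longleftrightarrow> k \<le> A n"
      proof (cases "k = 0")
        case False
        have "\<bar>real_of_int (int k - 1)\<bar> \<le> a n \<longleftrightarrow> real k \<le> \<alpha> n"
          using False unfolding \<alpha>_def by auto
        also have "\<dots> \<longleftrightarrow> k \<le> A n"
          unfolding A_def using elim by (simp add: le_nat_iff le_floor_iff)
        finally show ?thesis .
      qed (use elim in \<open>auto simp: \<alpha>_def\<close>)
      then show ?thesis by (simp add: indicator_def)
    qed
    have "b n = real n * (\<integral>k. indicator {..A n} k * (real k - 1) \<partial>measure_pmf p)"
      unfolding b[OF elim(2)] step_pmf_def integral_map_pmf ind by (simp add: mult.commute)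
    also have "\<dots> = - (real n * drift p (A n))"
      unfolding integral_pmf_atMost drift_def mult_minus_right[symmetric] sum_negf[symmetric]
      by (simp add: algebra_simps)
    finally show ?case
      using drift_nonneg[OF mean] by (simp add: B_def)
  qed
  have BA: "filterlim (\<lambda>n. B n / real (A n)) at_top sequentially"
  proof (rule filterlim_at_top_mono)
    have "filterlim (\<lambda>n. drift p (A n) / (real (A n) * tail p (real (A n)))) at_top sequentially"
      by (rule filterlim_compose[OF drift_over_tail[OF tail_pos rv mean] A_top])
    then show "filterlim (\<lambda>n. 1 / 2 * (drift p (A n) / (real (A n) * tail p (real (A n))))) at_top sequentially"
      by (intro filterlim_tendsto_pos_mult_at_top[OF tendsto_const]) auto
    show "\<forall>\<^sub>F n in sequentially. 1 / 2 * (drift p (A n) / (real (A n) * tail p (real (A n)))) \<le> B n / real (A n)"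
      using nA B A_pos
    proof eventually_elim
      case (elim n)
      have "1 / 2 * (drift p (A n) / (real (A n) * tail p (real (A n)))) \<le>
          (real n * tail p (real (A n))) * (drift p (A n) / (real (A n) * tail p (real (A n))))"
        using elim tail_nonneg drift_nonneg[OF mean]
        by (intro mult_right_mono divide_nonneg_nonneg mult_nonneg_nonneg) auto
      also have "\<dots> = B n / real (A n)"
        using elim tail_pos[of "real (A n)"] by (simp add: field_simps)
      finally show ?case .
    qed
  qed
  have BA_ge: "\<forall>\<^sub>F n in sequentially. c * real (A n) \<le> B n" for c
    using filterlim_at_top[THEN iffD1, OF BA, rule_format, of c] A_pos
    by eventually_elim (simp add: pos_le_divide_eq)
  have B_top: "filterlim B at_top sequentially"
    using filterlim_at_top_mono[OF A_real] BA_ge[of 1] by simp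
  have tail_B: "(\<lambda>n. real n * tail p (B n)) \<longlonglongrightarrow> 0"
  proof (rule order_tendstoI)
    fix e :: real assume "e < 0"
    moreover have "0 \<le> real n * tail p (B n)" for n by (simp add: tail_nonneg)
    ultimately show "\<forall>\<^sub>F n in sequentially. e < real n * tail p (B n)"
      by (intro always_eventually allI) (meson less_le_trans)
  next
    fix e :: real assume e: "0 < e"
    \<comment> \<open>13 instead of 12 = 2 * 6 makes the last inequality strict.\<close>
    define c where "c = 13 / e"
    have c: "0 < c" using e by (simp add: c_def)
    have "\<forall>\<^sub>F x in at_top. tail p (c * x) \<le> 2 / c * tail p x"
      using c by (intro rv_le[OF tail_pos rv]) (auto simp: divide_simps)
    from nA BA_ge[of c] A_pos eventually_compose_filterlim[OF this A_real]
    show "\<forall>\<^sub>F n in sequentially. real n * tail p (B n) < e"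
    proof eventually_elim
      case (elim n)
      have "real n * tail p (B n) \<le> real n * tail p (c * real (A n))"
        using elim by (intro mult_left_mono tail_antimono) auto
      also have "\<dots> \<le> real n * (2 / c * tail p (real (A n)))"
        using elim c by (intro mult_left_mono) (auto simp: divide_simps)
      also have "\<dots> = 2 / c * (real n * tail p (real (A n)))" by simp
      also have "\<dots> \<le> 2 / c * 6" using elim c by (intro mult_left_mono) auto
      also have "\<dots> < e" using e by (simp add: c_def field_simps)
      finally show ?case .
    qed
  qed
  obtain A0 where A0: "\<And>A N. A0 \<le> A \<Longrightarrow>
      (\<Sum>k\<in>{A<..N}. real k * pmf p k) \<le> 10 * sqrt (real N * real A) * tail p (real A)"
    using first_moment_bound[OF tail_pos rv] by blast
  have drift_B: "(\<lambda>n. real n * drift p (nat \<lfloor>\<epsilon> * B n\<rfloor>) / B n) \<longlonglongrightarrow> 1" if \<epsilon>: "0 < \<epsilon>" for \<epsilon>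
  proof (rule tendsto_sandwich)
    let ?E = "\<lambda>n. nat \<lfloor>\<epsilon> * B n\<rfloor>"
    have inv: "(\<lambda>n. inverse (B n / real (A n))) \<longlonglongrightarrow> 0"
      by (rule tendsto_inverse_0_at_top[OF BA])
    \<comment> \<open>Relative change of the drift between A and \<epsilon> B: 10 from the first
      moment bound, 6 from n \<open>tail p (A n)\<close>, and A / B tends to 0 under the
      root.\<close>
    have "(\<lambda>n. 1 - 60 * sqrt (\<epsilon> * inverse (B n / real (A n)))) \<longlonglongrightarrow> 1 - 60 * sqrt (\<epsilon> * 0)"
      by (intro tendsto_intros inv)
    then show "(\<lambda>n. 1 - 60 * sqrt (\<epsilon> * inverse (B n / real (A n)))) \<longlonglongrightarrow> 1" by simp
    have basic: "\<forall>\<^sub>F n in sequentially. A n \<le> ?E n \<and> 0 < B n \<and> 1 \<le> A n \<and> A0 \<le> A n"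
      using BA_ge[of "1 / \<epsilon>"] BA_ge[of 1] A_pos filterlim_at_top[THEN iffD1, OF A_top, rule_format, of A0]
    proof eventually_elim
      case (elim n)
      then have "real (A n) \<le> \<epsilon> * B n" using \<epsilon> by (simp add: field_simps)
      then show ?case using elim by (auto simp: le_nat_iff le_floor_iff)
    qed
    show "\<forall>\<^sub>F n in sequentially. real n * drift p (?E n) / B n \<le> 1"
      using basic B
    proof eventually_elim
      case (elim n)
      then have "real n * drift p (?E n) \<le> real n * drift p (A n)"
        by (intro mult_left_mono drift_antimono) auto
      then have "real n * drift p (?E n) \<le> B n" using elim(2) by linarith
      moreover have "0 < B n" using elim(1) by blast
      ultimately show ?case by (simp only: divide_le_eq_1_pos)
    qed
    show "\<forall>\<^sub>F n in sequentially. 1 - 60 * sqrt (\<epsilon> * inverse (B n / real (A n))) \<le> real n * drift p (?E n) / B n"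
      using basic B nA
    proof eventually_elim
      case (elim n)
      have "drift p (A n) - drift p (?E n) = (\<Sum>k\<in>{A n<..?E n}. (real k - 1) * pmf p k)"
        using elim by (intro drift_diff) auto
      also have "\<dots> \<le> (\<Sum>k\<in>{A n<..?E n}. real k * pmf p k)"
        by (intro sum_mono mult_right_mono) auto
      also have "\<dots> \<le> 10 * sqrt (real (?E n) * real (A n)) * tail p (real (A n))"
        using elim by (intro A0) auto
      also have "\<dots> \<le> 10 * sqrt (\<epsilon> * B n * real (A n)) * tail p (real (A n))"
        using elim(1) \<epsilon> by (intro mult_right_mono mult_left_mono real_sqrt_le_mono tail_nonneg) auto
      finally have "real n * (drift p (A n) - drift p (?E n)) \<le>
          real n * (10 * sqrt (\<epsilon> * B n * real (A n)) * tail p (real (A n)))"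
        by (intro mult_left_mono) auto
      also have "\<dots> = 10 * sqrt (\<epsilon> * B n * real (A n)) * (real n * tail p (real (A n)))" by simp
      also have "\<dots> \<le> 10 * sqrt (\<epsilon> * B n * real (A n)) * 6"
        using elim(1,3) \<epsilon> by (intro mult_left_mono) auto
      also have "sqrt (\<epsilon> * B n * real (A n)) = sqrt (\<epsilon> * inverse (B n / real (A n))) * B n"
      proof -
        have eq: "\<epsilon> * B n * real (A n) = (\<epsilon> * inverse (B n / real (A n))) * (B n)\<^sup>2"
          using elim(1) by (simp add: field_simps power2_eq_square)
        have "\<bar>B n\<bar> = B n" using elim(1) by simp
        then show ?thesis unfolding eq real_sqrt_mult[of _ "(B n)\<^sup>2"] real_sqrt_abs by (simp only:)
      qed
      finally have "B n - real n * drift p (?E n) \<le> 60 * sqrt (\<epsilon> * inverse (B n / real (A n))) * B n"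
        using elim(2) by (simp only: right_diff_distrib mult_ac)
      then have "(1 - 60 * sqrt (\<epsilon> * inverse (B n / real (A n)))) * B n \<le> real n * drift p (?E n)"
        by (simp add: algebra_simps)
      then show ?case using elim(1) by (simp add: pos_le_divide_eq)
    qed
  qed auto
  obtain C where C: "\<forall>\<^sub>F x in at_top. sqmom p (nat \<lfloor>x\<rfloor>) \<le> C * x\<^sup>2 * tail p x"
    using sqmom_bound[OF tail_pos rv] by blast
  have "\<forall>\<^sub>F n in sequentially. sqmom p (nat \<lfloor>B n\<rfloor>) \<le> max C 1 * (B n)\<^sup>2 * tail p (B n)"
    using eventually_compose_filterlim[OF C B_top]
  proof eventually_elim
    case (elim n)
    have "C * ((B n)\<^sup>2 * tail p (B n)) \<le> max C 1 * ((B n)\<^sup>2 * tail p (B n))"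
      by (intro mult_right_mono mult_nonneg_nonneg tail_nonneg) auto
    then show ?case using elim by (simp add: mult.assoc)
  qed
  then have "cauchy_scaling p B"
    by unfold_locales
      (use tail_pos B_top drift_B tail_B rv_seq[OF tail_pos rv B_top] in
        \<open>auto intro!: exI[of _ "max C 1"]\<close>)
  then show ?thesis by (simp add: B_def[abs_def])
qed

section \<open>Asymptotics of the survival probability\<close>

lemma prob_greaterThan_floor_le: "measure_pmf.prob p {nat \<lfloor>x\<rfloor><..} \<le> tail p x"
  unfolding tail_def by (intro measure_pmf.finite_measure_mono) (auto, linarith)

lemma prob_greaterThan_compl: "1 - measure_pmf.prob p {..D} = measure_pmf.prob p {D<..}" for p :: "nat pmf"
proof -
  have "{D<..} = UNIV - {..D}" by auto
  then show ?thesis using measure_pmf.prob_compl[of "{..D}" p] by simp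
qed

context cauchy_scaling
begin

definition s :: "nat \<Rightarrow> real" where "s n = real n * tail p (B n)"
text \<open>\<open>f n\<close> turns out to be asymptotic to the probability that a tree has at least \<open>n\<close> vertices.\<close>

definition f :: "nat \<Rightarrow> real" where "f n = s n / B n"
text \<open>Half of ln (1 / s): the factor exp R in the exponential moment then uses up only the
  square root of 1 / s.\<close>

definition R :: "nat \<Rightarrow> real" where "R n = - ln (s n) / 2"

lemma s_tendsto: "s \<longlonglongrightarrow> 0"
  using tail_B by (simp add: s_def[abs_def])

lemma B_ge: "\<forall>\<^sub>F n in sequentially. c \<le> B n"
  using B_top by (simp add: filterlim_at_top)

lemma s_pos: "\<forall>\<^sub>F n in sequentially. 0 < s n"
  using eventually_gt_at_top[of 0] by eventually_elim (use tail_pos in \<open>simp add: s_def\<close>)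

lemma f_pos: "\<forall>\<^sub>F n in sequentially. 0 < f n"
  using s_pos B_ge[of 1] by eventually_elim (simp add: f_def)

lemma f_tendsto: "f \<longlonglongrightarrow> 0"
  unfolding f_def using real_tendsto_divide_at_top[OF s_tendsto B_top] .

lemma R_top: "filterlim R at_top sequentially"
proof -
  have "filterlim s (at_right 0) sequentially"
    using s_tendsto s_pos by (simp add: filterlim_at_right_to_0 filterlim_at eventually_mono)
  moreover have "filterlim (\<lambda>x::real. - ln x / 2) at_top (at_right 0)" by real_asymp
  ultimately show ?thesis unfolding R_def by (rule filterlim_compose[rotated])
qed

lemma s_eq_exp: "\<forall>\<^sub>F n in sequentially. s n = exp (- 2 * R n)"
  using s_pos by eventually_elim (simp add: R_def)

lemma drift_bounds:
  assumes "0 < \<epsilon>"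
  shows "\<forall>\<^sub>F n in sequentially. B n / (2 * real n) \<le> drift p (nat \<lfloor>\<epsilon> * B n\<rfloor>) \<and> 0 < drift p (nat \<lfloor>\<epsilon> * B n\<rfloor>)"
proof -
  have "\<forall>\<^sub>F n in sequentially. 1 / 2 < real n * drift p (nat \<lfloor>\<epsilon> * B n\<rfloor>) / B n"
    using drift_B[OF assms] by (rule order_tendstoD) simp
  then show ?thesis using B_ge[of 1] eventually_gt_at_top[of 0]
  proof (eventually_elim)
    case (elim n)
    then have *: "B n / (2 * real n) < drift p (nat \<lfloor>\<epsilon> * B n\<rfloor>)" using elim by (simp add: field_simps)
    moreover have "0 < B n / (2 * real n)" using elim by simp
    ultimately show ?case by linarith
  qed
qed

end

section \<open>Negligibility of bad words\<close>

text \<open>\<eta> is the fraction of n within which the jump has to occur, e the height tolerance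
  relative to B, and K n the time horizon. Limits in n are taken with all three fixed; \<eta> and e
  are chosen small afterwards.\<close>

locale jump_scale = cauchy_scaling +
  fixes \<eta> e :: real and K :: nat
  assumes \<eta>: "0 < \<eta>" "\<eta> \<le> 1 / 2" and e: "0 < e" and K: "0 < K"
begin

text \<open>
  The level \<open>\<epsilon> B\<close> is so far below \<open>\<eta> B\<close> that surviving \<open>\<eta> n\<close> steps without a jump above it costs \<open>(s n)\<^sup>2\<close>.
\<close>

definition \<epsilon> :: real where "\<epsilon> = \<eta> / 64"
definition D :: "nat \<Rightarrow> nat" where "D n = nat \<lfloor>\<epsilon> * B n\<rfloor>"
definition J :: "nat \<Rightarrow> nat" where "J n = nat \<lfloor>\<eta> * real n\<rfloor>"
definition l :: "nat \<Rightarrow> real" where "l n = R n / (\<epsilon> * B n)"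

lemma \<epsilon>: "0 < \<epsilon>" "\<epsilon> \<le> 1"
  using \<eta> by (auto simp: \<epsilon>_def)

lemma J_bounds: "\<forall>\<^sub>F n in sequentially. 0 < J n \<and> real (J n) \<le> \<eta> * real n \<and>
    \<eta> * real n / 8 \<le> real (J n div 2) \<and> \<eta> * real n / 4 \<le> real (J n - J n div 2)"
proof -
  have "\<forall>\<^sub>F n in sequentially. 16 < \<eta> * real n" using \<eta> by real_asymp
  then show ?thesis
  proof eventually_elim
    case (elim n)
    have J: "real (J n) \<le> \<eta> * real n" "\<eta> * real n - 1 < real (J n)"
      using elim by (auto simp: J_def)
    have "J n \<le> 2 * (J n div 2) + 1" "2 * (J n div 2) \<le> J n" by auto
    then have "real (J n) \<le> real (2 * (J n div 2) + 1)" "real (2 * (J n div 2)) \<le> real (J n)"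
      by (auto simp only: of_nat_le_iff)
    then have d: "real (J n) \<le> 2 * real (J n div 2) + 1" "2 * real (J n div 2) \<le> real (J n)" by auto
    have "real (J n - J n div 2) = real (J n) - real (J n div 2)" by simp
    then show ?case using J elim d by auto
  qed
qed

lemma g_le: "\<forall>\<^sub>F n in sequentially. measure_pmf.prob p {D n<..} \<le> 2 / \<epsilon> * tail p (B n)"
proof -
  have "\<forall>\<^sub>F n in sequentially. tail p (\<epsilon> * B n) / tail p (B n) < 2 / \<epsilon>"
    by (rule order_tendstoD(2)[OF tail_rv]) (use \<epsilon> in \<open>auto simp: divide_simps\<close>)
  then show ?thesis
  proof eventually_elim
    case (elim n)
    then have "tail p (\<epsilon> * B n) \<le> 2 / \<epsilon> * tail p (B n)"
      using tail_pos[of "B n"] by (simp add: pos_divide_less_eq)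
    then show ?case using prob_greaterThan_floor_le[of p "\<epsilon> * B n"] by (simp add: D_def)
  qed
qed

text \<open>With s = exp (-2 R) the quadratic term is at most a constant times R exp (-R) B / n,
  which is eventually below half the drift.\<close>

lemma eventually_exponential_bound:
  "\<forall>\<^sub>F n in sequentially. exponential_bound p (D n) (l n) (R n) \<and> l n \<le> 1"
proof -
  obtain C where C: "0 < C" "\<forall>\<^sub>F n in sequentially. sqmom p (nat \<lfloor>B n\<rfloor>) \<le> C * (B n)\<^sup>2 * tail p (B n)"
    using sqmom_B by blast
  have "((\<lambda>r. (C / \<epsilon>) * (r * exp (- r))) \<longlongrightarrow> 0) at_top" by real_asymp
  from filterlim_compose[OF this R_top]
  \<comment> \<open>The threshold 1/4 matches \<open>drift p (D n)\<close> / 2 \<ge> B / (4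
    n).\<close>
  have E1: "\<forall>\<^sub>F n in sequentially. (C / \<epsilon>) * (R n * exp (- R n)) < 1 / 4"
    by (rule order_tendstoD) simp
  \<comment> \<open>An atom at some k \<ge> 2 keeps \<open>sqmom\<close> away from 0. The inequality
    on l exp R \<open>sqmom\<close> then bounds l by a constant times exp (-R), which gives l \<le>
    1 without comparing R to B.\<close>
  obtain k where k: "2 \<le> k" "0 < pmf p k"
  proof -
    have "set_pmf p \<inter> {k. 2 \<le> real k} \<noteq> {}"
      using tail_pos[of 2] measure_pmf_zero_iff[of p "{k. 2 \<le> real k}"] unfolding tail_def by linarith
    then obtain k where "k \<in> set_pmf p" "2 \<le> real k" by auto
    then show thesis using that[of k] pmf_positive[of k p] by simp
  qed
  have E2: "\<forall>\<^sub>F n in sequentially. exp (- R n) < 2 * pmf p k"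
    using k by (intro order_tendstoD(2)[OF filterlim_compose[OF _ R_top, of "\<lambda>r. exp (- r)" "nhds 0"]])
      (real_asymp, simp)
  show ?thesis
    using E1 E2 C(2) drift_bounds[OF \<epsilon>(1)] B_ge[of 1] s_eq_exp eventually_gt_at_top[of 0]
      filterlim_at_top[THEN iffD1, OF R_top, rule_format, of 1] B_ge[of "(real k + 1) / \<epsilon>"]
  proof eventually_elim
    case (elim n)
    have "sqmom p (D n) \<le> sqmom p (nat \<lfloor>B n\<rfloor>)"
      unfolding sqmom_def D_def using \<epsilon> elim
      by (intro sum_mono2 atMost_subset_iff[THEN iffD2] nat_mono floor_mono) (auto simp: mult_le_cancel_right1)
    then have sq: "sqmom p (D n) \<le> C * (B n)\<^sup>2 * tail p (B n)" using elim by linarith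
    have "l n * exp (R n) * sqmom p (D n) \<le> l n * exp (R n) * (C * (B n)\<^sup>2 * tail p (B n))"
      using sq elim \<epsilon> by (intro mult_left_mono) (auto simp: l_def)
    also have "\<dots> = (C / \<epsilon>) * (R n * exp (R n) * s n) * (B n / real n)"
      using elim \<epsilon> by (simp add: l_def s_def field_simps power2_eq_square)
    also have "R n * exp (R n) * s n = R n * exp (- R n)"
      using elim by (simp add: exp_add[symmetric])
    also have "(C / \<epsilon>) * (R n * exp (- R n)) * (B n / real n) \<le> 1 / 4 * (B n / real n)"
      using elim by (intro mult_right_mono) auto
    also have "\<dots> \<le> drift p (D n) / 2" using elim by (simp add: D_def)
    finally have 1: "l n * exp (R n) * sqmom p (D n) \<le> drift p (D n) / 2" .
    have "real (D n) \<le> \<epsilon> * B n" using elim \<epsilon> by (simp add: D_def)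
    then have "l n * real (D n) \<le> l n * (\<epsilon> * B n)"
      using elim \<epsilon> by (intro mult_left_mono) (auto simp: l_def)
    also have "\<dots> = R n" using elim \<epsilon> by (simp add: l_def)
    finally have 2: "l n * real (D n) \<le> R n" .
    have 3: "0 < l n" using elim \<epsilon> by (simp add: l_def)
    have kD: "k \<le> D n"
    proof -
      have "real k + 1 \<le> \<epsilon> * B n" using elim \<epsilon> by (simp add: pos_divide_le_eq mult.commute)
      then show ?thesis unfolding D_def by linarith
    qed
    have "pmf p k \<le> (real k - 1)\<^sup>2 * pmf p k"
      using k one_le_power[of "real k - 1" 2] by (simp add: mult_le_cancel_right1)
    also have "\<dots> \<le> sqmom p (D n)"
      unfolding sqmom_def using kD by (intro member_le_sum) auto
    finally have "l n * exp (R n) * pmf p k \<le> l n * exp (R n) * sqmom p (D n)"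
      using 3 by (intro mult_left_mono) auto
    also have "\<dots> \<le> 1 / 2"
    proof -
      have "drift p (D n) \<le> (\<Sum>k\<le>D n. pmf p k)"
        unfolding drift_def using mult_right_mono[of "1 - real k" 1 "pmf p k" for k]
        by (intro sum_mono) simp
      also have "\<dots> \<le> 1" by (simp add: sum_pmf_atMost)
      finally show ?thesis using 1 by linarith
    qed
    finally have "l n * pmf p k \<le> exp (- R n) / 2"
      by (simp add: exp_minus field_simps)
    also have "\<dots> \<le> 1 * pmf p k" using elim by simp
    finally have 4: "l n \<le> 1" using k by simp
    show ?case using 1 2 3 4 elim by (auto simp: D_def intro!: exponential_bound.intro)
  qed
qed


definition A :: "nat \<Rightarrow> real" where "A n = e * B n"
definition c :: "nat \<Rightarrow> real" where "c n = B n / real n"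

lemma J_le: "J n \<le> n"
proof -
  have "\<eta> * real n \<le> real n" using \<eta> by (intro mult_left_le_one_le) auto
  then have "\<lfloor>\<eta> * real n\<rfloor> \<le> int n" by linarith
  then show ?thesis by (simp add: J_def)
qed

lemma horizon_bounds:
  fixes x :: real
  assumes "0 < n" "1 \<le> x" "x \<le> real K" and J: "real (J n) \<le> x * real n - 2"
  defines "N \<equiv> nat \<lceil>x * real n\<rceil> - 1"
  shows "real N < x * real n" "x * real n - 1 \<le> real N" "J n \<le> N" "N \<le> K * n"
proof -
  have "0 < \<lceil>x * real n\<rceil>" using assms by simp
  then have "real N = of_int \<lceil>x * real n\<rceil> - 1"
    by (simp add: N_def of_nat_diff nat_le_iff Suc_leI)
  then show N: "real N < x * real n" "x * real n - 1 \<le> real N" by linarith+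
  with J have "real (J n) \<le> real N" by linarith
  then show "J n \<le> N" by simp
  have "x * real n \<le> real K * real n" using assms by (intro mult_right_mono) auto
  with N have "real N \<le> real (K * n)" by simp
  then show "N \<le> K * n" by (simp only: of_nat_le_iff)
qed

text \<open>Truncation at B itself: the drift there is B / n up to o(B / n), a jump above B within K
  n steps costs at most K s, and the variance term is of order s by the second moment bound.\<close>

lemma deviation_bound:
  obtains \<delta> where "\<delta> \<longlonglongrightarrow> 0"
    "\<forall>\<^sub>F n in sequentially. \<forall>N\<le>K * n. word_prob p N {v. deviates (A n) (c n) v} \<le> \<delta> n"
proof -
  obtain C where C: "0 < C" "\<forall>\<^sub>F n in sequentially. sqmom p (nat \<lfloor>B n\<rfloor>) \<le> C * (B n)\<^sup>2 * tail p (B n)"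
    using sqmom_B by blast
  define \<delta> where "\<delta> n = (real K + 4 * real K * C / e\<^sup>2) * s n" for n
  have "\<delta> \<longlonglongrightarrow> (real K + 4 * real K * C / e\<^sup>2) * 0"
    unfolding \<delta>_def by (intro tendsto_intros s_tendsto)
  then have "\<delta> \<longlonglongrightarrow> 0" by simp
  moreover have "\<forall>\<^sub>F n in sequentially. \<forall>N\<le>K * n. word_prob p N {v. deviates (A n) (c n) v} \<le> \<delta> n"
  proof -
    have "(\<lambda>n. \<bar>1 - real n * drift p (nat \<lfloor>1 * B n\<rfloor>) / B n\<bar>) \<longlonglongrightarrow> \<bar>1 - 1\<bar>"
      by (intro tendsto_intros drift_B) simp
    then have "\<forall>\<^sub>F n in sequentially. \<bar>1 - real n * drift p (nat \<lfloor>1 * B n\<rfloor>) / B n\<bar> < e / (2 * real K)"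
      by (rule order_tendstoD) (use e K in simp)
    then show ?thesis using C(2) B_ge[of 1] eventually_gt_at_top[of 0]
    proof eventually_elim
      case (elim n)
      show ?case
      proof (intro allI impI)
        fix N assume N: "N \<le> K * n"
        then have N': "real N \<le> real K * real n" by (metis of_nat_le_iff of_nat_mult)
        let ?F = "nat \<lfloor>B n\<rfloor>"
        have "c n - drift p ?F = (1 - real n * drift p ?F / B n) * (B n / real n)"
          using elim by (simp add: c_def field_simps)
        then have "\<bar>c n - drift p ?F\<bar> = \<bar>1 - real n * drift p ?F / B n\<bar> * (B n / real n)"
          using elim by (simp add: abs_mult)
        also have "\<dots> \<le> e / (2 * real K) * (B n / real n)"
          using elim by (intro mult_right_mono) auto
        finally have "real N * \<bar>c n - drift p ?F\<bar> \<le> (real K * real n) * (e / (2 * real K) * (B n / real n))"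
          using N' by (intro mult_mono) auto
        also have "\<dots> = A n / 2" using elim K by (simp add: A_def)
        finally have "word_prob p N {v. deviates (A n) (c n) v} \<le>
            real N * (1 - measure_pmf.prob p {..?F}) + 4 * real N * sqmom p ?F / (A n)\<^sup>2"
          using elim e by (intro prob_deviates_le) (auto simp: A_def)
        also have "\<dots> \<le> (real K * real n) * tail p (B n) +
            4 * (real K * real n) * (C * (B n)\<^sup>2 * tail p (B n)) / (A n)\<^sup>2"
          unfolding prob_greaterThan_compl using N' elim prob_greaterThan_floor_le
          by (intro add_mono mult_mono divide_right_mono sqmom_nonneg) auto
        also have "\<dots> = \<delta> n"
          using elim e by (simp add: \<delta>_def A_def s_def field_simps power2_eq_square)
        finally show "word_prob p N {v. deviates (A n) (c n) v} \<le> \<delta> n" .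
      qed
    qed
  qed
  ultimately show thesis using that by blast
qed

lemma V0_bounds:
  assumes "exponential_bound p (D n) (l n) (R n)" "l n \<le> 1"
  shows "0 \<le> exponential_bound.V (l n) 0" "exponential_bound.V (l n) 0 \<le> 2 * l n"
proof -
  interpret exponential_bound p "D n" "l n" "R n" by fact
  show "0 \<le> V 0" using V_nonneg by simp
  have "exp (l n) \<le> 1 + l n + (l n)\<^sup>2" using l assms(2) by (intro exp_bound) auto
  moreover have "(l n)\<^sup>2 \<le> l n * 1" unfolding power2_eq_square using l assms(2) by (intro mult_left_mono) auto
  ultimately show "V 0 \<le> 2 * l n" by (simp add: V_def)
qed

text \<open>The exponent is l (B / (2 n)) / 2 times \<eta> n / 4, that is \<eta> R / (16 \<epsilon>)
  = 4 R; this is where the 64 in \<epsilon> comes from, and exp (-4 R) = s^2.\<close>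

lemma rho_power_le:
  "\<forall>\<^sub>F n in sequentially. exponential_bound.\<rho> p (D n) (l n) ^ (J n - J n div 2) \<le> (s n)\<^sup>2"
  using eventually_exponential_bound J_bounds drift_bounds[OF \<epsilon>(1)] s_eq_exp B_ge[of 1]
    eventually_gt_at_top[of 0]
proof eventually_elim
  case (elim n)
  interpret exponential_bound p "D n" "l n" "R n" using elim by blast
  let ?m = "J n - J n div 2"
  have "\<rho> ^ ?m \<le> exp (- (l n * drift p (D n) / 2)) ^ ?m"
    by (intro power_mono rho)
  also have "\<dots> = exp (- (l n * drift p (D n) / 2 * real ?m))"
    by (simp add: exp_of_nat_mult[symmetric] mult.commute)
  also have "\<dots> \<le> exp (- (l n * (B n / (2 * real n)) / 2 * (\<eta> * real n / 4)))"
  proof -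
    have "(B n / (2 * real n)) * (\<eta> * real n / 4) \<le> drift p (D n) * real ?m"
      using elim \<eta> by (intro mult_mono) (auto simp: D_def)
    moreover have "l n * x / 2 * y \<le> l n * d / 2 * m" if "x * y \<le> d * m" for x y d m
      using mult_left_mono[OF that, of "l n / 2"] l by (simp add: mult_ac)
    ultimately show ?thesis unfolding exp_le_cancel_iff neg_le_iff_le by blast
  qed
  also have "l n * (B n / (2 * real n)) / 2 * (\<eta> * real n / 4) = 4 * R n"
    using elim \<eta> by (simp add: \<epsilon>_def jump_scale.l_def[OF jump_scale_axioms] field_simps)
  also have "exp (- (4 * R n)) = (s n)\<^sup>2"
    using elim by (simp add: exp_double[symmetric])
  finally show ?case .
qed

text \<open>Relative to f = s / B: no jump in the window has probability of order s^2 (R + 1) / B;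
  excessive height has V 0, of order R / B, times \<eta> n jump times of cost s / n, divided by exp
  (R e / \<epsilon>) - 1; deviation has lifetime n / B times s / n times \<delta>.\<close>

lemma bad_word_negligible:
  "(\<lambda>n. word_prob p (K * n) {w. bad_word (D n) (J n) (A n) (c n) w} / f n) \<longlonglongrightarrow> 0"
proof -
  obtain \<delta> where \<delta>: "\<delta> \<longlonglongrightarrow> 0"
    "\<forall>\<^sub>F n in sequentially. \<forall>N\<le>K * n. word_prob p N {v. deviates (A n) (c n) v} \<le> \<delta> n"
    by (rule deviation_bound)
  \<comment> \<open>The first two contributions divided by f, as a function of R alone.\<close>
  define G where "G r = exp (- 2 * r) * (2 * r / \<epsilon> + 16 / \<eta>) + 4 * \<eta> / \<epsilon>\<^sup>2 * r / (exp (r * e / \<epsilon>) - 1)" for r :: real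
  have "(G \<longlongrightarrow> 0) at_top"
  proof -
    have 1: "((\<lambda>r::real. exp (- 2 * r) * (a * r + b)) \<longlongrightarrow> 0) at_top" for a b
    proof -
      have "((\<lambda>r::real. a * (exp (- 2 * r) * r) + b * exp (- 2 * r)) \<longlongrightarrow> a * 0 + b * 0) at_top"
        by (intro tendsto_add tendsto_mult tendsto_const) real_asymp+
      then show ?thesis by (simp add: algebra_simps)
    qed
    have 2: "((\<lambda>r::real. r / (exp (t * r) - 1)) \<longlongrightarrow> 0) at_top" if "0 < t" for t
      using that by real_asymp
    have "((\<lambda>r. exp (- 2 * r) * (2 / \<epsilon> * r + 16 / \<eta>) + 4 * \<eta> / \<epsilon>\<^sup>2 * (r / (exp (e / \<epsilon> * r) - 1))) \<longlongrightarrow> 0 + 4 * \<eta> / \<epsilon>\<^sup>2 * 0) at_top"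
      using e \<epsilon> by (intro tendsto_add tendsto_mult tendsto_const 1 2) auto
    then show ?thesis by (simp add: G_def[abs_def] mult.commute)
  qed
  from filterlim_compose[OF this R_top] have G: "(\<lambda>n. G (R n)) \<longlonglongrightarrow> 0" .
  have "(\<lambda>n. G (R n) + 4 / \<epsilon> * \<delta> n) \<longlonglongrightarrow> 0 + 4 / \<epsilon> * 0"
    by (intro tendsto_intros G \<delta>)
  then have lim: "(\<lambda>n. G (R n) + 4 / \<epsilon> * \<delta> n) \<longlonglongrightarrow> 0" by simp
  have ev: "\<forall>\<^sub>F n in sequentially. word_prob p (K * n)
      {w. bad_word (D n) (J n) (A n) (c n) w} / f n \<le> G (R n) + 4 / \<epsilon> * \<delta> n"
    using eventually_exponential_bound J_bounds drift_bounds[OF \<epsilon>(1)] s_eq_exp B_ge[of 1]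
      eventually_gt_at_top[of 0] rho_power_le \<delta>(2) g_le s_pos
      filterlim_at_top[THEN iffD1, OF R_top, rule_format, of 1]
  proof eventually_elim
    case (elim n)
    interpret exponential_bound p "D n" "l n" "R n" using elim by blast
    note V0 = V0_bounds[OF elim(1)[THEN conjunct1] elim(1)[THEN conjunct2]]
    have l_eq: "l n = R n / (\<epsilon> * B n)" by (rule jump_scale.l_def[OF jump_scale_axioms])
    have n: "0 < n" "1 \<le> B n" "0 < s n" "1 \<le> R n" using elim by auto
    let ?m = "J n div 2"
    let ?g = "measure_pmf.prob p {D n<..}"
    define \<kappa> where "\<kappa> = V 0 / (exp (l n * A n) - 1)"
    have lA: "l n * A n = R n * e / \<epsilon>" using n \<epsilon> by (simp add: l_eq A_def)
    have pos: "0 < exp (R n * e / \<epsilon>) - 1" using n e \<epsilon> by simp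
    have gs: "?g \<le> 2 / \<epsilon> * (s n / real n)" using elim(9) n by (simp add: s_def)
    have d: "B n / (2 * real n) \<le> drift p (D n)" "0 < drift p (D n)" using elim by (auto simp: D_def)
    have \<delta>0: "0 \<le> \<delta> n" using elim(8)[rule_format, of 0] measure_nonneg order_trans by blast
    have "J n \<le> K * n" using J_le[of n] K by (cases K) auto
    then have "word_prob p (K * n) {w. bad_word (D n) (J n) (A n) (c n) w} \<le>
        confined_prob p (D n) (J n) 0 + real (J n) * \<kappa> * ?g + ?g * \<delta> n / drift p (D n)"
      using elim(8) drift_pos n e unfolding \<kappa>_def
      by (intro prob_bad_word_le prob_confined_high_le) (auto simp: A_def)
    moreover have "confined_prob p (D n) (J n) 0 \<le> f n * (exp (- 2 * R n) * (2 * R n / \<epsilon> + 16 / \<eta>))"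
    proof -
      have m: "0 < ?m" "\<eta> * real n / 8 \<le> real ?m"
      proof -
        show le: "\<eta> * real n / 8 \<le> real ?m" using elim by blast
        have "0 < \<eta> * real n / 8" using \<eta> n by simp
        with le have "0 < real ?m" by linarith
        then show "0 < ?m" by simp
      qed
      have "confined_prob p (D n) ?m 0 \<le> 1 / (drift p (D n) * real ?m)"
        by (rule confined_mean_one_le[OF drift_pos m(1)])
      also have "\<dots> \<le> 1 / (B n / (2 * real n) * (\<eta> * real n / 8))"
        using d m n \<eta> by (intro divide_left_mono mult_mono mult_pos_pos) auto
      also have "\<dots> = 16 / \<eta> / B n" using n \<eta> by (simp add: field_simps)
      finally have q: "confined_prob p (D n) ?m 0 \<le> 16 / \<eta> / B n" .
      \<comment> \<open>The first half of the window yields the factor 1 / B, the second half the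
        factor s^2.\<close>
      have "confined_prob p (D n) (J n) 0 = confined_mean p (D n) (?m + (J n - ?m)) (\<lambda>_. 1) 0" by simp
      also have "\<dots> \<le> \<rho> ^ (J n - ?m) * (V 0 + confined_prob p (D n) ?m 0)"
        by (rule confined_mean_one_exp_le)
      also have "\<dots> \<le> (s n)\<^sup>2 * (2 * l n + 16 / \<eta> / B n)"
        using elim(7) V0 q confined_mean_nonneg[of "\<lambda>_. 1" p "D n" ?m 0] by (intro mult_mono add_mono) auto
      also have "\<dots> = f n * (s n * (2 * R n / \<epsilon> + 16 / \<eta>))"
        using n \<epsilon> by (simp add: f_def l_eq power2_eq_square add_divide_distrib distrib_left mult_ac)
      also have "s n = exp (- 2 * R n)" by (rule elim)
      finally show ?thesis .
    qed
    moreover have "real (J n) * \<kappa> * ?g \<le> f n * (4 * \<eta> / \<epsilon>\<^sup>2 * R n / (exp (R n * e / \<epsilon>) - 1))"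
    proof -
      have "real (J n) * \<kappa> * ?g \<le> (\<eta> * real n) * (2 * l n / (exp (R n * e / \<epsilon>) - 1)) * (2 / \<epsilon> * (s n / real n))"
        unfolding \<kappa>_def lA using elim V0 gs pos \<eta> l
        by (intro mult_mono divide_right_mono mult_nonneg_nonneg divide_nonneg_nonneg) auto
      also have "\<dots> = f n * (4 * \<eta> / \<epsilon>\<^sup>2 * R n / (exp (R n * e / \<epsilon>) - 1))"
        using n \<epsilon> pos by (simp add: f_def l_eq power2_eq_square mult_ac)
      finally show ?thesis .
    qed
    moreover have "?g * \<delta> n / drift p (D n) \<le> f n * (4 / \<epsilon> * \<delta> n)"
    proof -
      have "?g * \<delta> n / drift p (D n) \<le> (2 / \<epsilon> * (s n / real n)) * \<delta> n / drift p (D n)"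
        using gs \<delta>0 d(2) by (intro divide_right_mono mult_right_mono) auto
      also have "\<dots> \<le> (2 / \<epsilon> * (s n / real n)) * \<delta> n / (B n / (2 * real n))"
      proof (rule divide_left_mono[OF d(1)])
        show "0 \<le> 2 / \<epsilon> * (s n / real n) * \<delta> n" using n \<epsilon> \<delta>0 by simp
        show "0 < drift p (D n) * (B n / (2 * real n))" using d(2) n by simp
      qed
      also have "\<dots> = f n * (4 / \<epsilon> * \<delta> n)" using n by (simp add: f_def mult_ac)
      finally show ?thesis .
    qed
    ultimately have "word_prob p (K * n) {w. bad_word (D n) (J n) (A n) (c n) w} \<le>
        f n * (G (R n) + 4 / \<epsilon> * \<delta> n)"
      unfolding G_def by (simp add: distrib_left)
    moreover have "0 < f n" using n by (simp add: f_def)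
    ultimately show ?case by (simp add: pos_divide_le_eq mult.commute)
  qed
  show ?thesis
    by (rule tendsto_sandwich[OF _ ev tendsto_const lim])
      (use f_pos in \<open>auto elim!: eventually_mono\<close>)
qed


section \<open>Bounds for the survival probability\<close>

lemma J_less:
  assumes "1 \<le> x"
  shows "\<forall>\<^sub>F n in sequentially. \<eta> * real n < x * real n - 2"
proof -
  have "0 < x - \<eta>" using assms \<eta> by simp
  then have "\<forall>\<^sub>F n in sequentially. 2 < (x - \<eta>) * real n" by real_asymp
  then show ?thesis by eventually_elim (simp add: algebra_simps)
qed

lemma drift_ratio: "(\<lambda>n. B n / (real n * drift p (D n))) \<longlonglongrightarrow> 1"
  using tendsto_inverse[OF drift_B[OF \<epsilon>(1)]] by (simp add: D_def)

text \<open>In x - \<eta> - 3 e, \<eta> pays for the window before the jump, 2 e for the two errors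
  \<open>A n\<close>, and the last e for rounding, as e n > 2.\<close>

lemma surv_prob_upper:
  fixes x :: real
  assumes x: "1 \<le> x" and y: "0 < y" "y \<le> x - \<eta> - 3 * e" and "x \<le> real K" and u: "1 / y < u"
  shows "\<forall>\<^sub>F n in sequentially. surv_prob p (nat \<lceil>x * real n\<rceil> - 1) / f n < u"
proof -
  let ?N = "\<lambda>n. nat \<lceil>x * real n\<rceil> - 1"
  let ?bad = "\<lambda>n. word_prob p (K * n) {w. bad_word (D n) (J n) (A n) (c n) w} / f n"
  let ?rhs = "\<lambda>n. ?bad n + (B n / (real n * drift p (D n))) * (tail p (y * B n) / tail p (B n))"
  have "?rhs \<longlonglongrightarrow> 0 + 1 * (1 / y)"
    by (intro tendsto_intros bad_word_negligible drift_ratio tail_rv y)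
  then have ev: "\<forall>\<^sub>F n in sequentially. ?rhs n < u"
    by (rule order_tendstoD) (use u in simp)
  have "\<forall>\<^sub>F n in sequentially. 2 < e * real n" using e by real_asymp
  then show ?thesis
    using J_less[OF x] ev J_bounds f_pos B_ge[of 1] eventually_gt_at_top[of 0] drift_bounds[OF \<epsilon>(1)]
  proof eventually_elim
    case (elim n)
    have n: "0 < n" using elim by blast
    have "real (J n) \<le> x * real n - 2" using elim by linarith
    note N = horizon_bounds[OF n x assms(4) this]
    have d: "0 < drift p (D n)" using elim by (simp add: D_def)
    have c: "0 \<le> c n" using elim by (simp add: c_def)
    have "surv_prob p (?N n) \<le> word_prob p (K * n)
        {w. bad_word (D n) (J n) (A n) (c n) w} +
        tail p (real (?N n - J n) * c n - 2 * A n) / drift p (D n)"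
      unfolding surv_prob_def using elim N(3,4) d c by (intro prob_surv_le) auto
    also have "tail p (real (?N n - J n) * c n - 2 * A n) \<le> tail p (y * B n)"
    proof (rule tail_antimono)
      have "(y + 2 * e) * real n \<le> (x - \<eta> - e) * real n"
        using y by (intro mult_right_mono) auto
      also have "\<dots> \<le> real (?N n - J n)"
      proof -
        have "real (?N n - J n) = real (?N n) - real (J n)" using N(3) by (rule of_nat_diff)
        moreover have "real (J n) \<le> \<eta> * real n" using elim by blast
        ultimately show ?thesis
          unfolding left_diff_distrib using N(2) elim(1) by linarith
      qed
      finally have "(y + 2 * e) * real n * c n \<le> real (?N n - J n) * c n"
        using c by (intro mult_right_mono) auto
      then show "y * B n \<le> real (?N n - J n) * c n - 2 * A n"
        using elim by (simp add: c_def A_def algebra_simps)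
    qed
    finally have "surv_prob p (?N n) \<le> word_prob p (K * n)
        {w. bad_word (D n) (J n) (A n) (c n) w} + tail p (y * B n) / drift p (D n)"
      using d by (simp add: divide_right_mono)
    then have "surv_prob p (?N n) / f n \<le> (word_prob p (K * n)
        {w. bad_word (D n) (J n) (A n) (c n) w} + tail p (y * B n) / drift p (D n)) / f n"
      using elim by (intro divide_right_mono) auto
    also have "\<dots> = ?rhs n"
      unfolding add_divide_distrib using d tail_pos[of "B n"]
      by (simp add: f_def s_def mult_ac)
    finally show ?case using elim by linarith
  qed
qed

text \<open>One e pays for the deviation, another for the unit lost in a step, as e B \<ge> 1.
  Optional stopping bounds the expected lifetime from below: the leftover height, at most 2 s^2, and
  the loss to big jumps, at most (2 / \<epsilon>) s, both vanish.\<close>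

lemma surv_prob_lower:
  fixes x :: real
  assumes x: "1 \<le> x" and y: "x + \<eta> + 2 * e \<le> y" and "x \<le> real K" and u: "u < 1 / y"
  shows "\<forall>\<^sub>F n in sequentially. u < surv_prob p (nat \<lceil>x * real n\<rceil> - 1) / f n"
proof -
  obtain \<delta> where \<delta>: "\<delta> \<longlonglongrightarrow> 0"
    "\<forall>\<^sub>F n in sequentially. \<forall>N\<le>K * n. word_prob p N {v. deviates (A n) (c n) v} \<le> \<delta> n"
    by (rule deviation_bound)
  let ?N = "\<lambda>n. nat \<lceil>x * real n\<rceil> - 1"
  let ?lhs = "\<lambda>n. (1 - 2 * (s n)\<^sup>2 - 2 / \<epsilon> * s n) * (B n / (real n * drift p (D n))) *
    ((tail p (y * B n) / tail p (B n)) * (1 - \<delta> n))"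
  have ypos: "1 \<le> y" using x y \<eta> e by linarith
  have "?lhs \<longlonglongrightarrow> (1 - 2 * 0\<^sup>2 - 2 / \<epsilon> * 0) * 1 * ((1 / y) * (1 - 0))"
    using ypos by (intro tendsto_intros s_tendsto drift_ratio tail_rv \<delta>) auto
  then have ev: "\<forall>\<^sub>F n in sequentially. u < ?lhs n"
    by (rule order_tendstoD) (use u in simp)
  have \<delta>1: "\<forall>\<^sub>F n in sequentially. \<delta> n < 1" by (rule order_tendstoD(2)[OF \<delta>(1)]) simp
  show ?thesis
    using ev J_bounds f_pos B_ge[of "1 / e"] B_ge[of 1] eventually_gt_at_top[of 0] drift_bounds[OF \<epsilon>(1)] \<delta>(2) \<delta>1
      eventually_exponential_bound rho_power_le g_le J_less[OF x]
  proof eventually_elim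
    case (elim n)
    interpret exponential_bound p "D n" "l n" "R n" using elim by blast
    note V0 = V0_bounds[OF elim(10)[THEN conjunct1] elim(10)[THEN conjunct2]]
    have n: "0 < n" "1 \<le> B n" using elim by auto
    have "real (J n) \<le> x * real n - 2" using elim by linarith
    note N = horizon_bounds[OF n(1) x assms(3) this]
    have c: "0 \<le> c n" using elim by (simp add: c_def)
    have height: "confined_mean p (D n) (J n) (\<lambda>y. real_of_int y + 1) 0 \<le> 2 * (s n)\<^sup>2"
    proof -
      have "confined_mean p (D n) (J n) (\<lambda>y. real_of_int y + 1) 0 \<le> \<rho> ^ J n * (V 0 / l n)"
        by (rule confined_mean_height_le)
      also have "\<dots> \<le> \<rho> ^ (J n - J n div 2) * 2"
        using V0 l rho rho_le_1
        by (intro mult_mono power_decreasing) (auto simp: divide_le_eq)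
      also have "\<dots> \<le> (s n)\<^sup>2 * 2" using elim by (intro mult_right_mono) auto
      finally show ?thesis by simp
    qed
    have "real (J n) * (1 - measure_pmf.prob p {..D n}) \<le> real n * (2 / \<epsilon> * tail p (B n))"
      unfolding prob_greaterThan_compl using elim J_le[of n] by (intro mult_mono) auto
    also have "\<dots> = 2 / \<epsilon> * s n" by (simp add: s_def)
    finally have "1 - 2 * (s n)\<^sup>2 - 2 / \<epsilon> * s n \<le> drift p (D n) * (\<Sum>k<J n. confined_prob p (D n) k 0)"
      using drift_sum_conf_ge[of p "D n" "J n"] drift_pos height by linarith
    then have q: "(1 - 2 * (s n)\<^sup>2 - 2 / \<epsilon> * s n) / drift p (D n) \<le> (\<Sum>k<J n. confined_prob p (D n) k 0)"
      using drift_pos by (simp add: pos_divide_le_eq mult.commute)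
    have "(1 - 2 * (s n)\<^sup>2 - 2 / \<epsilon> * s n) / drift p (D n) * (tail p (y * B n) * (1 - \<delta> n)) \<le>
        (\<Sum>k<J n. confined_prob p (D n) k 0) * (tail p (y * B n) * (1 - \<delta> n))"
      using q elim tail_nonneg by (intro mult_right_mono mult_nonneg_nonneg) auto
    also have "\<dots> \<le> surv_prob p (?N n)"
      unfolding surv_prob_def
    proof (rule prob_surv_ge[OF N(3) c])
      have "real (?N n) * c n \<le> x * real n * c n" using N(1) c by (intro mult_right_mono) auto
      also have "\<dots> = x * B n" using n by (simp add: c_def)
      finally have "real (?N n) * c n + A n + 1 \<le> x * B n + e * B n + e * B n"
        using elim e by (simp add: A_def field_simps)
      also have "\<dots> \<le> y * B n"
      proof -
        have "(x + 2 * e) * B n \<le> y * B n" using y \<eta> n by (intro mult_right_mono) auto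
        then show ?thesis by (simp add: algebra_simps)
      qed
      finally show "real (?N n) * c n + A n + 1 \<le> y * B n" .
      have "real (D n) \<le> \<epsilon> * B n" using n \<epsilon> by (simp add: D_def)
      also have "\<dots> < y * B n" using ypos \<eta> n by (intro mult_strict_right_mono) (auto simp: \<epsilon>_def)
      finally show "real (D n) < y * B n" .
      show "word_prob p m {v. deviates (A n) (c n) v} \<le> \<delta> n" if "m \<le> ?N n" for m
        using elim that N(4) by auto
    qed
    finally have "(1 - 2 * (s n)\<^sup>2 - 2 / \<epsilon> * s n) / drift p (D n) * (tail p (y * B n) * (1 - \<delta> n)) / f n \<le>
        surv_prob p (?N n) / f n"
      using elim by (intro divide_right_mono) auto
    moreover have "(1 - 2 * (s n)\<^sup>2 - 2 / \<epsilon> * s n) / drift p (D n) * (tail p (y * B n) * (1 - \<delta> n)) / f n = ?lhs n"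
      using n drift_pos tail_pos[of "B n"] by (simp add: f_def s_def mult_ac)
    ultimately show ?case using elim by linarith
  qed
qed

end

lemma ex_small_pos:
  fixes P :: "real \<Rightarrow> bool"
  assumes "\<forall>\<^sub>F h in at_right 0. P h"
  shows "\<exists>h. 0 < h \<and> h < 1 / 8 \<and> P h"
proof -
  have "\<forall>\<^sub>F h::real in at_right 0. h \<in> {0<..<1 / 8}" by (rule eventually_at_right_real) simp
  with assms have "\<forall>\<^sub>F h in at_right 0. 0 < h \<and> h < 1 / 8 \<and> P h" by eventually_elim auto
  then show ?thesis by (rule eventually_happens'[OF trivial_limit_at_right_real])
qed

text \<open>One small h serves as both \<eta> and e, which makes the jump thresholds x - 4 h and x +
  3 h; it is chosen after u.\<close>

lemma (in cauchy_scaling) surv_prob_tendsto: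
  assumes x: "1 \<le> x"
  shows "(\<lambda>n. surv_prob p (nat \<lceil>x * real n\<rceil> - 1) / f n) \<longlonglongrightarrow> 1 / x"
proof (rule order_tendstoI)
  fix u assume u: "1 / x < u"
  have "((\<lambda>h. 1 / (x - 4 * h)) \<longlongrightarrow> 1 / (x - 4 * 0)) (at_right 0)"
    using x by (intro tendsto_intros) auto
  then have "\<forall>\<^sub>F h in at_right 0. 1 / (x - 4 * h) < u"
    by (rule order_tendstoD) (use u in simp)
  from ex_small_pos[OF this] obtain h where h: "0 < h" "h < 1 / 8" "1 / (x - 4 * h) < u" by blast
  obtain K :: nat where KN: "x \<le> real K" using real_arch_simple by blast
  have "0 < K" using KN x by (cases K) auto
  interpret jump_scale p B h h K by unfold_locales (use h(1,2) \<open>0 < K\<close> in auto)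
  show "\<forall>\<^sub>F n in sequentially. surv_prob p (nat \<lceil>x * real n\<rceil> - 1) / f n < u"
    by (rule surv_prob_upper[OF x _ _ KN h(3)]) (use h(1,2) x in auto)
next
  fix u assume u: "u < 1 / x"
  have "((\<lambda>h. 1 / (x + 3 * h)) \<longlongrightarrow> 1 / (x + 3 * 0)) (at_right 0)"
    using x by (intro tendsto_intros) auto
  then have "\<forall>\<^sub>F h in at_right 0. u < 1 / (x + 3 * h)"
    by (rule order_tendstoD) (use u in simp)
  from ex_small_pos[OF this] obtain h where h: "0 < h" "h < 1 / 8" "u < 1 / (x + 3 * h)" by blast
  obtain K :: nat where KN: "x \<le> real K" using real_arch_simple by blast
  have "0 < K" using KN x by (cases K) auto
  interpret jump_scale p B h h K by unfold_locales (use h(1,2) \<open>0 < K\<close> in auto)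
  show "\<forall>\<^sub>F n in sequentially. u < surv_prob p (nat \<lceil>x * real n\<rceil> - 1) / f n"
    by (rule surv_prob_lower[OF x _ KN h(3)]) auto
qed

section \<open>Skorokhod topology\<close>

text \<open>For t \<ge> 0 the killed path is the positive part of x - t, which is Lipschitz in
  x.\<close>

lemma limit_path_dist: "-1 \<le> t \<Longrightarrow> \<bar>limit_path x t - limit_path y t\<bar> \<le> \<bar>x - y\<bar>"
  by (auto simp: limit_path_def)

lemma cadlag_floor:
  fixes g :: "int \<Rightarrow> real" and n :: nat
  shows "(\<lambda>t\<in>{a..}. g \<lfloor>real n * t\<rfloor>) \<in> cadlag_space a"
proof -
  let ?f = "\<lambda>t\<in>{a..}. g \<lfloor>real n * t\<rfloor>"
  have right: "(?f \<longlongrightarrow> ?f t) (at_right t)" if "a \<le> t" for t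
  proof (rule tendsto_eventually)
    have "((\<lambda>s. real n * s) \<longlongrightarrow> real n * t) (at_right t)" by (intro tendsto_intros)
    moreover have "real n * t < of_int (\<lfloor>real n * t\<rfloor> + 1)" by linarith
    ultimately have "\<forall>\<^sub>F s in at_right t. real n * s < of_int (\<lfloor>real n * t\<rfloor> + 1)"
      by (rule order_tendstoD)
    moreover have "\<forall>\<^sub>F s in at_right t. t < s" by (rule eventually_at_right_less)
    ultimately show "\<forall>\<^sub>F s in at_right t. ?f s = ?f t"
    proof eventually_elim
      case (elim s)
      have "real n * t \<le> real n * s" using elim by (intro mult_left_mono) auto
      then have "\<lfloor>real n * s\<rfloor> = \<lfloor>real n * t\<rfloor>" using elim by (intro floor_unique) linarith+
      then show ?case using elim that by simp
    qed
  qed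
  have left: "\<exists>v. (?f \<longlongrightarrow> v) (at_left t)" if "a < t" for t
  proof (cases "n = 0")
    case True
    have "\<forall>\<^sub>F s in at_left t. a < s" using that by (rule eventually_at_left_real[THEN eventually_mono]) auto
    then have "\<forall>\<^sub>F s in at_left t. ?f s = g 0" by eventually_elim (simp add: True)
    then show ?thesis by (blast intro: tendsto_eventually)
  next
    case False
    have "\<forall>\<^sub>F s in at_left t. ?f s = g (\<lceil>real n * t\<rceil> - 1)"
    proof -
      have "((\<lambda>s. real n * s) \<longlongrightarrow> real n * t) (at_left t)" by (intro tendsto_intros)
      moreover have "of_int (\<lceil>real n * t\<rceil> - 1) < real n * t" by linarith
      ultimately have "\<forall>\<^sub>F s in at_left t. of_int (\<lceil>real n * t\<rceil> - 1) < real n * s"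
        by (rule order_tendstoD)
      moreover have "\<forall>\<^sub>F s in at_left t. s \<in> {a<..<t}" using that by (rule eventually_at_left_real)
      ultimately show ?thesis
      proof eventually_elim
        case (elim s)
        have "real n * s < real n * t" using elim False by (intro mult_strict_left_mono) auto
        then have "\<lfloor>real n * s\<rfloor> = \<lceil>real n * t\<rceil> - 1" using elim by (intro floor_unique) linarith+
        then show ?case using elim by simp
      qed
    qed
    then show ?thesis by (blast intro: tendsto_eventually)
  qed
  show ?thesis unfolding cadlag_space_def using right left by auto
qed

lemma rescaled_path_cadlag: "rescaled_path n c \<tau> \<in> cadlag_space (-1)"
  unfolding rescaled_path_def by (rule cadlag_floor)

lemma limit_path_cadlag: "limit_path x \<in> cadlag_space (-1)"
proof -
  \<comment> \<open>The inner maximum covers negative x, for which the path vanishes.\<close>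
  define h where "h t = max (max x 0 - t) 0" for t
  have eq: "limit_path x t = (if 0 \<le> t then h t else 0)" if "-1 \<le> t" for t
    using that by (auto simp: limit_path_def h_def)
  have h: "(h \<longlongrightarrow> h t) F" if "F \<le> nhds t" for F t
    unfolding h_def using that
    by (intro tendsto_intros tendsto_mono[OF that]) (auto simp: tendsto_ident_at tendsto_def eventually_nhds)
  have right: "(limit_path x \<longlongrightarrow> limit_path x t) (at_right t)" if t: "-1 \<le> t" for t
  proof (cases "0 \<le> t")
    case True
    have "\<forall>\<^sub>F s in at_right t. h s = limit_path x s"
      using eventually_at_right_less[of t] by eventually_elim (use True t in \<open>simp add: eq\<close>)
    moreover have "(h \<longlongrightarrow> h t) (at_right t)" by (rule h) (simp add: at_within_def)
    ultimately show ?thesis using True t by (simp add: eq tendsto_cong)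
  next
    case False
    then have "\<forall>\<^sub>F s in at_right t. s \<in> {t<..<0}" by (intro eventually_at_right_real) simp
    then have "\<forall>\<^sub>F s in at_right t. limit_path x s = limit_path x t"
      by eventually_elim (use False t in \<open>auto simp: eq\<close>)
    then show ?thesis by (rule tendsto_eventually)
  qed
  have left: "\<exists>v. (limit_path x \<longlongrightarrow> v) (at_left t)" if t: "-1 < t" for t
  proof (cases "0 < t")
    case True
    then have "\<forall>\<^sub>F s in at_left t. s \<in> {0<..<t}" by (rule eventually_at_left_real)
    then have "\<forall>\<^sub>F s in at_left t. h s = limit_path x s"
      by eventually_elim (simp add: eq)
    moreover have "(h \<longlongrightarrow> h t) (at_left t)" by (rule h) (simp add: at_within_def)
    ultimately show ?thesis by (auto simp: tendsto_cong)
  next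
    case False
    from t have "\<forall>\<^sub>F s in at_left t. s \<in> {-1<..<t}" by (rule eventually_at_left_real)
    then have "\<forall>\<^sub>F s in at_left t. limit_path x s = 0"
      by eventually_elim (use False in \<open>auto simp: eq\<close>)
    then show ?thesis by (blast intro: tendsto_eventually)
  qed
  show ?thesis
    unfolding cadlag_space_def using right left by (auto simp: limit_path_def extensional_def)
qed

section \<open>Neighbourhoods of the curve of limit paths\<close>

lemma J1_nbhd_perturb:
  assumes "g \<in> J1_nbhd a f T d" "\<And>t. a \<le> t \<Longrightarrow> \<bar>f t - f' t\<bar> \<le> d'" "d + d' \<le> e" "0 \<le> d'"
  shows "g \<in> J1_nbhd a f' T e"
proof -
  obtain \<theta> d0 where g: "g \<in> cadlag_space a" "\<theta> \<in> time_changes a" "d0 < d"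
    "\<And>t. a \<le> t \<Longrightarrow> \<bar>\<theta> t - t\<bar> \<le> d0" "\<And>t. t \<in> {a..T} \<Longrightarrow> \<bar>g (\<theta> t) - f t\<bar> \<le> d0"
    using assms(1) by (auto simp: J1_nbhd_def)
  have "\<bar>\<theta> t - t\<bar> \<le> d0 + d'" if "a \<le> t" for t using g(4)[OF that] assms(4) by linarith
  moreover have "\<bar>g (\<theta> t) - f' t\<bar> \<le> d0 + d'" if "t \<in> {a..T}" for t
    using g(5)[OF that] assms(2)[of t] that by (simp add: abs_le_iff)
  moreover have "d0 + d' < e" using g(3) assms(3) by linarith
  ultimately show ?thesis unfolding J1_nbhd_def using g(1,2) by blast
qed

lemma continuous_map_limit_path: "continuous_map euclideanreal (skorokhod_J1 (-1)) limit_path"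
  unfolding continuous_map_def
proof (intro conjI allI impI)
  show "limit_path \<in> topspace euclideanreal \<rightarrow> topspace (skorokhod_J1 (-1))"
    by (simp add: limit_path_cadlag)
  fix U assume U: "openin (skorokhod_J1 (-1)) U"
  have "open {x. limit_path x \<in> U}"
    unfolding open_dist
  proof
    fix x assume "x \<in> {x. limit_path x \<in> U}"
    then obtain T e where e: "0 < e" "J1_nbhd (-1) (limit_path x) T e \<subseteq> U"
      using U unfolding openin_skorokhod_J1 by blast
    have "limit_path y \<in> U" if "dist y x < e / 2" for y
    proof -
      have "limit_path y \<in> J1_nbhd (-1) (limit_path y) T (e / 2)"
        using e by (intro J1_nbhd_self limit_path_cadlag) auto
      then have "limit_path y \<in> J1_nbhd (-1) (limit_path x) T e"
        by (rule J1_nbhd_perturb[where d' = "e / 2"])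
          (use e that limit_path_dist[of _ y x] in \<open>force simp: dist_real_def\<close>)+
      then show ?thesis using e by blast
    qed
    then show "\<exists>e>0. \<forall>y. dist y x < e \<longrightarrow> y \<in> {x. limit_path x \<in> U}"
      using e by (intro exI[of _ "e / 2"]) auto
  qed
  then show "openin euclideanreal {x \<in> topspace euclideanreal. limit_path x \<in> U}" by simp
qed

lemma continuous_map_limit_pair:
  "continuous_map euclideanreal (prod_topology (skorokhod_J1 (-1)) euclideanreal) (\<lambda>x. (limit_path x, x))"
  by (intro continuous_map_pairedI continuous_map_limit_path) auto

text \<open>The pairs (\<open>limit_path x\<close>, x) over a compact interval form a compact curve,
  along which continuity of F becomes uniform by a finite subcover.\<close>

lemma uniform_continuity_limit_path:
  assumes F: "continuous_map (prod_topology (skorokhod_J1 (-1)) euclideanreal) euclideanreal F"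
    and e: "0 < e"
  obtains T \<delta> where "0 < \<delta>"
    "\<And>x g. x \<in> {a..b} \<Longrightarrow> g \<in> J1_nbhd (-1) (limit_path x) T \<delta> \<Longrightarrow> \<bar>F (g, x) - F (limit_path x, x)\<bar> < e"
proof -
  have "\<exists>T d. 0 < d \<and> (\<forall>x g. \<bar>x - y\<bar> < d \<longrightarrow> g \<in> J1_nbhd (-1) (limit_path x) T d \<longrightarrow>
      \<bar>F (g, x) - F (limit_path x, x)\<bar> < e)" for y
  proof -
    let ?W = "{z \<in> topspace (prod_topology (skorokhod_J1 (-1)) euclideanreal). F z \<in> ball (F (limit_path y, y)) (e / 2)}"
    have "openin (prod_topology (skorokhod_J1 (-1)) euclideanreal) ?W"
    proof -
      have "openin euclideanreal (ball (F (limit_path y, y)) (e / 2))" by simp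
      then show ?thesis using F[unfolded continuous_map_def] by blast
    qed
    moreover have "(limit_path y, y) \<in> ?W" using e limit_path_cadlag by simp
    ultimately have "\<exists>U V. openin (skorokhod_J1 (-1)) U \<and> openin euclideanreal V \<and>
        limit_path y \<in> U \<and> y \<in> V \<and> U \<times> V \<subseteq> ?W"
      by (rule openin_prod_topology_alt[THEN iffD1, rule_format])
    then obtain U V where UV: "openin (skorokhod_J1 (-1)) U" "openin euclideanreal V"
      "limit_path y \<in> U" "y \<in> V" "U \<times> V \<subseteq> ?W"
      by blast
    obtain T d1 where d1: "0 < d1" "J1_nbhd (-1) (limit_path y) T d1 \<subseteq> U"
      using UV(1,3) unfolding openin_skorokhod_J1 by blast
    obtain d2 where d2: "0 < d2" "\<And>x. \<bar>x - y\<bar> < d2 \<Longrightarrow> x \<in> V"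
      using UV(2,4) by (auto simp: open_dist dist_real_def)
    \<comment> \<open>Half of d1 is reserved for moving the centre of the neighbourhood from x to
      y.\<close>
    define d where "d = min (d1 / 2) d2"
    have d: "0 < d" using d1 d2 by (simp add: d_def)
    have near: "\<bar>F (g, x) - F (limit_path y, y)\<bar> < e / 2"
      if "\<bar>x - y\<bar> < d" "g \<in> J1_nbhd (-1) (limit_path x) T d" for x g
    proof -
      have "g \<in> J1_nbhd (-1) (limit_path y) T d1"
      proof (rule J1_nbhd_perturb[OF that(2), of _ "d1 / 2"])
        show "\<bar>limit_path x t - limit_path y t\<bar> \<le> d1 / 2" if "-1 \<le> t" for t
          using limit_path_dist[OF that, of x y] \<open>\<bar>x - y\<bar> < d\<close> by (simp add: d_def)
      qed (use d1 in \<open>auto simp: d_def\<close>)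
      then have "g \<in> U" using d1 by blast
      moreover have "x \<in> V" using d2 that by (simp add: d_def)
      ultimately have "(g, x) \<in> ?W" using UV(5) by blast
      then show ?thesis by (auto simp: dist_real_def abs_minus_commute)
    qed
    have "\<bar>F (g, x) - F (limit_path x, x)\<bar> < e"
      if "\<bar>x - y\<bar> < d" "g \<in> J1_nbhd (-1) (limit_path x) T d" for x g
      using near[OF that] near[OF that(1) J1_nbhd_self[OF limit_path_cadlag d]] by linarith
    with d show ?thesis by blast
  qed
  then obtain T d where Td: "\<And>y. 0 < d y"
    "\<And>y x g. \<bar>x - y\<bar> < d y \<Longrightarrow> g \<in> J1_nbhd (-1) (limit_path x) (T y) (d y) \<Longrightarrow>
      \<bar>F (g, x) - F (limit_path x, x)\<bar> < e"
    by metis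
  have cover: "{a..b} \<subseteq> (\<Union>y\<in>{a..b}. ball y (d y))" using Td(1) by force
  obtain C where C: "C \<subseteq> {a..b}" "finite C" "{a..b} \<subseteq> (\<Union>y\<in>C. ball y (d y))"
    by (rule compactE_image[OF compact_Icc _ cover]) auto
  define \<delta> where "\<delta> = Min (insert 1 (d ` C))"
  define T' where "T' = Max (insert 0 (T ` C))"
  have "0 < \<delta>" using C Td(1) by (auto simp: \<delta>_def)
  moreover have "\<bar>F (g, x) - F (limit_path x, x)\<bar> < e"
    if x: "x \<in> {a..b}" and g: "g \<in> J1_nbhd (-1) (limit_path x) T' \<delta>" for x g
  proof -
    obtain y where y: "y \<in> C" "x \<in> ball y (d y)" using C x by blast
    have "T y \<le> T'" "\<delta> \<le> d y" using C y by (auto simp: T'_def \<delta>_def)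
    then have "g \<in> J1_nbhd (-1) (limit_path x) (T y) (d y)"
      using g J1_nbhd_mono by blast
    then show ?thesis using y by (intro Td(2)[of x y]) (auto simp: dist_real_def abs_minus_commute)
  qed
  ultimately show thesis by (rule that)
qed

text \<open>Time change of \<open>[-1, \<infinity>)\<close> that takes 0 to \<open>h\<close>, the time of the big jump.\<close>

definition shift_time :: "real \<Rightarrow> real \<Rightarrow> real" where
  "shift_time h t = (if t < 0 then t + (t + 1) * h else t + h)"

lemma shift_time:
  assumes "0 \<le> h"
  shows "shift_time h \<in> time_changes (-1)" "-1 \<le> t \<Longrightarrow> \<bar>shift_time h t - t\<bar> \<le> h"
proof -
  have mono: "strict_mono_on {-1..} (shift_time h)"
  proof (rule strict_mono_onI)
    fix r t :: real assume "r \<in> {-1..}" "t \<in> {-1..}" "r < t"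
    moreover have "r * h \<le> t * h" using \<open>r < t\<close> assms by (intro mult_right_mono) auto
    moreover have "r * h \<le> 0" if "r < 0" using that assms by (simp add: mult_le_0_iff)
    ultimately show "shift_time h r < shift_time h t"
      by (auto simp: shift_time_def algebra_simps)
  qed
  have "bij_betw (shift_time h) {-1..} {-1..}"
  proof (rule bij_betw_imageI)
    show "inj_on (shift_time h) {-1..}" using mono by (rule strict_mono_on_imp_inj_on)
    show "shift_time h ` {-1..} = {-1..}"
    proof (intro equalityI subsetI)
      fix s assume "s \<in> shift_time h ` {-1..}"
      then obtain t where t: "-1 \<le> t" "s = shift_time h t" by auto
      have "0 \<le> (t + 1) * h" using t assms by simp
      then have "t \<le> shift_time h t" using assms by (simp only: shift_time_def split: if_split) linarith
      then show "s \<in> {-1..}" using t by simp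
    next
      fix s :: real assume s: "s \<in> {-1..}"
      show "s \<in> shift_time h ` {-1..}"
      proof (cases "s < h")
        case True
        define t where "t = (s - h) / (1 + h)"
        have "-1 \<le> t" using s assms by (simp add: t_def field_simps)
        moreover have "t < 0" using True assms by (simp add: t_def field_simps)
        moreover have "t * (1 + h) = s - h" using assms by (simp add: t_def)
        ultimately show ?thesis by (intro image_eqI[of _ _ t]) (auto simp: shift_time_def algebra_simps)
      next
        case False
        then show ?thesis using assms by (intro image_eqI[of _ _ "s - h"]) (auto simp: shift_time_def)
      qed
    qed
  qed
  with mono show "shift_time h \<in> time_changes (-1)" by (simp add: time_changes_def)
  show "\<bar>shift_time h t - t\<bar> \<le> h" if "-1 \<le> t"
  proof (cases "t < 0")
    case True
    have "0 \<le> (t + 1) * h" using that assms by simp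
    moreover have "(t + 1) * h \<le> 1 * h"
      using True that assms by (intro mult_right_mono) auto
    ultimately show ?thesis using True by (simp add: shift_time_def)
  qed (use assms in \<open>simp add: shift_time_def\<close>)
qed

section \<open>Paths of good words\<close>

text \<open>The excursion is at -1 at time k, so the deviation bound at i compared with the one at k
  eliminates the unknown size of the jump. Error budget: \<eta> for the time shift, 2 e for the two
  deviations, 1 / b for ending at -1.\<close>

lemma good_word_path:
  assumes n: "0 < n" and b: "0 < b" and w: "degs \<tau> = take k w" "k \<le> length w" "tree_size \<tau> = k"
    and J: "J < k" "real J \<le> \<eta> * real n" and good: "\<not> bad_word D J (e * b) (b / real n) w"
    and small: "\<eta> + 2 * e + 1 / b < \<delta>" and e: "0 < e"
  shows "rescaled_path n b \<tau> \<in> J1_nbhd (-1) (limit_path (real k / real n)) T \<delta>"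
proof -
  have exc: "excursion (take k w)" using bij_betw_degs w(1) by (metis bij_betwE UNIV_I mem_Collect_eq)
  have steps_k: "steps (take k w) = -1" using exc by (simp add: excursion_def)
  have steps_nn: "0 \<le> steps (take i w)" if "i < k" for i
    using exc that w(2) by (auto simp: excursion_def dest!: spec[of _ i])
  have s: "surv 0 (take J w)" using steps_nn J w(2) by (auto simp: surv_iff)
  have "J \<le> length w" using J w(2) by simp
  obtain j where j: "j < J" "first_jump D j w" "\<And>i. i \<le> j \<Longrightarrow> real_of_int (steps (take i w)) < e * b"
    and dev: "\<And>i. j < i \<Longrightarrow> i \<le> length w \<Longrightarrow>
      \<bar>real_of_int (steps (take i w)) - real_of_int (steps (take (Suc j) w)) + real (i - Suc j) * (b / real n)\<bar> \<le> e * b"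
    by (rule good_wordE[OF s \<open>J \<le> length w\<close> good]) (rule that)
  \<comment> \<open>The jump is complete at step j + 1, which the time change makes time 0 of the
    limit path.\<close>
  define h where "h = real (Suc j) / real n"
  have h: "0 \<le> h" "h \<le> \<eta>"
  proof -
    show "0 \<le> h" by (simp add: h_def)
    have "real (Suc j) \<le> real J" using j(1) by simp
    also have "\<dots> \<le> \<eta> * real n" by (rule J)
    finally show "h \<le> \<eta>" using n by (simp add: h_def pos_divide_le_eq)
  qed
  define d where "d = \<eta> + 2 * e + 1 / b"
  have luk: "lukasiewicz \<tau> i = (if 0 \<le> i \<and> i \<le> int k then steps (take (nat i) w) else 0)" for i
    unfolding lukasiewicz_eq_steps w(1) using w(3) by (auto simp: min_def)
  have "\<bar>rescaled_path n b \<tau> (shift_time h t) - limit_path (real k / real n) t\<bar> \<le> d" if t: "-1 \<le> t" for t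
  proof -
    have st: "-1 \<le> shift_time h t"
      using shift_time(1)[OF h(1)] t by (auto simp: time_changes_def dest: bij_betwE)
    then have val: "rescaled_path n b \<tau> (shift_time h t) = real_of_int (lukasiewicz \<tau> \<lfloor>real n * shift_time h t\<rfloor>) / b"
      by (simp add: rescaled_path_def)
    show ?thesis
    proof (cases "t < 0")
      case True
      \<comment> \<open>Negative times are mapped before the completed jump, where the height is
        below e b and the limit path is 0.\<close>
      define m where "m = \<lfloor>real n * shift_time h t\<rfloor>"
      have "shift_time h t < h"
      proof -
        have "t * h \<le> 0" using True h by (simp add: mult_le_0_iff)
        then show ?thesis using True by (simp add: shift_time_def algebra_simps)
      qed
      then have "real n * shift_time h t < real n * h" using n by (intro mult_strict_left_mono) auto
      also have "\<dots> = real (Suc j)" using n by (simp add: h_def)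
      finally have m: "m < int (Suc j)" unfolding m_def by linarith
      have "\<bar>real_of_int (lukasiewicz \<tau> m)\<bar> \<le> e * b"
      proof (cases "0 \<le> m")
        case True
        then have "nat m \<le> j" using m by linarith
        then have "real_of_int (steps (take (nat m) w)) < e * b" "0 \<le> steps (take (nat m) w)"
          using j J by (auto intro: steps_nn)
        then show ?thesis using True \<open>nat m \<le> j\<close> j(1) J(1) by (auto simp: luk)
      qed (use e b in \<open>simp add: luk\<close>)
      then have "\<bar>real_of_int (lukasiewicz \<tau> m) / b\<bar> \<le> e" using b by (simp add: abs_divide pos_divide_le_eq)
      moreover have lp: "limit_path (real k / real n) t = 0" using True t by (simp add: limit_path_def)
      moreover have "0 < 1 / b" using b by simp
      ultimately show ?thesis unfolding val m_def[symmetric] d_def lp diff_zero using h e by linarith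
    next
      case False
      then have t0: "0 \<le> t" by simp
      define q where "q = nat \<lfloor>real n * t\<rfloor>"
      have q: "real q \<le> real n * t" "real n * t < real q + 1" using t0 n by (auto simp: q_def)
      have q': "real q / real n \<le> t" "t < real q / real n + 1 / real n"
        using q n by (auto simp: field_simps)
      define i where "i = Suc j + q"
      have "real n * shift_time h t = real n * t + real (Suc j)"
      proof -
        have "real n * h = real (Suc j)" using n by (simp add: h_def)
        then show ?thesis using False by (simp add: shift_time_def distrib_left)
      qed
      then have fl: "\<lfloor>real n * shift_time h t\<rfloor> = int i"
        using q by (simp add: i_def floor_eq_iff)
      have hn: "1 / real n \<le> h" using n by (simp add: h_def divide_right_mono)
      have i': "real i / real n = real q / real n + h" by (simp add: i_def h_def add_divide_distrib)
      show ?thesis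
      proof (cases "i \<le> k")
        case True
        have "\<bar>real_of_int (steps (take i w)) - real_of_int (steps (take (Suc j) w)) + real (i - Suc j) * (b / real n)\<bar> \<le> e * b"
          using True w(2) by (intro dev) (auto simp: i_def)
        moreover have "\<bar>real_of_int (steps (take k w)) - real_of_int (steps (take (Suc j) w)) + real (k - Suc j) * (b / real n)\<bar> \<le> e * b"
          using j J w(2) by (intro dev) auto
        moreover have "real (k - Suc j) * (b / real n) - real (i - Suc j) * (b / real n) = (real k - real i) * (b / real n)"
        proof -
          have "real (k - Suc j) - real (i - Suc j) = real k - real i"
            using j(1) J(1) by (simp add: i_def of_nat_diff)
          then show ?thesis by (simp only: left_diff_distrib[symmetric])
        qed
        ultimately have "\<bar>real_of_int (steps (take i w)) - ((real k - real i) * (b / real n) - 1)\<bar> \<le> 2 * e * b"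
          unfolding steps_k by (simp add: abs_le_iff)
        then have "\<bar>real_of_int (steps (take i w)) - ((real k - real i) * (b / real n) - 1)\<bar> / b \<le> 2 * e"
          using b by (simp add: pos_divide_le_eq)
        moreover have "\<bar>real_of_int (steps (take i w)) - ((real k - real i) * (b / real n) - 1)\<bar> / b =
            \<bar>real_of_int (steps (take i w)) / b - ((real k / real n - real i / real n) - 1 / b)\<bar>"
        proof -
          have "real_of_int (steps (take i w)) / b - ((real k / real n - real i / real n) - 1 / b) =
            (real_of_int (steps (take i w)) - ((real k - real i) * (b / real n) - 1)) / b"
            using b n by (simp add: field_simps)
          then show ?thesis using b by (simp add: abs_divide)
        qed
        ultimately have 1: "\<bar>real_of_int (steps (take i w)) / b - (real k / real n - real i / real n - 1 / b)\<bar> \<le> 2 * e"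
          by simp
        have "real n * t \<le> real k" using True q by (simp add: i_def)
        then have "limit_path (real k / real n) t = real k / real n - t"
          using t0 n by (simp add: limit_path_def pos_le_divide_eq mult.commute)
        moreover have "rescaled_path n b \<tau> (shift_time h t) = real_of_int (steps (take i w)) / b"
          unfolding val fl luk using True by simp
        moreover have "\<bar>real i / real n - t\<bar> \<le> h" unfolding i' using q' hn h by (simp add: abs_le_iff)
        moreover have "0 < 1 / b" using b by simp
        ultimately show ?thesis using 1 h unfolding d_def by (simp only: abs_le_iff) linarith
      next
        case F: False
        \<comment> \<open>The tree is already exhausted; by the time shift the limit path has height
          at most h left.\<close>
        have "real k \<le> real i" using F by simp
        then have "real k / real n \<le> real i / real n" by (rule divide_right_mono) simp
        then have "0 \<le> limit_path (real k / real n) t" "limit_path (real k / real n) t \<le> h"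
          using i' q' h t by (auto simp: limit_path_def)
        moreover have "rescaled_path n b \<tau> (shift_time h t) = 0"
          unfolding val fl luk using F by simp
        moreover have "0 < 1 / b" using b by simp
        ultimately show ?thesis using h e unfolding d_def by linarith
      qed
    qed
  qed
  moreover have "\<bar>shift_time h t - t\<bar> \<le> d" if "-1 \<le> t" for t
  proof -
    have "0 < 1 / b" using b by simp
    then show ?thesis using shift_time(2)[OF h(1) that] h e unfolding d_def by linarith
  qed
  moreover have "d < \<delta>" using small by (simp add: d_def)
  ultimately show ?thesis
    unfolding J1_nbhd_def
    by (intro CollectI conjI rescaled_path_cadlag bexI[of _ "shift_time h"] exI[of _ d] allI ballI impI
        shift_time(1)[OF h(1)]) auto
qed

section \<open>Convergence in distribution\<close>

lemma openin_Pow_topspace: "{U. openin S U} \<subseteq> Pow (topspace S)"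
  by (auto dest: openin_subset)

lemma measurable_borel_of:
  assumes "\<And>U. openin S U \<Longrightarrow> X -` U \<inter> space M \<in> sets M" "X \<in> space M \<rightarrow> topspace S"
  shows "X \<in> M \<rightarrow>\<^sub>M borel_of S"
  unfolding borel_of_def
  using assms by (intro measurable_measure_of openin_Pow_topspace) auto

lemma measurable_borel_of_continuous_map:
  fixes J :: "'w \<Rightarrow> real"
  assumes "continuous_map euclideanreal S \<phi>" "J \<in> borel_measurable M"
  shows "(\<lambda>\<omega>. \<phi> (J \<omega>)) \<in> M \<rightarrow>\<^sub>M borel_of S"
proof (rule measurable_borel_of)
  fix U assume "openin S U"
  then have "open {x. \<phi> x \<in> U}" using assms(1) by (auto simp: continuous_map_def)
  then have "J -` {x. \<phi> x \<in> U} \<inter> space M \<in> sets M"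
    using assms(2) by (intro measurable_sets[of J M borel]) auto
  then show "(\<lambda>\<omega>. \<phi> (J \<omega>)) -` U \<inter> space M \<in> sets M" by (simp add: vimage_def)
qed (use assms(1) in \<open>auto simp: continuous_map_def\<close>)

section \<open>The tree conditioned on its size\<close>

text \<open>A first letter of at least n + 1 lifts the walk to n, from where the remaining steps
  cannot bring it below 0. The conditioning event thus has positive mass for every n.\<close>

lemma surv_prob_pos:
  assumes "\<And>x. 0 < tail p x"
  shows "0 < surv_prob p n"
proof (cases n)
  case (Suc m)
  have "0 < tail p (real (Suc n))" by (rule assms)
  also have "\<dots> = word_prob p n {w. w ! 0 \<in> {k. real (Suc n) \<le> real k}}"
    using prob_replicate_split[of 0 n p UNIV "{k. real (Suc n) \<le> real k}" UNIV] Suc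
    by (simp add: tail_def measure_pmf.prob_space[simplified])
  also have "\<dots> \<le> surv_prob p n"
    unfolding surv_prob_def
  proof (rule measure_pmf.finite_measure_mono_AE)
    show "AE w in measure_pmf (replicate_pmf n p).
        w \<in> {w. w ! 0 \<in> {k. real (Suc n) \<le> real k}} \<longrightarrow> w \<in> {w. surv 0 w}"
      using AE_replicate_length[of n p]
    proof eventually_elim
      case (elim w)
      have "0 \<le> steps (take i w)" if "Suc n \<le> w ! 0" "i \<le> n" for i
      proof (cases i)
        case (Suc i')
        obtain k v where w: "w = k # v" using elim \<open>n = Suc m\<close> by (cases w) auto
        show ?thesis using Suc that w steps_ge[of "take i' v"] by auto
      qed simp
      then show ?case using elim by (auto simp: surv_iff)
    qed
  qed auto
  finally show ?thesis .
qed simp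

lemma surv_prob_antimono: "m \<le> n \<Longrightarrow> surv_prob p n \<le> surv_prob p m"
proof (induction rule: dec_induct)
  case (step k)
  have "0 \<le> surv_prob p k - surv_prob p (Suc k)"
    unfolding prob_excursion[symmetric] by simp
  then show ?case using step by linarith
qed simp

text \<open>A strict tail lies between the weak tails at x and at points slightly above x, and 1 / x
  is continuous. For constant sequences this gives the strict tails of J.\<close>

lemma strict_tail_limit:
  fixes P Q :: "nat \<Rightarrow> real \<Rightarrow> real"
  assumes QP: "\<And>n x. Q n x \<le> P n x" and PQ: "\<And>n x y. x < y \<Longrightarrow> P n y \<le> Q n x"
    and lim: "\<And>x. 1 \<le> x \<Longrightarrow> (\<lambda>n. P n x) \<longlonglongrightarrow> 1 / x" and x: "1 \<le> x"
  shows "(\<lambda>n. Q n x) \<longlonglongrightarrow> 1 / x"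
proof (rule order_tendstoI)
  fix u assume "1 / x < u"
  with lim[OF x] have "\<forall>\<^sub>F n in sequentially. P n x < u" by (rule order_tendstoD)
  then show "\<forall>\<^sub>F n in sequentially. Q n x < u"
    by eventually_elim (use QP in \<open>blast intro: le_less_trans\<close>)
next
  fix u assume u: "u < 1 / x"
  have "((\<lambda>y. 1 / y) \<longlongrightarrow> 1 / x) (at_right x)"
    using x by (intro tendsto_intros) auto
  then have "\<forall>\<^sub>F y in at_right x. u < 1 / y" using u by (rule order_tendstoD)
  then have "\<forall>\<^sub>F y in at_right x. x < y \<and> u < 1 / y"
    using eventually_at_right_less[of x] by eventually_elim auto
  then obtain y where y: "x < y" "u < 1 / y"
    using eventually_happens'[OF trivial_limit_at_right_real] by blast
  have "1 \<le> y" using x y by linarith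
  from lim[OF this] y(2) have "\<forall>\<^sub>F n in sequentially. u < P n y" by (rule order_tendstoD)
  then show "\<forall>\<^sub>F n in sequentially. u < Q n x"
    by eventually_elim (use PQ[OF y(1)] in \<open>blast intro: less_le_trans\<close>)
qed

context cauchy_scaling
begin

lemma surv_prob_tendsto_0: "(\<lambda>n. surv_prob p n) \<longlonglongrightarrow> 0"
proof -
  have "(\<lambda>n. surv_prob p (n - 1) / f n * f n) \<longlonglongrightarrow> (1 / 1) * 0"
    using surv_prob_tendsto[of 1] by (intro tendsto_mult f_tendsto) simp
  moreover have "\<forall>\<^sub>F n in sequentially. surv_prob p (n - 1) / f n * f n = surv_prob p (n - 1)"
    using f_pos by eventually_elim simp
  ultimately have "(\<lambda>n. surv_prob p (n - 1)) \<longlonglongrightarrow> 0" by (simp add: tendsto_cong)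
  from LIMSEQ_Suc[OF this] show ?thesis by simp
qed

lemma emeasure_BGW_ge_neq:
  "emeasure (BGW p) {\<tau>. n \<le> tree_size \<tau>} \<noteq> 0" "emeasure (BGW p) {\<tau>. n \<le> tree_size \<tau>} \<noteq> \<infinity>"
proof -
  interpret prob_space "BGW p" by (rule prob_space_BGW[OF surv_prob_tendsto_0])
  show "emeasure (BGW p) {\<tau>. n \<le> tree_size \<tau>} \<noteq> 0" "emeasure (BGW p) {\<tau>. n \<le> tree_size \<tau>} \<noteq> \<infinity>"
    using measure_BGW_size_ge[OF surv_prob_tendsto_0, of n] surv_prob_pos[OF tail_pos, of "n - 1"]
    by (auto simp: emeasure_eq_measure)
qed

lemma prob_space_BGW_ge: "prob_space (BGW_ge p n)"
  unfolding BGW_ge_def using emeasure_BGW_ge_neq by (rule prob_space_uniform_measure)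

lemma sets_BGW_ge: "sets (BGW_ge p n) = UNIV" "space (BGW_ge p n) = UNIV"
  by (simp_all add: BGW_ge_def)

lemma measure_BGW_ge:
  "measure (BGW_ge p n) X = measure (BGW p) ({\<tau>. n \<le> tree_size \<tau>} \<inter> X) / surv_prob p (n - 1)"
  unfolding BGW_ge_def measure_BGW_size_ge[OF surv_prob_tendsto_0, of n, symmetric]
  by (rule measure_uniform_measure[OF emeasure_BGW_ge_neq]) simp

text \<open>For x \<ge> 1 the event size \<ge> x n lies inside the conditioning event, so the
  conditional probability is a quotient of two survival probabilities and f cancels.\<close>

lemma BGW_ge_size_tendsto:
  assumes x: "1 \<le> x"
  shows "(\<lambda>n. measure (BGW_ge p n) {\<tau>. x \<le> real (tree_size \<tau>) / real n}) \<longlonglongrightarrow> 1 / x"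
proof -
  have "(\<lambda>n. (surv_prob p (nat \<lceil>x * real n\<rceil> - 1) / f n) / (surv_prob p (nat \<lceil>1 * real n\<rceil> - 1) / f n)) \<longlonglongrightarrow> (1 / x) / (1 / 1)"
    by (intro tendsto_divide surv_prob_tendsto x) auto
  moreover have "\<forall>\<^sub>F n in sequentially. (surv_prob p (nat \<lceil>x * real n\<rceil> - 1) / f n) / (surv_prob p (nat \<lceil>1 * real n\<rceil> - 1) / f n) =
      measure (BGW_ge p n) {\<tau>. x \<le> real (tree_size \<tau>) / real n}"
    using f_pos eventually_gt_at_top[of 0]
  proof eventually_elim
    case (elim n)
    have "n \<le> m \<and> x \<le> real m / real n \<longleftrightarrow> nat \<lceil>x * real n\<rceil> \<le> m" for m
    proof -
      have "x \<le> real m / real n \<longleftrightarrow> nat \<lceil>x * real n\<rceil> \<le> m"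
        using elim by (simp add: pos_le_divide_eq nat_le_iff ceiling_le_iff)
      moreover have "n \<le> m" if "x \<le> real m / real n"
      proof -
        have "1 \<le> real m / real n" using that x by linarith
        then show ?thesis using elim by (simp add: pos_le_divide_eq)
      qed
      ultimately show ?thesis by blast
    qed
    then have eq: "{\<tau>. n \<le> tree_size \<tau>} \<inter> {\<tau>. x \<le> real (tree_size \<tau>) / real n} = {\<tau>. nat \<lceil>x * real n\<rceil> \<le> tree_size \<tau>}"
      by auto
    have "nat \<lceil>1 * real n\<rceil> = n" by simp
    then show ?case
      unfolding measure_BGW_ge eq measure_BGW_size_ge[OF surv_prob_tendsto_0] using elim(1) by simp
  qed
  ultimately show ?thesis by (simp add: tendsto_cong)
qed

text \<open>Conditioning divides by a probability asymptotic to f, which is why bad words were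
  measured relative to f. Sizes above K n are cut off and cost 1 / K in the limit.\<close>

lemma BGW_ge_bad_path:
  assumes \<delta>: "0 < \<delta>" and K: "0 < K" and r: "1 / real K < r"
  shows "\<forall>\<^sub>F n in sequentially. measure (BGW_ge p n)
    {\<tau>. real K < real (tree_size \<tau>) / real n \<or>
      rescaled_path n (B n) \<tau> \<notin> J1_nbhd (-1) (limit_path (real (tree_size \<tau>) / real n)) T \<delta>} < r"
proof -
  \<comment> \<open>With 1 / B \<le> \<delta> / 4, the budget \<eta> + 2 e + 1 / B is at most 3
    \<delta> / 4.\<close>
  define \<eta>' where "\<eta>' = min (1 / 2) (\<delta> / 4)"
  define e' where "e' = \<delta> / 8"
  interpret jump_scale p B \<eta>' e' K by unfold_locales (use \<delta> K in \<open>auto simp: \<eta>'_def e'_def\<close>)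
  let ?bad = "\<lambda>n. word_prob p (K * n) {w. bad_word (D n) (J n) (A n) (c n) w}"
  have "(\<lambda>n. (?bad n / f n + surv_prob p (nat \<lceil>real K * real n\<rceil> - 1) / f n) /
      (surv_prob p (nat \<lceil>1 * real n\<rceil> - 1) / f n)) \<longlonglongrightarrow> (0 + 1 / real K) / (1 / 1)"
    using K by (intro tendsto_divide tendsto_add bad_word_negligible surv_prob_tendsto) auto
  then have "\<forall>\<^sub>F n in sequentially. (?bad n / f n + surv_prob p (nat \<lceil>real K * real n\<rceil> - 1) / f n) /
      (surv_prob p (nat \<lceil>1 * real n\<rceil> - 1) / f n) < r"
    by (rule order_tendstoD) (use r in simp)
  then show ?thesis
    using f_pos eventually_gt_at_top[of 0] B_ge[of "4 / \<delta>"] B_ge[of 1] J_bounds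
  proof eventually_elim
    case (elim n)
    define P where "P \<tau> \<longleftrightarrow> rescaled_path n (B n) \<tau> \<notin> J1_nbhd (-1) (limit_path (real (tree_size \<tau>) / real n)) T \<delta>" for \<tau>
    \<comment> \<open>Transports the path event from the tree to its word, where word probabilities
      apply.\<close>
    define Q where "Q u \<longleftrightarrow> (\<exists>\<tau>. degs \<tau> = u \<and> P \<tau>)" for u
    interpret bgw: prob_space "BGW p" by (rule prob_space_BGW[OF surv_prob_tendsto_0])
    have "measure (BGW p) ({\<tau>. n \<le> tree_size \<tau>} \<inter> {\<tau>. real K < real (tree_size \<tau>) / real n \<or> P \<tau>}) \<le>
        measure (BGW p) ({\<tau>. n \<le> tree_size \<tau> \<and> tree_size \<tau> \<le> K * n \<and> Q (degs \<tau>)} \<union> {\<tau>. K * n + 1 \<le> tree_size \<tau>})"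
    proof (rule bgw.finite_measure_mono)
      show "{\<tau>. n \<le> tree_size \<tau>} \<inter> {\<tau>. real K < real (tree_size \<tau>) / real n \<or> P \<tau>} \<subseteq>
        {\<tau>. n \<le> tree_size \<tau> \<and> tree_size \<tau> \<le> K * n \<and> Q (degs \<tau>)} \<union> {\<tau>. K * n + 1 \<le> tree_size \<tau>}"
      proof (intro subsetI)
        fix \<tau> assume \<tau>: "\<tau> \<in> {\<tau>. n \<le> tree_size \<tau>} \<inter> {\<tau>. real K < real (tree_size \<tau>) / real n \<or> P \<tau>}"
        show "\<tau> \<in> {\<tau>. n \<le> tree_size \<tau> \<and> tree_size \<tau> \<le> K * n \<and> Q (degs \<tau>)} \<union> {\<tau>. K * n + 1 \<le> tree_size \<tau>}"
        proof (cases "K * n + 1 \<le> tree_size \<tau>")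
          case False
          then have "real (tree_size \<tau>) \<le> real (K * n)" by (simp only: of_nat_le_iff)
          then have "\<not> real K < real (tree_size \<tau>) / real n"
            using elim by (simp add: pos_less_divide_eq)
          then show ?thesis using \<tau> False by (auto simp: Q_def)
        qed simp
      qed
    qed simp
    also have "\<dots> \<le> measure (BGW p) {\<tau>. n \<le> tree_size \<tau> \<and> tree_size \<tau> \<le> K * n \<and> Q (degs \<tau>)} +
        measure (BGW p) {\<tau>. K * n + 1 \<le> tree_size \<tau>}"
      by (rule measure_Un_le) auto
    also have "measure (BGW p) {\<tau>. K * n + 1 \<le> tree_size \<tau>} \<le> surv_prob p (nat \<lceil>real K * real n\<rceil> - 1)"
    proof -
      have "\<lceil>real K * real n\<rceil> = int (K * n)" by (metis ceiling_of_nat of_nat_mult)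
      then show ?thesis
        unfolding measure_BGW_size_ge[OF surv_prob_tendsto_0] by (simp add: surv_prob_antimono nat_mult_distrib)
    qed
    also have "measure (BGW p) {\<tau>. n \<le> tree_size \<tau> \<and> tree_size \<tau> \<le> K * n \<and> Q (degs \<tau>)} \<le>
        word_prob p (K * n) {w. \<exists>k\<in>{n..K * n}. excursion (take k w) \<and> Q (take k w)}"
      by (rule measure_BGW_size_between_le[OF surv_prob_tendsto_0])
    also have "\<dots> \<le> ?bad n"
    proof (rule measure_pmf.finite_measure_mono_AE)
      show "AE w in measure_pmf (replicate_pmf (K * n) p).
        w \<in> {w. \<exists>k\<in>{n..K * n}. excursion (take k w) \<and> Q (take k w)} \<longrightarrow>
        w \<in> {w. bad_word (D n) (J n) (A n) (c n) w}"
      proof (rule eventually_mono[OF AE_replicate_length[of "K * n" p]], rule impI)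
        fix w :: "nat list"
        assume len: "length w = K * n" and "w \<in> {w. \<exists>k\<in>{n..K * n}. excursion (take k w) \<and> Q (take k w)}"
        then obtain k \<tau> where k: "n \<le> k" "k \<le> K * n" and \<tau>: "degs \<tau> = take k w" "P \<tau>"
          by (auto simp: Q_def)
        have size: "tree_size \<tau> = k"
          using length_degs[of \<tau>] \<tau>(1) k len by simp
        have Jn: "J n < n"
        proof -
          have "real (J n) \<le> \<eta>' * real n" using elim by blast
          also have "\<dots> < 1 * real n" using elim \<eta> by (intro mult_strict_right_mono) auto
          finally show ?thesis by simp
        qed
        have "bad_word (D n) (J n) (e' * B n) (B n / real n) w"
        proof (rule ccontr)
          assume good: "\<not> bad_word (D n) (J n) (e' * B n) (B n / real n) w"
          have "rescaled_path n (B n) \<tau> \<in> J1_nbhd (-1) (limit_path (real k / real n)) T \<delta>"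
          proof (rule good_word_path[OF _ _ \<tau>(1) _ size _ _ good])
            have "1 / B n \<le> \<delta> / 4" using elim \<delta> by (simp add: field_simps)
            moreover have "\<eta>' \<le> \<delta> / 4" by (simp add: \<eta>'_def)
            ultimately show "\<eta>' + 2 * e' + 1 / B n < \<delta>" using \<delta> by (simp add: e'_def)
            show "real (J n) \<le> \<eta>' * real n" using elim by blast
          qed (use elim k len Jn e in auto)
          then show False using \<tau>(2) size by (simp add: P_def)
        qed
        then show "w \<in> {w. bad_word (D n) (J n) (A n) (c n) w}"
          by (simp add: A_def c_def)
      qed
    qed simp
    finally have *: "measure (BGW p) ({\<tau>. n \<le> tree_size \<tau>} \<inter> {\<tau>. real K < real (tree_size \<tau>) / real n \<or> P \<tau>}) \<le>
        ?bad n + surv_prob p (nat \<lceil>real K * real n\<rceil> - 1)" by simp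
    have "measure (BGW_ge p n) {\<tau>. real K < real (tree_size \<tau>) / real n \<or> P \<tau>} \<le>
        (?bad n + surv_prob p (nat \<lceil>real K * real n\<rceil> - 1)) / surv_prob p (n - 1)"
      unfolding measure_BGW_ge using * surv_prob_nonneg by (rule divide_right_mono)
    also have "\<dots> = (?bad n / f n + surv_prob p (nat \<lceil>real K * real n\<rceil> - 1) / f n) /
      (surv_prob p (nat \<lceil>1 * real n\<rceil> - 1) / f n)"
    proof -
      have "nat \<lceil>1 * real n\<rceil> = n" by simp
      then show ?thesis using elim(2) by (simp add: add_divide_distrib[symmetric])
    qed
    also have "\<dots> < r" by (rule elim)
    finally show ?case unfolding P_def .
  qed
qed

theorem converges_in_distribution_pair:
  fixes N :: "'w measure" and J :: "'w \<Rightarrow> real"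
  assumes N: "prob_space N" and J: "J \<in> borel_measurable N"
    and tailJ: "\<And>x. x \<ge> 1 \<Longrightarrow> measure N {\<omega> \<in> space N. J \<omega> \<ge> x} = 1 / x"
  shows "converges_in_distribution (prod_topology (skorokhod_J1 (-1)) euclideanreal)
      (BGW_ge p) (\<lambda>n \<tau>. (rescaled_path n (B n) \<tau>, real (tree_size \<tau>) / real n))
      N (\<lambda>\<omega>. (limit_path (J \<omega>), J \<omega>))"
    (is "converges_in_distribution ?S _ _ _ _")
  unfolding converges_in_distribution_def random_element_def
proof (intro conjI allI impI)
  show "prob_space N" by (rule N)
  show "prob_space (BGW_ge p n)" for n by (rule prob_space_BGW_ge)
  show "(\<lambda>\<tau>. (rescaled_path n (B n) \<tau>, real (tree_size \<tau>) / real n)) \<in> BGW_ge p n \<rightarrow>\<^sub>M borel_of ?S" for n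
    by (rule measurable_borel_of) (auto simp: sets_BGW_ge rescaled_path_cadlag)
  show "(\<lambda>\<omega>. (limit_path (J \<omega>), J \<omega>)) \<in> N \<rightarrow>\<^sub>M borel_of ?S"
    by (rule measurable_borel_of_continuous_map[OF continuous_map_limit_pair J])
  fix F assume "continuous_map ?S euclideanreal F \<and> bounded (F ` topspace ?S)"
  then have F: "continuous_map ?S euclideanreal F" and "bounded (F ` topspace ?S)" by auto
  then obtain C0 where "\<forall>y\<in>F ` topspace ?S. norm y \<le> C0" unfolding bounded_iff by blast
  \<comment> \<open>The maximum with 1 keeps C positive for the division in r.\<close>
  define C where "C = max C0 1"
  have C: "0 < C" "\<And>z. z \<in> topspace ?S \<Longrightarrow> \<bar>F z\<bar> \<le> C"
  proof -
    show "0 < C" by (simp add: C_def)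
    fix z assume "z \<in> topspace ?S"
    then have "norm (F z) \<le> C0" using \<open>\<forall>y\<in>F ` topspace ?S. norm y \<le> C0\<close> by blast
    then show "\<bar>F z\<bar> \<le> C" by (simp add: C_def)
  qed
  define G where "G x = F (limit_path x, x)" for x
  define Z where "Z n \<tau> = real (tree_size \<tau>) / real n" for n \<tau>
  define X where "X n \<tau> = rescaled_path n (B n) \<tau>" for n \<tau>
  have Gb: "\<bar>G x\<bar> \<le> C" for x unfolding G_def by (rule C) (simp add: limit_path_cadlag)
  have Fb: "\<bar>F (X n \<tau>, Z n \<tau>)\<bar> \<le> C" for n \<tau>
    by (rule C) (simp add: X_def rescaled_path_cadlag)
  have Gcont: "isCont G x" for x
  proof -
    have "continuous_map euclideanreal euclideanreal (F \<circ> (\<lambda>x. (limit_path x, x)))"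
      by (rule continuous_map_compose[OF continuous_map_limit_pair F])
    then have "continuous_on UNIV G" by (simp add: G_def[abs_def] comp_def)
    then show ?thesis by (simp add: continuous_on_eq_continuous_at)
  qed
  have G_meas: "G \<in> borel_measurable borel"
    using Gcont by (intro borel_measurable_continuous_onI continuous_at_imp_continuous_on) auto
  have Z_meas: "Z n \<in> borel_measurable (BGW_ge p n)" for n
    by (simp add: measurable_def sets_BGW_ge)
  interpret N: prob_space N by (rule N)
  have "(\<lambda>n. \<integral>x. G x \<partial>distr (BGW_ge p n) borel (Z n)) \<longlonglongrightarrow> (\<integral>x. G x \<partial>distr N borel J)"
  proof (rule weak_conv_imp_integral_bdd_continuous_conv[OF _ _ _ Gcont])
    show "real_distribution (distr (BGW_ge p n) borel (Z n))" for n
      using prob_space.prob_space_distr[OF prob_space_BGW_ge Z_meas]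
      by (simp add: real_distribution_def real_distribution_axioms_def)
    show "real_distribution (distr N borel J)"
      using N.prob_space_distr[OF J] by (simp add: real_distribution_def real_distribution_axioms_def)
    show "norm (G x) \<le> C" for x using Gb by simp
    have cdf_n: "cdf (distr (BGW_ge p n) borel (Z n)) x = 1 - measure (BGW_ge p n) {\<tau>. x < Z n \<tau>}" for n x
    proof -
      interpret prob_space "BGW_ge p n" by (rule prob_space_BGW_ge)
      have "{\<tau>. Z n \<tau> \<le> x} = space (BGW_ge p n) - {\<tau>. x < Z n \<tau>}" by (auto simp: sets_BGW_ge)
      then have "measure (BGW_ge p n) {\<tau>. Z n \<tau> \<le> x} = 1 - measure (BGW_ge p n) {\<tau>. x < Z n \<tau>}"
        by (simp only:) (rule prob_compl, simp add: sets_BGW_ge)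
      then show ?thesis
        using Z_meas by (simp add: cdf_def measure_distr vimage_def sets_BGW_ge)
    qed
    have cdf_J: "cdf (distr N borel J) x = 1 - measure N {\<omega> \<in> space N. x < J \<omega>}" for x
    proof -
      have "{\<omega> \<in> space N. J \<omega> \<le> x} = space N - {\<omega> \<in> space N. x < J \<omega>}" by auto
      moreover have "{\<omega> \<in> space N. x < J \<omega>} \<in> sets N" using J by measurable
      ultimately have "measure N {\<omega> \<in> space N. J \<omega> \<le> x} = 1 - measure N {\<omega> \<in> space N. x < J \<omega>}"
        by (simp add: N.prob_compl)
      moreover have "J -` {..x} \<inter> space N = {\<omega> \<in> space N. J \<omega> \<le> x}" by auto
      ultimately show ?thesis using J by (simp add: cdf_def measure_distr)
    qed
    show "weak_conv_m (\<lambda>n. distr (BGW_ge p n) borel (Z n)) (distr N borel J)"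
      unfolding weak_conv_m_def weak_conv_def
    proof (intro allI impI)
      fix x :: real
      show "(\<lambda>n. cdf (distr (BGW_ge p n) borel (Z n)) x) \<longlonglongrightarrow> cdf (distr N borel J) x"
      \<comment> \<open>Below 1 both distribution functions vanish for n > 0: J \<ge> 1 almost
        surely, and the conditioned size is at least n.\<close>
      proof (cases "1 \<le> x")
        case True
        have 1: "(\<lambda>n. measure (BGW_ge p n) {\<tau>. x < Z n \<tau>}) \<longlonglongrightarrow> 1 / x"
        proof (rule strict_tail_limit[OF _ _ _ True])
          fix n and x y :: real
          interpret prob_space "BGW_ge p n" by (rule prob_space_BGW_ge)
          show "measure (BGW_ge p n) {\<tau>. x < Z n \<tau>} \<le> measure (BGW_ge p n) {\<tau>. x \<le> Z n \<tau>}"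
            by (intro finite_measure_mono) (auto simp: sets_BGW_ge)
          show "measure (BGW_ge p n) {\<tau>. y \<le> Z n \<tau>} \<le> measure (BGW_ge p n) {\<tau>. x < Z n \<tau>}" if "x < y"
            using that by (intro finite_measure_mono) (auto simp: sets_BGW_ge)
        next
          show "(\<lambda>n. measure (BGW_ge p n) {\<tau>. x \<le> Z n \<tau>}) \<longlonglongrightarrow> 1 / x" if "1 \<le> x" for x
            unfolding Z_def using that by (rule BGW_ge_size_tendsto)
        qed
        have "(\<lambda>n::nat. measure N {\<omega> \<in> space N. x < J \<omega>}) \<longlonglongrightarrow> 1 / x"
        proof (rule strict_tail_limit[OF _ _ _ True])
          fix x y :: real
          show "measure N {\<omega> \<in> space N. x < J \<omega>} \<le> measure N {\<omega> \<in> space N. x \<le> J \<omega>}"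
            using J by (intro N.finite_measure_mono) auto
          show "measure N {\<omega> \<in> space N. y \<le> J \<omega>} \<le> measure N {\<omega> \<in> space N. x < J \<omega>}" if "x < y"
            using J that by (intro N.finite_measure_mono) auto
        next
          show "(\<lambda>n::nat. measure N {\<omega> \<in> space N. x \<le> J \<omega>}) \<longlonglongrightarrow> 1 / x" if "1 \<le> x" for x
            using tailJ[OF that] by simp
        qed
        then have 2: "measure N {\<omega> \<in> space N. x < J \<omega>} = 1 / x" by (simp add: LIMSEQ_const_iff)
        show ?thesis unfolding cdf_n cdf_J 2 by (intro tendsto_intros 1)
      next
        case False
        have "measure N {\<omega> \<in> space N. x < J \<omega>} \<ge> measure N {\<omega> \<in> space N. 1 \<le> J \<omega>}"
          using J False by (intro N.finite_measure_mono) auto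
        then have 2: "measure N {\<omega> \<in> space N. x < J \<omega>} = 1"
          using tailJ[of 1] by (intro antisym) auto
        have "\<forall>\<^sub>F n in sequentially. measure (BGW_ge p n) {\<tau>. x < Z n \<tau>} = 1"
          using eventually_gt_at_top[of 0]
        proof eventually_elim
          case (elim n)
          have "{\<tau>. n \<le> tree_size \<tau>} \<inter> {\<tau>. x < Z n \<tau>} = {\<tau>. n \<le> tree_size \<tau>}"
            using False elim by (auto simp: Z_def pos_less_divide_eq)
              (smt (verit) mult_le_cancel_right1 of_nat_0_less_iff of_nat_le_iff)
          then show ?case
            using surv_prob_pos[OF tail_pos, of "n - 1"]
            by (simp add: measure_BGW_ge measure_BGW_size_ge[OF surv_prob_tendsto_0])
        qed
        then have "\<forall>\<^sub>F n in sequentially. cdf (distr (BGW_ge p n) borel (Z n)) x = cdf (distr N borel J) x"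
          unfolding cdf_n cdf_J 2 by eventually_elim simp
        then show ?thesis by (rule tendsto_eventually)
      qed
    qed
  qed
  then have conv: "(\<lambda>n. \<integral>\<tau>. G (Z n \<tau>) \<partial>BGW_ge p n) \<longlonglongrightarrow> (\<integral>\<omega>. G (J \<omega>) \<partial>N)"
    using J Z_meas G_meas by (simp add: integral_distr)
  have "(\<lambda>n. (\<integral>\<tau>. F (X n \<tau>, Z n \<tau>) \<partial>BGW_ge p n) - (\<integral>\<tau>. G (Z n \<tau>) \<partial>BGW_ge p n)) \<longlonglongrightarrow> 0"
    unfolding tendsto_iff dist_real_def
  proof (intro allI impI)
    fix e :: real assume e: "0 < e"
    \<comment> \<open>On the exceptional set the two integrands differ by at most 2 C, so mass r
      costs e / 2.\<close>
    define r where "r = e / (4 * C)"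
    have r: "0 < r" using e C by (simp add: r_def)
    obtain K where K: "0 < K" "1 / real K < r" using nat_approx_posE[OF r] by (metis zero_less_Suc)
    obtain T \<delta> where \<delta>: "0 < \<delta>"
      "\<And>x g. x \<in> {0..real K} \<Longrightarrow> g \<in> J1_nbhd (-1) (limit_path x) T \<delta> \<Longrightarrow> \<bar>F (g, x) - F (limit_path x, x)\<bar> < e / 2"
      by (rule uniform_continuity_limit_path[OF F, of "e / 2" 0 "real K"]) (use e in auto)
    show "\<forall>\<^sub>F n in sequentially. \<bar>(\<integral>\<tau>. F (X n \<tau>, Z n \<tau>) \<partial>BGW_ge p n) - (\<integral>\<tau>. G (Z n \<tau>) \<partial>BGW_ge p n) - 0\<bar> < e"
      using BGW_ge_bad_path[OF \<delta>(1) K, of T]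
    proof eventually_elim
      case (elim n)
      interpret prob_space "BGW_ge p n" by (rule prob_space_BGW_ge)
      define W where "W = {\<tau>. real K < Z n \<tau> \<or> X n \<tau> \<notin> J1_nbhd (-1) (limit_path (Z n \<tau>)) T \<delta>}"
      have W: "measure (BGW_ge p n) W < r" using elim by (simp add: W_def X_def Z_def)
      have int: "integrable (BGW_ge p n) h" if "\<And>\<tau>. \<bar>h \<tau>\<bar> \<le> b" for h :: "plane_tree \<Rightarrow> real" and b
        using that by (intro integrable_const_bound[of _ b]) (auto simp: measurable_def sets_BGW_ge)
      have le: "\<bar>F (X n \<tau>, Z n \<tau>) - G (Z n \<tau>)\<bar> \<le> e / 2 + 2 * C * indicator W \<tau>" for \<tau>
      proof (cases "\<tau> \<in> W")
        case True
        then show ?thesis using Fb[of n \<tau>] Gb[of "Z n \<tau>"] e by simp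
      next
        case False
        then have "\<bar>F (X n \<tau>, Z n \<tau>) - G (Z n \<tau>)\<bar> < e / 2"
          unfolding G_def by (intro \<delta>(2)) (auto simp: W_def Z_def)
        then show ?thesis using False by simp
      qed
      have "\<bar>(\<integral>\<tau>. F (X n \<tau>, Z n \<tau>) \<partial>BGW_ge p n) - (\<integral>\<tau>. G (Z n \<tau>) \<partial>BGW_ge p n)\<bar> =
          \<bar>\<integral>\<tau>. F (X n \<tau>, Z n \<tau>) - G (Z n \<tau>) \<partial>BGW_ge p n\<bar>"
        using int[of "\<lambda>\<tau>. F (X n \<tau>, Z n \<tau>)" C] int[of "\<lambda>\<tau>. G (Z n \<tau>)" C] Fb Gb
        by (simp add: Bochner_Integration.integral_diff)
      also have "\<dots> \<le> (\<integral>\<tau>. \<bar>F (X n \<tau>, Z n \<tau>) - G (Z n \<tau>)\<bar> \<partial>BGW_ge p n)"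
        by (rule integral_abs_bound)
      also have "\<dots> \<le> (\<integral>\<tau>. e / 2 + 2 * C * indicator W \<tau> \<partial>BGW_ge p n)"
      proof (rule integral_mono)
        show "integrable (BGW_ge p n) (\<lambda>\<tau>. \<bar>F (X n \<tau>, Z n \<tau>) - G (Z n \<tau>)\<bar>)"
        proof (rule int[of _ "C + C"])
          show "\<bar>\<bar>F (X n \<tau>, Z n \<tau>) - G (Z n \<tau>)\<bar>\<bar> \<le> C + C" for \<tau>
            using Fb[of n \<tau>] Gb[of "Z n \<tau>"] by linarith
        qed
        show "integrable (BGW_ge p n) (\<lambda>\<tau>. e / 2 + 2 * C * indicator W \<tau>)"
          using e C by (intro int[of _ "e / 2 + 2 * C"]) (auto simp: indicator_def)
      qed (rule le)
      also have "\<dots> = e / 2 + 2 * C * measure (BGW_ge p n) W"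
      proof -
        have "measure (BGW_ge p n) UNIV = 1" using prob_space[unfolded sets_BGW_ge] .
        moreover have "integrable (BGW_ge p n) (indicator W :: plane_tree \<Rightarrow> real)"
          by (intro int[of _ 1]) (auto simp: indicator_def)
        ultimately show ?thesis by (simp add: sets_BGW_ge)
      qed
      also have "\<dots> < e / 2 + 2 * C * r" using W C by simp
      also have "\<dots> = e" using C by (simp add: r_def)
      finally show ?case by simp
    qed
  qed
  from tendsto_add[OF this conv]
  show "(\<lambda>n. \<integral>\<omega>. F (rescaled_path n (B n) \<omega>, real (tree_size \<omega>) / real n) \<partial>BGW_ge p n)
      \<longlonglongrightarrow> (\<integral>\<omega>. F (limit_path (J \<omega>), J \<omega>) \<partial>N)"
    by (simp add: G_def X_def Z_def)
qed

end

text \<open>Composition with the continuous first projection; measurability of the first component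
  is tested on cylinders over open sets.\<close>

lemma converges_in_distribution_fst:
  assumes "converges_in_distribution (prod_topology S S') M (\<lambda>n \<omega>. (X n \<omega>, X' n \<omega>)) N (\<lambda>\<omega>. (Y \<omega>, Y' \<omega>))"
  shows "converges_in_distribution S M X N Y"
proof -
  have fst: "continuous_map (prod_topology S S') S fst" by (rule continuous_map_fst)
  have meas: "g \<in> M \<rightarrow>\<^sub>M borel_of S" if "(\<lambda>\<omega>. (g \<omega>, h \<omega>)) \<in> M \<rightarrow>\<^sub>M borel_of (prod_topology S S')"
    for M :: "'e measure" and g h
  proof (rule measurable_borel_of)
    have sp: "space (borel_of (prod_topology S S')) = topspace (prod_topology S S')"
      unfolding borel_of_def by (rule space_measure_of[OF openin_Pow_topspace])
    show "g \<in> space M \<rightarrow> topspace S" using measurable_space[OF that] by (auto simp: sp)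
    fix U assume U: "openin S U"
    have "openin (prod_topology S S') (U \<times> topspace S')"
      using U by (simp add: openin_prod_Times_iff)
    then have "U \<times> topspace S' \<in> sets (borel_of (prod_topology S S'))"
      unfolding borel_of_def sets_measure_of[OF openin_Pow_topspace] by (auto intro: sigma_sets.Basic)
    from measurable_sets[OF that this]
    have "(\<lambda>\<omega>. (g \<omega>, h \<omega>)) -` (U \<times> topspace S') \<inter> space M \<in> sets M" .
    also have "(\<lambda>\<omega>. (g \<omega>, h \<omega>)) -` (U \<times> topspace S') \<inter> space M = g -` U \<inter> space M"
      using measurable_space[OF that] by (auto simp: sp)
    finally show "g -` U \<inter> space M \<in> sets M" .
  qed
  show ?thesis
    unfolding converges_in_distribution_def
  proof (intro conjI allI impI)
    show "random_element S (M n) (X n)" for n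
      using assms meas unfolding converges_in_distribution_def random_element_def by blast
    show "random_element S N Y"
      using assms meas unfolding converges_in_distribution_def random_element_def by blast
    fix F assume F: "continuous_map S euclideanreal F \<and> bounded (F ` topspace S)"
    have "continuous_map (prod_topology S S') euclideanreal (F \<circ> fst)"
      using F by (intro continuous_map_compose[OF fst]) auto
    moreover have "bounded ((F \<circ> fst) ` topspace (prod_topology S S'))"
      by (rule bounded_subset[of "F ` topspace S"]) (use F in auto)
    ultimately have "(\<lambda>n. \<integral>\<omega>. (F \<circ> fst) (X n \<omega>, X' n \<omega>) \<partial>M n) \<longlonglongrightarrow> (\<integral>\<omega>. (F \<circ> fst) (Y \<omega>, Y' \<omega>) \<partial>N)"
      using assms unfolding converges_in_distribution_def by blast
    then show "(\<lambda>n. \<integral>\<omega>. F (X n \<omega>) \<partial>M n) \<longlonglongrightarrow> (\<integral>\<omega>. F (Y \<omega>) \<partial>N)" by simp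
  qed
qed

theorem proposition31:
  fixes \<mu> :: "nat pmf" and L :: "real \<Rightarrow> real" and a b :: "nat \<Rightarrow> real"
    and N :: "'w measure" and J :: "'w \<Rightarrow> real"
  assumes "prob_space N" and "J \<in> borel_measurable N"
    and "\<And>x. x \<ge> 1 \<Longrightarrow> measure N {\<omega> \<in> space N. J \<omega> \<ge> x} = 1 / x"
    and "slowly_varying L"
    and "(\<lambda>i. real i * pmf \<mu> i) sums 1"
    and "(\<lambda>n. measure_pmf.prob \<mu> {n..}) \<sim>[sequentially] (\<lambda>n. L (real n) / real n)"
    and "(\<lambda>n. real n * measure_pmf.prob (step_pmf \<mu>) {x. real_of_int x \<ge> a n}) \<longlonglongrightarrow> 1"
    and "\<And>n. n \<ge> 1 \<Longrightarrow> b n = real n *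
      measure_pmf.expectation (step_pmf \<mu>)
        (\<lambda>x. real_of_int x * indicator {x. \<bar>real_of_int x\<bar> \<le> a n} x)"
  shows "converges_in_distribution (skorokhod_J1 (-1))
      (BGW_ge \<mu>) (\<lambda>n. rescaled_path n \<bar>b n\<bar>)
      N (\<lambda>\<omega>. limit_path (J \<omega>)) \<and>
    converges_in_distribution (prod_topology (skorokhod_J1 (-1)) euclideanreal)
      (BGW_ge \<mu>) (\<lambda>n \<tau>. (rescaled_path n \<bar>b n\<bar> \<tau>, real (tree_size \<tau>) / real n))
      N (\<lambda>\<omega>. (limit_path (J \<omega>), J \<omega>))"
proof -
  have "cauchy_scaling \<mu> (\<lambda>n. \<bar>b n\<bar>)"
    by (rule cauchy_scalingI[OF assms(4-8)])
  then have pair: "converges_in_distribution (prod_topology (skorokhod_J1 (-1)) euclideanreal)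
      (BGW_ge \<mu>) (\<lambda>n \<tau>. (rescaled_path n \<bar>b n\<bar> \<tau>, real (tree_size \<tau>) / real n))
      N (\<lambda>\<omega>. (limit_path (J \<omega>), J \<omega>))"
    by (rule cauchy_scaling.converges_in_distribution_pair[OF _ assms(1-3)])
  from converges_in_distribution_fst[OF pair] pair show ?thesis by blast
qed

end
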